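(* Let $N\ge 2$, $n\ge 1$, $V=\{1,\dots,N\}$, and let $a:[0,+\infty)\to[0,+\infty)$ be Lipschitz continuous, non-decreasing, with $a(r)>0$ for $r>0$. Consider the metric bounded confidence model $$\dot x_i=\sum_{j\in N_i^m(x)}a(\|x_j-x_i\|)(x_j-x_i),\quad i\in V,\qquad (\mathrm{M})$$ and, for $1\le\kappa\le N-1$, the topological bounded confidence model $$\dot x_i=\sum_{j\in N_i^t(x)}a(\|x_j-x_i\|)(x_j-x_i),\quad i\in V,\qquad (\mathrm{T})$$ with $x=(x_1,\dots,x_N)\in\mathbb{R}^{nN}$. Let properties P1 (average preservation), P2 (contractivity of the support) and P3 (convergence to cluster points) of a solution on $[0,+\infty)$ be as defined in the context. (i) Every Caratheodory solution and every Krasovsky solution of (M) satisfies P1, P2 and P3. (ii) Every Caratheodory solution and every Krasovsky solution of (T) satisfies P2. Caratheodory and Krasovsky solutions of (T) may fail to satisfy P1 and may fail to satisfy P3; that is, for each of the two notions of solution, there are choices of $N,n,\kappa,a$ and a solution of (T) that violates P1, and there are choices of $N,n,\kappa,a$ and a solution of (T) that violates P3. (iii) In addition to (ii), if $\kappa=1$, every Caratheodory solution of (T) satisfies P3.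
   Context: $\|\cdot\|$ is the Euclidean norm, and $x_i\in\mathbb{R}^n$ is the state of agent $i\in V$. Metric neighbors: $N_i^m(x)=\{j\in V:\|x_j-x_i\|<1\}$. Topological neighbors: for fixed $1\le\kappa\le N-1$, order the elements $j$ of $V\setminus\{i\}$ by increasing value of $\|x_j-x_i\|$, where ties are broken by giving priority to the agent with lower index; $N_i^t(x)$ is the set of the first $\kappa$ elements of this list. Each model is an autonomous ODE $\dot x=g(x)$ on $\mathbb{R}^{m}$, $m=nN$, with $g$ measurable, locally bounded and in general discontinuous. A Caratheodory solution on $[0,T]$ is an absolutely continuous $x:[0,T]\to\mathbb{R}^m$ with $\dot x(t)=g(x(t))$ for almost every $t\in[0,T]$. A Krasovsky solution on $[0,T]$ is an absolutely continuous $x:[0,T]\to\mathbb{R}^m$ with $\dot x(t)\in K(x(t))$ for almost every $t\in[0,T]$, where $$K(x)=\bigcap_{\delta>0}\overline{co}\,\{g(y):\ \|y-x\|<\delta\}$$ and $\overline{co}$ denotes the closed convex hull. A function on $[0,+\infty)$ is a solution (in either sense) if its restriction to every $[0,T]$, $T>0$, is. Properties of a solution $x(t)=(x_1(t),\dots,x_N(t))$, $t\in[0,+\infty)$: P1 (average preservation): $x_{ave}(t)=\frac1N\sum_{i}x_i(t)$ is constant in $t$. P2 (contractivity of the support): for all $T^2\ge T^1\ge 0$, $\overline{co}(\{x_1(T^1),\dots,x_N(T^1)\})\supseteq\overline{co}(\{x_1(T^2),\dots,x_N(T^2)\})$. P3 (convergence to cluster points): $x(t)$ converges as $t\to+\infty$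 to a cluster point, i.e. to a point $x^\infty=(x_1^\infty,\dots,x_N^\infty)\in\mathbb{R}^{nN}$ such that for every $i\in V$ and every $j\in N_i(x^\infty)$ one has $x_i^\infty=x_j^\infty$, where $N_i=N_i^m$ for model (M) and $N_i=N_i^t$ for model (T). *)

theory Defs
  imports "HOL-Analysis.Analysis" "HOL-Library.Function_Algebras"
begin

text \<open>
  The number of agents \<open>N\<close> and the dimension \<open>n\<close> are natural numbers that get quantified
  inside formulas, so \<open>\<real>\<^sup>n\<close> is represented as in \<^const>\<open>Euclidean_space\<close>: by the
  functions \<open>nat \<Rightarrow> real\<close> vanishing at all arguments \<open>\<ge> n\<close>. A point of \<open>\<real>\<^sup>n\<^sup>N\<close> is a
  function \<open>nat \<Rightarrow> nat \<Rightarrow> real\<close> that maps each agent in \<open>{1..N}\<close> to a point of \<open>\<real>\<^sup>n\<close> and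
  vanishes at all other arguments. Both are closed finite-dimensional subspaces of function spaces,
  on which the product topology coincides with the Euclidean one; hence \<^const>\<open>closure\<close> and
  \<open>\<longlongrightarrow>\<close> at the function types have their Euclidean meaning there.
\<close>

instantiation "fun" :: (type, real_vector) real_vector
begin

definition "r *\<^sub>R f = (\<lambda>x. r *\<^sub>R f x)"

instance
  by standard (simp_all add: scaleR_fun_def fun_eq_iff scaleR_add_right scaleR_add_left)

end

lemma scaleR_fun_apply [simp]: "(r *\<^sub>R f) x = r *\<^sub>R f x"
  by (simp add: scaleR_fun_def)

type_synonym point = "nat \<Rightarrow> real"
type_synonym state = "nat \<Rightarrow> point"

definition state_space :: "nat \<Rightarrow> nat \<Rightarrow> state set" where
  "state_space N n =
     {x. (\<forall>i\<in>{1..N}. x i \<in> topspace (Euclidean_space n)) \<and> (\<forall>i. i \<notin> {1..N} \<longrightarrow> x i = 0)}"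

definition enorm :: "nat \<Rightarrow> point \<Rightarrow> real" where
  "enorm n v = L2_set v {..<n}"

definition snorm :: "nat \<Rightarrow> nat \<Rightarrow> state \<Rightarrow> real" where
  "snorm N n x = L2_set (\<lambda>i. enorm n (x i)) {1..N}"

definition closed_hull :: "'a::{real_vector,topological_space} set \<Rightarrow> 'a set" where
  "closed_hull S = closure (convex hull S)"


subsection \<open>Solutions of discontinuous autonomous ODEs\<close>

text \<open>The finite families of non-overlapping intervals in the usual \<open>\<epsilon>\<close>-\<open>\<delta>\<close> definition are given
  as divisions of their unions.\<close>

definition abs_continuous_curve :: "nat \<Rightarrow> nat \<Rightarrow> real \<Rightarrow> (real \<Rightarrow> state) \<Rightarrow> bool" where
  "abs_continuous_curve N n T x \<longleftrightarrow>
     (\<forall>\<epsilon>>0. \<exists>\<delta>>0. \<forall>D. D division_of \<Union>D \<longrightarrow> \<Union>D \<subseteq> {0..T} \<longrightarrow> (\<Sum>K\<in>D. Sup K - Inf K) < \<delta> \<longrightarrow>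
        (\<Sum>K\<in>D. snorm N n (x (Sup K) - x (Inf K))) < \<epsilon>)"

definition has_velocity :: "real \<Rightarrow> (real \<Rightarrow> state) \<Rightarrow> state \<Rightarrow> real \<Rightarrow> bool" where
  "has_velocity T x v t \<longleftrightarrow>
     (\<forall>i k. ((\<lambda>s. x s i k) has_real_derivative v i k) (at t within {0..T}))"

definition caratheodory_on ::
  "nat \<Rightarrow> nat \<Rightarrow> (state \<Rightarrow> state) \<Rightarrow> real \<Rightarrow> (real \<Rightarrow> state) \<Rightarrow> bool" where
  "caratheodory_on N n g T x \<longleftrightarrow>
     (\<forall>t\<in>{0..T}. x t \<in> state_space N n) \<and> abs_continuous_curve N n T x \<and>
     (AE t in lebesgue_on {0..T}. has_velocity T x (g (x t)) t)"

definition krasovsky_set :: "nat \<Rightarrow> nat \<Rightarrow> (state \<Rightarrow> state) \<Rightarrow> state \<Rightarrow> state set" where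
  "krasovsky_set N n g x =
     (\<Inter>\<delta>\<in>{0<..}. closed_hull (g ` {y \<in> state_space N n. snorm N n (y - x) < \<delta>}))"

definition krasovsky_on ::
  "nat \<Rightarrow> nat \<Rightarrow> (state \<Rightarrow> state) \<Rightarrow> real \<Rightarrow> (real \<Rightarrow> state) \<Rightarrow> bool" where
  "krasovsky_on N n g T x \<longleftrightarrow>
     (\<forall>t\<in>{0..T}. x t \<in> state_space N n) \<and> abs_continuous_curve N n T x \<and>
     (AE t in lebesgue_on {0..T}. \<exists>v \<in> krasovsky_set N n g (x t). has_velocity T x v t)"

text \<open>Solutions on \<open>[0,+\<infinity>)\<close>; the values at negative times are irrelevant.\<close>

definition caratheodory_solution ::
  "nat \<Rightarrow> nat \<Rightarrow> (state \<Rightarrow> state) \<Rightarrow> (real \<Rightarrow> state) \<Rightarrow> bool" where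
  "caratheodory_solution N n g x \<longleftrightarrow> (\<forall>T>0. caratheodory_on N n g T x)"

definition krasovsky_solution ::
  "nat \<Rightarrow> nat \<Rightarrow> (state \<Rightarrow> state) \<Rightarrow> (real \<Rightarrow> state) \<Rightarrow> bool" where
  "krasovsky_solution N n g x \<longleftrightarrow> (\<forall>T>0. krasovsky_on N n g T x)"


subsection \<open>Bounded confidence models\<close>

type_synonym nbhd = "state \<Rightarrow> nat \<Rightarrow> nat set"

definition metric_nbrs :: "nat \<Rightarrow> nat \<Rightarrow> nbhd" where
  "metric_nbrs N n x i = {j \<in> {1..N}. enorm n (x j - x i) < 1}"

text \<open>\<^const>\<open>sort_key\<close> is stable and the sorted list is initially
  in increasing order, so ties are broken in favour of the lower index.\<close>

definition topological_nbrs :: "nat \<Rightarrow> nat \<Rightarrow> nat \<Rightarrow> nbhd" where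
  "topological_nbrs N n \<kappa> x i =
     set (take \<kappa> (sort_key (\<lambda>j. enorm n (x j - x i)) [j \<leftarrow> [1..<Suc N]. j \<noteq> i]))"

definition bc_field :: "nat \<Rightarrow> nat \<Rightarrow> (real \<Rightarrow> real) \<Rightarrow> nbhd \<Rightarrow> state \<Rightarrow> state" where
  "bc_field N n a Nb x =
     (\<lambda>i. if i \<in> {1..N} then \<Sum>j\<in>Nb x i. a (enorm n (x j - x i)) *\<^sub>R (x j - x i) else 0)"

abbreviation metric_model :: "nat \<Rightarrow> nat \<Rightarrow> (real \<Rightarrow> real) \<Rightarrow> state \<Rightarrow> state" where
  "metric_model N n a \<equiv> bc_field N n a (metric_nbrs N n)"

abbreviation topological_model ::
  "nat \<Rightarrow> nat \<Rightarrow> nat \<Rightarrow> (real \<Rightarrow> real) \<Rightarrow> state \<Rightarrow> state" where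
  "topological_model N n \<kappa> a \<equiv> bc_field N n a (topological_nbrs N n \<kappa>)"

text \<open>Only the values of the interaction function on \<open>[0,+\<infinity>)\<close> matter.\<close>

definition interaction :: "(real \<Rightarrow> real) \<Rightarrow> bool" where
  "interaction a \<longleftrightarrow>
     (\<forall>r\<ge>0. a r \<ge> 0) \<and> (\<exists>L. L-lipschitz_on {0..} a) \<and> mono_on {0..} a \<and> (\<forall>r>0. a r > 0)"


subsection \<open>Properties of solutions\<close>

definition average :: "nat \<Rightarrow> state \<Rightarrow> point" where
  "average N x = (1 / real N) *\<^sub>R (\<Sum>i\<in>{1..N}. x i)"

definition average_preserving :: "nat \<Rightarrow> (real \<Rightarrow> state) \<Rightarrow> bool" where
  "average_preserving N x \<longleftrightarrow> (\<lambda>t. average N (x t)) constant_on {0..}"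

definition support_contracting :: "nat \<Rightarrow> (real \<Rightarrow> state) \<Rightarrow> bool" where
  "support_contracting N x \<longleftrightarrow>
     (\<forall>T1 T2. 0 \<le> T1 \<and> T1 \<le> T2 \<longrightarrow>
        closed_hull (x T2 ` {1..N}) \<subseteq> closed_hull (x T1 ` {1..N}))"

definition cluster_point :: "nat \<Rightarrow> nat \<Rightarrow> nbhd \<Rightarrow> state \<Rightarrow> bool" where
  "cluster_point N n Nb z \<longleftrightarrow>
     z \<in> state_space N n \<and> (\<forall>i\<in>{1..N}. \<forall>j\<in>Nb z i. z i = z j)"

definition converges_to_cluster :: "nat \<Rightarrow> nat \<Rightarrow> nbhd \<Rightarrow> (real \<Rightarrow> state) \<Rightarrow> bool" where
  "converges_to_cluster N n Nb x \<longleftrightarrow> (\<exists>z. cluster_point N n Nb z \<and> (x \<longlongrightarrow> z) at_top)"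

end

theory Submission
  imports Defs
begin

text \<open>
  A Caratheodory solution is a Krasovsky solution, so parts (i) and (ii) only concern the latter. A
  Krasovsky velocity at \<open>x\<close> is a limit of convex combinations of field values at points
  near \<open>x\<close>. Therefore an inequality \<open>L v \<le> \<beta>\<close>, with \<open>L\<close> linear, holds for it as soon as it
  holds up to \<open>\<epsilon>\<close> for the field near \<open>x\<close> (\<open>krasovsky_set_halfspace\<close>). In these parts the
  dynamics enters through inequalities of this kind, integrated along absolutely continuous curves
  by \<open>abs_continuous_nonincreasing\<close>.

  Contractivity of the support holds for every field whose agents move towards other agents. For a
  half-space \<open>{z. b \<bullet> z \<le> c}\<close>, the sum of the squared excesses of \<open>b \<bullet> x\<^sub>i\<close> over \<open>c\<close> grows at most
  exponentially; if it vanishes once, it vanishes forever. Since a point outside the convex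
  hull of finitely many points is separated from it by a half-space, the hulls shrink.

  In the metric model the interaction is symmetric. Hence \<open>\<Sum>\<^sub>i \<phi>(x\<^sub>i\<^sub>k)\<close> is nonincreasing
  for every convex differentiable \<open>\<phi>\<close> and every coordinate \<open>k\<close>. Linear \<open>\<phi>\<close> of both signs give the
  preservation of the average. The truncated squares \<open>\<phi>(y) = (max 0 (y - c))\<^sup>2\<close> give convergence:
  their linear combinations contain bumps with support in any given small interval, so
  the sum of a bump over all agents converges; a coordinate that oscillated for ever across an
  interval would make the limit at least the height of the bump, for more disjoint bumps than
  there are agents
  (\<open>converges_of_truncated_square_sums\<close>). The full square gives an energy, which would decrease to
  \<open>-\<infinity>\<close> if two agents had distinct limits at distance less than \<open>1\<close>; so the limit is a cluster point.

  For the topological model with \<open>\<kappa> = 1\<close> let \<open>r\<^sub>i\<close> be the distance from agent \<open>i\<close> to its nearest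
  neighbour \<open>f i\<close>, and let \<open>\<sigma>\<^sub>i = a(r\<^sub>i) r\<^sub>i\<close> be its speed. Almost everywhere \<open>r\<^sub>i' \<le> \<sigma>\<^sub>f\<^sub>i - \<sigma>\<^sub>i \<le> 0\<close>, and
  \<open>r\<^sub>i' \<le> -\<sigma>\<^sub>i\<close> if \<open>i\<close> and \<open>f i\<close> are nearest neighbours of each other. The breaking of ties by index
  excludes longer cycles, so the chain \<open>i, f i, f (f i), \<dots>\<close> ends in such a pair, and telescoping along
  it yields \<open>\<Sum>\<^sub>j r\<^sub>j' \<le> -\<sigma>\<^sub>i\<close> for every \<open>i\<close> (\<open>sum_along_chain\<close>). Thus \<open>\<Sum>\<^sub>j r\<^sub>j\<close> pays
  for the path length of each agent: all agents have trajectories of finite length and converge, and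
  every \<open>r\<^sub>i\<close> tends to \<open>0\<close>. In the limit each agent shares its position with another one, which
  is what it means to be a cluster point.

  The two failures for the topological model are explicit: an agent that follows a pair at
  rest moves the average, and an agent halfway between two groups at rest, with one neighbour in each,
  does not move although it is not at the position of its neighbours.
\<close>

section \<open>Absolutely continuous real functions\<close>

definition abs_continuous_on :: "real \<Rightarrow> real \<Rightarrow> (real \<Rightarrow> real) \<Rightarrow> bool" where
  "abs_continuous_on a b f \<longleftrightarrow>
     (\<forall>\<epsilon>>0. \<exists>\<delta>>0. \<forall>D. D division_of \<Union>D \<longrightarrow> \<Union>D \<subseteq> {a..b} \<longrightarrow> (\<Sum>K\<in>D. Sup K - Inf K) < \<delta> \<longrightarrow>
        (\<Sum>K\<in>D. \<bar>f (Sup K) - f (Inf K)\<bar>) < \<epsilon>)"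

lemma division_memE:
  fixes D :: "real set set"
  assumes "D division_of S" "K \<in> D" "S \<subseteq> {a..b}"
  obtains u v where "K = {u..v}" "u \<le> v" "u \<in> {a..b}" "v \<in> {a..b}" "Inf K = u" "Sup K = v"
proof -
  obtain u v where K: "K = cbox u v" "K \<noteq> {}" "K \<subseteq> S"
    using division_ofD(2,3,4)[OF assms(1)] assms(2) by metis
  then have "u \<le> v" by simp
  then have "u \<in> K" "v \<in> K" using K(1) by auto
  then have "u \<in> {a..b}" "v \<in> {a..b}" using K(3) assms(3) by blast+
  then show thesis using K(1) \<open>u \<le> v\<close> that[of u v] by auto
qed

text \<open>
  Reduces the absolute continuity of sums, products, Lipschitz images, minima and Euclidean norms to an
  estimate of a single increment.
\<close>

lemma abs_continuous_on_dominated: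
  fixes f :: "real \<Rightarrow> real"
  assumes I: "finite I" and g: "\<And>i. i \<in> I \<Longrightarrow> abs_continuous_on a b (g i)"
    and dom: "\<And>s t. s \<in> {a..b} \<Longrightarrow> t \<in> {a..b} \<Longrightarrow> \<bar>f s - f t\<bar> \<le> B * (\<Sum>i\<in>I. \<bar>g i s - g i t\<bar>)"
  shows "abs_continuous_on a b f"
  unfolding abs_continuous_on_def
proof (intro allI impI)
  fix \<epsilon> :: real assume "\<epsilon> > 0"
  define C where "C = \<bar>B\<bar> + 1"
  define \<eta> where "\<eta> = \<epsilon> / (C * (real (card I) + 1))"
  have "C > 0" by (simp add: C_def)
  then have "\<eta> > 0" using \<open>\<epsilon> > 0\<close> by (simp add: \<eta>_def)
  have "\<forall>i\<in>I. \<exists>\<delta>>0. \<forall>D. D division_of \<Union>D \<longrightarrow> \<Union>D \<subseteq> {a..b} \<longrightarrow> (\<Sum>K\<in>D. Sup K - Inf K) < \<delta> \<longrightarrow>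
        (\<Sum>K\<in>D. \<bar>g i (Sup K) - g i (Inf K)\<bar>) < \<eta>"
    using g \<open>\<eta> > 0\<close> unfolding abs_continuous_on_def by blast
  from bchoice[OF this] obtain \<delta> where \<delta>: "\<forall>i\<in>I. \<delta> i > 0 \<and>
      (\<forall>D. D division_of \<Union>D \<longrightarrow> \<Union>D \<subseteq> {a..b} \<longrightarrow> (\<Sum>K\<in>D. Sup K - Inf K) < \<delta> i \<longrightarrow>
        (\<Sum>K\<in>D. \<bar>g i (Sup K) - g i (Inf K)\<bar>) < \<eta>)" by blast
  define d where "d = Min (insert 1 (\<delta> ` I))"
  have d: "d > 0" "\<And>i. i \<in> I \<Longrightarrow> d \<le> \<delta> i"
    using I \<delta> by (auto simp: d_def)
  have "(\<Sum>K\<in>D. \<bar>f (Sup K) - f (Inf K)\<bar>) < \<epsilon>"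
    if D: "D division_of \<Union>D" "\<Union>D \<subseteq> {a..b}" "(\<Sum>K\<in>D. Sup K - Inf K) < d" for D
  proof -
    have "(\<Sum>K\<in>D. \<bar>f (Sup K) - f (Inf K)\<bar>) \<le> (\<Sum>K\<in>D. C * (\<Sum>i\<in>I. \<bar>g i (Sup K) - g i (Inf K)\<bar>))"
    proof (rule sum_mono)
      fix K assume "K \<in> D"
      then have "Sup K \<in> {a..b}" "Inf K \<in> {a..b}"
        using division_memE[OF D(1) _ D(2)] by metis+
      then have "\<bar>f (Sup K) - f (Inf K)\<bar> \<le> B * (\<Sum>i\<in>I. \<bar>g i (Sup K) - g i (Inf K)\<bar>)"
        by (rule dom)
      also have "\<dots> \<le> C * (\<Sum>i\<in>I. \<bar>g i (Sup K) - g i (Inf K)\<bar>)"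
        by (intro mult_right_mono sum_nonneg) (auto simp: C_def)
      finally show "\<bar>f (Sup K) - f (Inf K)\<bar> \<le> C * (\<Sum>i\<in>I. \<bar>g i (Sup K) - g i (Inf K)\<bar>)" .
    qed
    also have "\<dots> = C * (\<Sum>i\<in>I. \<Sum>K\<in>D. \<bar>g i (Sup K) - g i (Inf K)\<bar>)"
      by (subst sum.swap) (simp add: sum_distrib_left)
    also have "\<dots> \<le> C * (\<Sum>i\<in>I. \<eta>)"
    proof (intro mult_left_mono sum_mono)
      fix i assume "i \<in> I"
      then have "(\<Sum>K\<in>D. Sup K - Inf K) < \<delta> i" using D(3) d(2) by fastforce
      then show "(\<Sum>K\<in>D. \<bar>g i (Sup K) - g i (Inf K)\<bar>) \<le> \<eta>"
        using \<delta> \<open>i \<in> I\<close> D(1,2) by (meson less_imp_le)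
    qed (use \<open>C > 0\<close> in auto)
    also have "\<dots> < C * ((real (card I) + 1) * \<eta>)"
      using \<open>C > 0\<close> \<open>\<eta> > 0\<close> by simp
    also have "\<dots> = \<epsilon>"
      using \<open>C > 0\<close> by (simp add: \<eta>_def)
    finally show ?thesis .
  qed
  then show "\<exists>\<delta>>0. \<forall>D. D division_of \<Union>D \<longrightarrow> \<Union>D \<subseteq> {a..b} \<longrightarrow> (\<Sum>K\<in>D. Sup K - Inf K) < \<delta> \<longrightarrow>
        (\<Sum>K\<in>D. \<bar>f (Sup K) - f (Inf K)\<bar>) < \<epsilon>"
    using d(1) by blast
qed

lemma abs_continuous_on_subinterval:
  assumes "abs_continuous_on a b f" "{c..d} \<subseteq> {a..b}"
  shows "abs_continuous_on c d f"
  using assms unfolding abs_continuous_on_def by (meson order_trans)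

lemma abs_continuous_on_ident: "abs_continuous_on a b (\<lambda>t. t)"
  unfolding abs_continuous_on_def
proof (intro allI impI)
  fix \<epsilon> :: real assume "\<epsilon> > 0"
  have "(\<Sum>K\<in>D. \<bar>Sup K - Inf K\<bar>) < \<epsilon>"
    if D: "D division_of \<Union>D" "\<Union>D \<subseteq> {a..b}" "(\<Sum>K\<in>D. Sup K - Inf K) < \<epsilon>" for D
  proof -
    have "(\<Sum>K\<in>D. \<bar>Sup K - Inf K\<bar>) = (\<Sum>K\<in>D. Sup K - Inf K)"
    proof (rule sum.cong[OF refl])
      fix K assume "K \<in> D"
      then obtain u v where "u \<le> v" "Inf K = u" "Sup K = v"
        using division_memE[OF D(1) _ D(2)] by metis
      then show "\<bar>Sup K - Inf K\<bar> = Sup K - Inf K" by simp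
    qed
    then show ?thesis using D(3) by simp
  qed
  then show "\<exists>\<delta>>0. \<forall>D. D division_of \<Union>D \<longrightarrow> \<Union>D \<subseteq> {a..b} \<longrightarrow> (\<Sum>K\<in>D. Sup K - Inf K) < \<delta> \<longrightarrow>
        (\<Sum>K\<in>D. \<bar>Sup K - Inf K\<bar>) < \<epsilon>"
    using \<open>\<epsilon> > 0\<close> by blast
qed

lemma abs_continuous_on_add:
  assumes "abs_continuous_on a b f" "abs_continuous_on a b g"
  shows "abs_continuous_on a b (\<lambda>t. f t + g t)"
  by (rule abs_continuous_on_dominated[of "{True,False}" _ _ "\<lambda>c. if c then f else g" _ 1])
     (use assms in auto)

lemma abs_continuous_on_minus:
  assumes "abs_continuous_on a b f"
  shows "abs_continuous_on a b (\<lambda>t. - f t)"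
  by (rule abs_continuous_on_dominated[of "{True}" _ _ "\<lambda>c. f" _ 1])
     (use assms in auto)

lemma abs_continuous_on_cmult:
  assumes "abs_continuous_on a b f"
  shows "abs_continuous_on a b (\<lambda>t. c * f t)"
  by (rule abs_continuous_on_dominated[of "{True}" _ _ "\<lambda>c. f" _ "\<bar>c\<bar>"])
     (use assms in \<open>auto simp: abs_mult simp flip: right_diff_distrib\<close>)

lemma abs_continuous_on_sum:
  assumes "finite I" "\<And>i. i \<in> I \<Longrightarrow> abs_continuous_on a b (f i)"
  shows "abs_continuous_on a b (\<lambda>t. \<Sum>i\<in>I. f i t)"
  by (rule abs_continuous_on_dominated[of I _ _ f _ 1])
     (use assms in \<open>auto simp flip: sum_subtractf\<close>)

lemma abs_continuous_on_imp_continuous_on: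
  assumes "abs_continuous_on a b f"
  shows "continuous_on {a..b} f"
  unfolding continuous_on_iff
proof (intro ballI allI impI)
  fix x \<epsilon> assume x: "x \<in> {a..b}" and "\<epsilon> > (0::real)"
  then obtain \<delta> where \<delta>: "\<delta> > 0" "\<And>D. D division_of \<Union>D \<Longrightarrow> \<Union>D \<subseteq> {a..b} \<Longrightarrow>
      (\<Sum>K\<in>D. Sup K - Inf K) < \<delta> \<Longrightarrow> (\<Sum>K\<in>D. \<bar>f (Sup K) - f (Inf K)\<bar>) < \<epsilon>"
    using assms unfolding abs_continuous_on_def by meson
  have one: "\<bar>f v - f u\<bar> < \<epsilon>" if "u \<le> v" "v - u < \<delta>" "u \<in> {a..b}" "v \<in> {a..b}" for u v
    using \<delta>(2)[of "{{u..v}}"] that division_of_self[of u v] by (simp add: subset_iff)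
  have "\<forall>y\<in>{a..b}. dist y x < \<delta> \<longrightarrow> dist (f y) (f x) < \<epsilon>"
  proof (intro ballI impI)
    fix y assume "y \<in> {a..b}" "dist y x < \<delta>"
    then show "dist (f y) (f x) < \<epsilon>"
      using one[of x y] one[of y x] x by (cases "x \<le> y") (auto simp: dist_real_def abs_minus_commute)
  qed
  with \<delta>(1) show "\<exists>d>0. \<forall>y\<in>{a..b}. dist y x < d \<longrightarrow> dist (f y) (f x) < \<epsilon>" by blast
qed

lemma abs_continuous_on_mult:
  assumes "abs_continuous_on a b f" "abs_continuous_on a b g"
  shows "abs_continuous_on a b (\<lambda>t. f t * g t)"
proof -
  have "\<exists>B. \<forall>t\<in>{a..b}. \<bar>h t\<bar> \<le> B" if "abs_continuous_on a b h" for h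
    using compact_imp_bounded[OF compact_continuous_image[OF abs_continuous_on_imp_continuous_on[OF that] compact_Icc]]
    by (auto simp: bounded_iff)
  then obtain B C where BC: "\<And>t. t \<in> {a..b} \<Longrightarrow> \<bar>f t\<bar> \<le> B" "\<And>t. t \<in> {a..b} \<Longrightarrow> \<bar>g t\<bar> \<le> C"
    using assms by metis
  show ?thesis
  proof (rule abs_continuous_on_dominated[of "{True,False}" _ _ "\<lambda>c. if c then f else g" _ "max B C"])
    fix s t assume st: "s \<in> {a..b}" "t \<in> {a..b}"
    have "\<bar>f s * g s - f t * g t\<bar> = \<bar>(f s - f t) * g s + f t * (g s - g t)\<bar>"
      by (simp add: algebra_simps)
    also have "\<dots> \<le> \<bar>f s - f t\<bar> * \<bar>g s\<bar> + \<bar>f t\<bar> * \<bar>g s - g t\<bar>"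
      by (metis abs_mult abs_triangle_ineq)
    also have "\<dots> \<le> \<bar>f s - f t\<bar> * max B C + max B C * \<bar>g s - g t\<bar>"
      using BC st by (intro add_mono mult_mono) (auto simp: le_max_iff_disj intro: order_trans[OF abs_ge_zero])
    finally show "\<bar>f s * g s - f t * g t\<bar> \<le> max B C *
        (\<Sum>i\<in>{True, False}. \<bar>(if i then f else g) s - (if i then f else g) t\<bar>)"
      by (simp add: algebra_simps)
  qed (use assms in auto)
qed

lemma abs_continuous_on_compose_lipschitz:
  assumes "abs_continuous_on a b f"
    and "\<And>s t. s \<in> {a..b} \<Longrightarrow> t \<in> {a..b} \<Longrightarrow> \<bar>\<phi> (f s) - \<phi> (f t)\<bar> \<le> B * \<bar>f s - f t\<bar>"
  shows "abs_continuous_on a b (\<lambda>t. \<phi> (f t))"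
  by (rule abs_continuous_on_dominated[of "{True}" _ _ "\<lambda>c. f" _ B])
     (use assms in auto)

text \<open>
  The derivative controls the increment over an interval that contains \<open>t\<close>, not only over one that
  starts at \<open>t\<close>; this is the form required by tagged divisions.
\<close>

lemma straddle_upper:
  fixes f :: "real \<Rightarrow> real"
  assumes "(f has_real_derivative d) (at t within S)" "d \<le> 0" "\<eta> > 0"
  shows "\<exists>r>0. \<forall>u\<in>S. \<forall>v\<in>S. u \<le> t \<and> t \<le> v \<and> \<bar>u - t\<bar> < r \<and> \<bar>v - t\<bar> < r \<longrightarrow> f v - f u \<le> \<eta> * (v - u)"
proof -
  obtain r where r: "r > 0" "\<And>y. y \<in> S \<Longrightarrow> \<bar>y - t\<bar> < r \<Longrightarrow> \<bar>f y - f t - d * (y - t)\<bar> \<le> \<eta> * \<bar>y - t\<bar>"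
    using assms(1,3) unfolding has_field_derivative_def has_derivative_within_alt
    by (auto simp: mult.commute)
  have "f v - f u \<le> \<eta> * (v - u)" if "u \<in> S" "v \<in> S" "u \<le> t" "t \<le> v" "\<bar>u - t\<bar> < r" "\<bar>v - t\<bar> < r" for u v
  proof -
    have "\<bar>f v - f t - d * (v - t)\<bar> \<le> \<eta> * (v - t)" "\<bar>f u - f t - d * (u - t)\<bar> \<le> \<eta> * (t - u)"
      using r(2)[of v] r(2)[of u] that by auto
    moreover have "d * (v - u) \<le> 0" using that assms(2) by (intro mult_nonpos_nonneg) auto
    ultimately show ?thesis by (simp add: algebra_simps)
  qed
  with r(1) show ?thesis by blast
qed

text \<open>
  Fix \<open>e > 0\<close>. Cover \<open>Z\<close> by an open set \<open>U\<close> so small that the increments of \<open>f\<close> over non-overlapping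
  intervals in \<open>U\<close> sum up to less than \<open>e / 2\<close>. Take a tagged division of \<open>{a..b}\<close> whose intervals
  lie in \<open>U\<close> if the tag is in \<open>Z\<close>, and are otherwise so short that the sign of the derivative at the
  tag bounds the increment; it exists by Cousin's lemma. Both kinds of intervals together contribute at
  most \<open>e\<close>.
\<close>

lemma abs_continuous_nonincreasing:
  fixes f :: "real \<Rightarrow> real"
  assumes ab: "a \<le> b" and ac: "abs_continuous_on a b f" and Z: "negligible Z"
    and deriv: "\<And>t. t \<in> {a..b} - Z \<Longrightarrow> \<exists>d\<le>0. (f has_real_derivative d) (at t within {a..b})"
  shows "f b \<le> f a"
proof (rule field_le_epsilon)
  fix e :: real assume e: "e > 0"
  define \<eta> where "\<eta> = e / 2 / (b - a + 1)"
  have \<eta>: "\<eta> > 0" using e ab by (simp add: \<eta>_def)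
  obtain \<delta> where \<delta>: "\<delta> > 0" "\<And>D. D division_of \<Union>D \<Longrightarrow> \<Union>D \<subseteq> {a..b} \<Longrightarrow>
      (\<Sum>K\<in>D. Sup K - Inf K) < \<delta> \<Longrightarrow> (\<Sum>K\<in>D. \<bar>f (Sup K) - f (Inf K)\<bar>) < e / 2"
    using ac e unfolding abs_continuous_on_def by (meson half_gt_zero)
  obtain U where U: "open U" "Z \<subseteq> U" "U \<in> lmeasurable" "measure lebesgue U < \<delta>"
  proof -
    have Z0: "Z \<in> null_sets lebesgue" using Z by (simp add: negligible_iff_null_sets)
    obtain U where U: "open U" "Z \<subseteq> U" "U - Z \<in> lmeasurable" "emeasure lebesgue (U - Z) < ennreal \<delta>"
      using sets_lebesgue_outer_open[of Z \<delta>] Z0 \<delta>(1) by (metis null_setsD2)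
    have "U = (U - Z) \<union> Z" using U by auto
    then have "U \<in> lmeasurable" "measure lebesgue U = measure lebesgue (U - Z)"
      using U(3) Z0 fmeasurable.Un[OF U(3), of Z] negligible_imp_measurable[OF Z]
        measure_Un_null_set[of "U - Z" lebesgue Z]
      by (auto simp: fmeasurableD)
    moreover have "measure lebesgue (U - Z) < \<delta>"
      using U(3,4) \<delta>(1) by (simp add: emeasure_eq_measure2 ennreal_less_iff)
    ultimately show thesis using that U by metis
  qed
  define good where "good t \<rho> \<longleftrightarrow> (\<forall>u\<in>{a..b}. \<forall>v\<in>{a..b}.
      u \<le> t \<and> t \<le> v \<and> \<bar>u - t\<bar> < \<rho> \<and> \<bar>v - t\<bar> < \<rho> \<longrightarrow> f v - f u \<le> \<eta> * (v - u))" for t \<rho>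
  have "\<exists>\<rho>>0. t \<in> {a..b} - Z \<longrightarrow> good t \<rho>" for t
  proof (cases "t \<in> {a..b} - Z")
    case True
    with deriv obtain d where "d \<le> 0" "(f has_real_derivative d) (at t within {a..b})" by blast
    from straddle_upper[OF this(2,1) \<eta>] show ?thesis unfolding good_def by blast
  qed (auto intro: exI[of _ 1])
  then obtain r where r: "\<And>t. r t > 0" "\<And>t. t \<in> {a..b} - Z \<Longrightarrow> good t (r t)" by metis
  \<comment> \<open>The gauge that separates the two kinds of tags.\<close>
  define \<gamma> where "\<gamma> t = (if t \<in> Z then U else ball t (r t))" for t
  have "gauge \<gamma>" using U r(1) by (auto simp: gauge_def \<gamma>_def)
  then obtain p where p: "p tagged_division_of {a..b}" "\<gamma> fine p"
    using fine_division_exists_real by blast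
  note pD = tagged_division_ofD[OF p(1)]
  define q where "q = {(x,K). (x,K) \<in> p \<and> x \<in> Z}"
  have qp: "q \<subseteq> p" by (auto simp: q_def)
  have finp: "finite p" using pD(1) .
  have mem: "\<exists>u v. K = {u..v} \<and> u \<le> x \<and> x \<le> v \<and> u \<in> {a..b} \<and> v \<in> {a..b} \<and> Inf K = u \<and> Sup K = v"
    if xK: "(x,K) \<in> p" for x K
  proof -
    obtain u v where K: "K = cbox u v" using pD(4)[OF xK] by auto
    moreover have "x \<in> K" "K \<subseteq> {a..b}" using pD(2,3)[OF xK] by auto
    ultimately show ?thesis by (intro exI[of _ u] exI[of _ v]) auto
  qed
  have "f b - f a = (\<Sum>(x,K)\<in>p. f (Sup K) - f (Inf K))"
    using additive_tagged_division_1[OF ab p(1), of f] by simp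
  also have "\<dots> = (\<Sum>(x,K)\<in>p-q. f (Sup K) - f (Inf K)) + (\<Sum>(x,K)\<in>q. f (Sup K) - f (Inf K))"
    by (rule sum.subset_diff[OF qp finp])
  also have "(\<Sum>(x,K)\<in>p-q. f (Sup K) - f (Inf K)) \<le> (\<Sum>(x,K)\<in>p-q. \<eta> * (Sup K - Inf K))"
  proof (rule sum_mono, clarsimp)
    fix x K assume xK: "(x,K) \<in> p" "(x,K) \<notin> q"
    then have xZ: "x \<notin> Z" by (auto simp: q_def)
    obtain u v where uv: "K = {u..v}" "u \<le> x" "x \<le> v" "u \<in> {a..b}" "v \<in> {a..b}" "Inf K = u" "Sup K = v"
      using mem[OF xK(1)] by auto
    have "K \<subseteq> ball x (r x)" using fineD[OF p(2) xK(1)] xZ by (simp add: \<gamma>_def)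
    moreover have "u \<in> K" "v \<in> K" using uv by auto
    ultimately have "u \<in> ball x (r x)" "v \<in> ball x (r x)" by blast+
    then show "f (Sup K) - f (Inf K) \<le> \<eta> * (Sup K - Inf K)"
      using r(2)[of x] uv xZ by (auto simp: good_def dist_real_def)
  qed
  also have "\<dots> \<le> (\<Sum>(x,K)\<in>p. \<eta> * (Sup K - Inf K))"
  proof (rule sum_mono2[OF finp])
    fix z assume "z \<in> p - (p - q)"
    then obtain x K where "z = (x,K)" "(x,K) \<in> p" by (cases z) auto
    then show "0 \<le> (case z of (x, K) \<Rightarrow> \<eta> * (Sup K - Inf K))"
      using mem[of x K] \<eta> by auto
  qed auto
  also have "\<dots> = \<eta> * (b - a)"
    using additive_tagged_division_1[OF ab p(1), of "\<lambda>x. x"]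
    by (simp add: case_prod_beta flip: sum_distrib_left)
  also have "\<dots> \<le> e / 2"
    using e ab by (simp add: \<eta>_def field_simps)
  also have "(\<Sum>(x,K)\<in>q. f (Sup K) - f (Inf K)) \<le> e / 2"
  proof -
    have qpart: "q tagged_partial_division_of {a..b}"
      using tagged_partial_division_subset[OF _ qp] p(1) by (auto simp: tagged_division_of_def)
    note qtag = tagged_partial_division_of_Union_self[OF qpart]
    define D where "D = snd ` q"
    have D: "D division_of \<Union>D" using division_of_tagged_division[OF qtag] by (simp add: D_def)
    have Dab: "\<Union>D \<subseteq> {a..b}" using pD(3) qp by (fastforce simp: D_def)
    have DU: "\<Union>D \<subseteq> U"
    proof -
      have "K \<subseteq> U" if "(x,K) \<in> q" for x K
        using fineD[OF p(2), of x K] that by (simp add: \<gamma>_def q_def)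
      then show ?thesis by (force simp: D_def)
    qed
    have "(\<Sum>K\<in>D. Sup K - Inf K) = (\<Sum>K\<in>D. measure lebesgue K)"
    proof (rule sum.cong[OF refl])
      fix K assume "K \<in> D"
      then obtain u v where "K = {u..v}" "u \<le> v" "Inf K = u" "Sup K = v"
        using division_memE[OF D _ Dab] by metis
      then show "Sup K - Inf K = measure lebesgue K" by simp
    qed
    also have "\<dots> = measure lebesgue (\<Union>D)" by (rule content_division[OF D])
    also have "\<dots> \<le> measure lebesgue U"
      using DU U(3) lmeasurable_division[OF D] by (intro measure_mono_fmeasurable) auto
    also have "\<dots> < \<delta>" by (rule U(4))
    finally have "(\<Sum>K\<in>D. \<bar>f (Sup K) - f (Inf K)\<bar>) < e / 2"
      using \<delta>(2)[OF D Dab] by simp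
    moreover have "(\<Sum>(x,K)\<in>q. f (Sup K) - f (Inf K)) = (\<Sum>K\<in>D. f (Sup K) - f (Inf K))"
    proof -
      define h where "h K = (if K = {} then 0 else f (Sup K) - f (Inf K))" for K
      have ne: "K \<noteq> {}" if "(x,K) \<in> q" for x K using pD(2) that qp by blast
      then have hq: "(case z of (x,K) \<Rightarrow> f (Sup K) - f (Inf K)) = (case z of (x,K) \<Rightarrow> h K)" if "z \<in> q" for z
        using that ne by (cases z) (auto simp: h_def)
      have hD: "h K = f (Sup K) - f (Inf K)" if "K \<in> D" for K
        using that ne by (auto simp: h_def D_def)
      have "(\<Sum>(x,K)\<in>q. f (Sup K) - f (Inf K)) = (\<Sum>(x,K)\<in>q. h K)"
        by (rule sum.cong[OF refl hq])
      also have "\<dots> = (\<Sum>K\<in>D. h K)"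
        unfolding D_def
      proof (rule sum.over_tagged_division_lemma[OF qtag])
        fix u v :: real assume "box u v = {}"
        then have "v \<le> u" by (simp add: box_eq_empty)
        then show "h (cbox u v) = 0"
          by (cases "u = v") (auto simp: h_def)
      qed
      also have "\<dots> = (\<Sum>K\<in>D. f (Sup K) - f (Inf K))"
        by (rule sum.cong[OF refl hD])
      finally show ?thesis .
    qed
    moreover have "\<dots> \<le> (\<Sum>K\<in>D. \<bar>f (Sup K) - f (Inf K)\<bar>)" by (intro sum_mono) auto
    ultimately show ?thesis by simp
  qed
  finally show "f b \<le> f a + e" by simp
qed

section \<open>Norms of points and states\<close>

lemma sum_apply: "(\<Sum>i\<in>A. f i) x = (\<Sum>i\<in>A. f i x)"
  for f :: "'a \<Rightarrow> 'b \<Rightarrow> 'c::comm_monoid_add"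
  by (induction A rule: infinite_finite_induct) auto

lemma point_eqI:
  assumes "u \<in> topspace (Euclidean_space n)" "v \<in> topspace (Euclidean_space n)"
    and "\<And>k. k < n \<Longrightarrow> u k = v k"
  shows "u = v"
proof
  fix k show "u k = v k"
    using assms by (cases "k < n") (auto simp: topspace_Euclidean_space)
qed

lemma abs_coord_le_enorm: "k < n \<Longrightarrow> \<bar>v k\<bar> \<le> enorm n v"
  using member_le_L2_set[of "{..<n}" k "\<lambda>k. \<bar>v k\<bar>"] by (simp add: enorm_def L2_set_def)

lemma enorm_nonneg [simp]: "enorm n v \<ge> 0"
  by (simp add: enorm_def)

lemma enorm_power2: "(enorm n v)\<^sup>2 = (\<Sum>k<n. (v k)\<^sup>2)"
  by (simp add: enorm_def L2_set_def sum_nonneg)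

lemma enorm_minus_commute: "enorm n (u - v) = enorm n (v - u)"
  by (simp add: enorm_def L2_set_def power2_commute)

lemma enorm_triangle: "enorm n (u + v) \<le> enorm n u + enorm n v"
  using L2_set_triangle_ineq[of u v "{..<n}"] by (simp add: enorm_def plus_fun_def)

lemma enorm_scaleR: "enorm n (c *\<^sub>R v) = \<bar>c\<bar> * enorm n v"
  by (simp add: enorm_def L2_set_def power_mult_distrib real_sqrt_mult flip: sum_distrib_left)

lemma inner_le_enorm: "(\<Sum>k<n. u k * v k) \<le> enorm n u * enorm n v"
proof -
  have "(\<Sum>k<n. u k * v k) \<le> (\<Sum>k<n. \<bar>u k\<bar> * \<bar>v k\<bar>)"
    by (intro sum_mono) (metis abs_ge_self abs_mult)
  also have "\<dots> \<le> enorm n u * enorm n v"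
    unfolding enorm_def by (rule L2_set_mult_ineq)
  finally show ?thesis .
qed

lemma enorm_eq_0_iff:
  assumes "u \<in> topspace (Euclidean_space n)" "v \<in> topspace (Euclidean_space n)"
  shows "enorm n (u - v) = 0 \<longleftrightarrow> u = v"
proof
  assume *: "enorm n (u - v) = 0"
  show "u = v"
  proof (rule point_eqI[OF assms])
    fix k assume "k < n"
    then show "u k = v k" using abs_coord_le_enorm[of k n "u - v"] * by simp
  qed
qed (simp add: enorm_def L2_set_def)

lemma enorm_le_snorm: "i \<in> {1..N} \<Longrightarrow> enorm n (x i) \<le> snorm N n x"
  using member_le_L2_set[of "{1..N}" i "\<lambda>i. enorm n (x i)"] by (simp add: snorm_def)

lemma abs_coord_le_snorm: "i \<in> {1..N} \<Longrightarrow> k < n \<Longrightarrow> \<bar>x i k\<bar> \<le> snorm N n x"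
  using abs_coord_le_enorm[of k n "x i"] enorm_le_snorm[of i N n x] by simp

text \<open>
  Distances between agents are continuous in the state, with an explicit modulus. This is what
  transfers weights and neighbourhoods from \<open>x\<close> to nearby states \<open>y\<close>.
\<close>

lemma enorm_diff_perturb:
  assumes "i \<in> {1..N}" "j \<in> {1..N}"
  shows "\<bar>enorm n (y j - y i) - enorm n (x j - x i)\<bar> \<le> 2 * snorm N n (y - x)"
proof -
  have e: "enorm n ((y - x) j) \<le> snorm N n (y - x)" "enorm n ((y - x) i) \<le> snorm N n (y - x)"
    using assms by (intro enorm_le_snorm; simp)+
  then have e': "enorm n (x j - y j) \<le> snorm N n (y - x)" "enorm n (x i - y i) \<le> snorm N n (y - x)"
    by (simp_all add: enorm_minus_commute)
  have "y j - y i = (x j - x i) + ((y j - x j) + (x i - y i))" by (simp add: algebra_simps)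
  then have 1: "enorm n (y j - y i) \<le> enorm n (x j - x i) + (enorm n (y j - x j) + enorm n (x i - y i))"
    by (metis add_left_mono enorm_triangle order_trans)
  have "x j - x i = (y j - y i) + ((x j - y j) + (y i - x i))" by (simp add: algebra_simps)
  then have 2: "enorm n (x j - x i) \<le> enorm n (y j - y i) + (enorm n (x j - y j) + enorm n (y i - x i))"
    by (metis add_left_mono enorm_triangle order_trans)
  show ?thesis using 1 2 e e' by simp
qed

lemma state_spaceD: "x \<in> state_space N n \<Longrightarrow> i \<in> {1..N} \<Longrightarrow> x i \<in> topspace (Euclidean_space n)"
  by (simp add: state_space_def)

section \<open>Krasovsky velocities\<close>

definition pairing :: "nat \<Rightarrow> nat \<Rightarrow> state \<Rightarrow> state \<Rightarrow> real" where
  "pairing N n c v = (\<Sum>i\<in>{1..N}. \<Sum>k<n. c i k * v i k)"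

lemma closed_hull_halfspace:
  assumes "\<And>v. v \<in> S \<Longrightarrow> pairing N n c v \<le> \<beta>" "v \<in> closed_hull S"
  shows "pairing N n c v \<le> \<beta>"
proof -
  have lin: "pairing N n c (r *\<^sub>R u + s *\<^sub>R w) = r * pairing N n c u + s * pairing N n c w" for r s u w
    by (simp add: pairing_def sum_distrib_left algebra_simps sum.distrib)
  have "convex {v. pairing N n c v \<le> \<beta>}"
    unfolding convex_def
  proof (intro ballI allI impI, simp add: lin)
    fix u w :: state and r s :: real
    assume "pairing N n c u \<le> \<beta>" "pairing N n c w \<le> \<beta>" "0 \<le> r" "0 \<le> s" "r + s = 1"
    then have "r * pairing N n c u + s * pairing N n c w \<le> r * \<beta> + s * \<beta>"
      by (intro add_mono mult_left_mono)
    then show "r * pairing N n c u + s * pairing N n c w \<le> \<beta>"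
      using \<open>r + s = 1\<close> by (simp flip: distrib_right)
  qed
  then have "convex hull S \<subseteq> {v. pairing N n c v \<le> \<beta>}"
    using assms(1) by (intro hull_minimal) auto
  moreover have "closed {v. pairing N n c v \<le> \<beta>}"
  proof -
    have coord: "continuous_on UNIV (\<lambda>v::state. v i k)" for i k
      using continuous_on_product_then_coordinatewise[of UNIV "\<lambda>v. v i" k]
        continuous_on_product_coordinates[of i] by blast
    have "continuous_on UNIV (pairing N n c)"
      unfolding pairing_def by (intro continuous_on_sum continuous_on_mult_left coord)
    then show ?thesis by (rule closed_Collect_le[OF _ continuous_on_const])
  qed
  ultimately show ?thesis
    using assms(2) closure_minimal[of "convex hull S" "{v. pairing N n c v \<le> \<beta>}"]
    by (auto simp: closed_hull_def)
qed

text \<open>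
  Half-spaces are closed and convex, so they contain a closed hull as soon as they contain its
  generators.
\<close>

lemma krasovsky_set_halfspace:
  assumes v: "v \<in> krasovsky_set N n g x"
    and near: "\<And>\<epsilon>. \<epsilon> > 0 \<Longrightarrow> \<exists>\<delta>>0. \<forall>y\<in>state_space N n. snorm N n (y - x) < \<delta> \<longrightarrow> pairing N n c (g y) \<le> \<beta> + \<epsilon>"
  shows "pairing N n c v \<le> \<beta>"
proof (rule field_le_epsilon)
  fix \<epsilon> :: real assume "\<epsilon> > 0"
  then obtain \<delta> where \<delta>: "\<delta> > 0"
    "\<And>y. y \<in> state_space N n \<Longrightarrow> snorm N n (y - x) < \<delta> \<Longrightarrow> pairing N n c (g y) \<le> \<beta> + \<epsilon>"
    using near by blast
  then have "v \<in> closed_hull (g ` {y \<in> state_space N n. snorm N n (y - x) < \<delta>})"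
    using v by (auto simp: krasovsky_set_def)
  then show "pairing N n c v \<le> \<beta> + \<epsilon>"
    by (rule closed_hull_halfspace[rotated]) (use \<delta>(2) in auto)
qed

lemma krasovsky_set_self:
  assumes "x \<in> state_space N n" shows "g x \<in> krasovsky_set N n g x"
proof -
  have "g x \<in> closed_hull (g ` {y \<in> state_space N n. snorm N n (y - x) < \<delta>})" if "\<delta> > 0" for \<delta>
  proof -
    have "g x \<in> g ` {y \<in> state_space N n. snorm N n (y - x) < \<delta>}"
      using that assms by (intro imageI) (simp add: snorm_def enorm_def L2_set_def)
    then show ?thesis
      unfolding closed_hull_def by (intro subsetD[OF closure_subset] hull_inc)
  qed
  then show ?thesis by (auto simp: krasovsky_set_def)
qed

lemma caratheodory_imp_krasovsky:
  assumes "caratheodory_solution N n g x" shows "krasovsky_solution N n g x"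
  unfolding krasovsky_solution_def krasovsky_on_def
proof (intro allI impI conjI)
  fix T :: real assume "T > 0"
  then have c: "\<forall>t\<in>{0..T}. x t \<in> state_space N n" "abs_continuous_curve N n T x"
    "AE t in lebesgue_on {0..T}. has_velocity T x (g (x t)) t"
    using assms unfolding caratheodory_solution_def caratheodory_on_def by auto
  show "\<forall>t\<in>{0..T}. x t \<in> state_space N n" "abs_continuous_curve N n T x"
    using c by auto
  show "AE t in lebesgue_on {0..T}. \<exists>v\<in>krasovsky_set N n g (x t). has_velocity T x v t"
    using c(3) AE_space
  proof eventually_elim
    case (elim t)
    then show ?case using krasovsky_set_self c(1) by (auto simp: space_restrict_space)
  qed
qed

section \<open>Solutions as absolutely continuous curves\<close>

lemma AE_lebesgue_on_negligible:
  assumes "AE t in lebesgue_on {0..T::real}. P t"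
  obtains Z where "negligible Z" "\<And>t. t \<in> {0..T} - Z \<Longrightarrow> P t"
proof -
  have "AE t in lebesgue. t \<in> {0..T} \<longrightarrow> P t"
    using assms by (subst (asm) AE_restrict_space_iff) auto
  then obtain Z where "Z \<in> null_sets lebesgue" "{t. \<not> (t \<in> {0..T} \<longrightarrow> P t)} \<subseteq> Z"
    by (auto simp: eventually_ae_filter)
  then show thesis using that[of Z] by (auto simp: negligible_iff_null_sets)
qed

lemma abs_continuous_curve_coord:
  assumes ac: "abs_continuous_curve N n T x" and ik: "i \<in> {1..N}" "k < n"
  shows "abs_continuous_on 0 T (\<lambda>t. x t i k)"
  unfolding abs_continuous_on_def
proof (intro allI impI)
  fix \<epsilon> :: real assume "\<epsilon> > 0"
  then obtain \<delta> where \<delta>: "\<delta> > 0" "\<And>D. D division_of \<Union>D \<Longrightarrow> \<Union>D \<subseteq> {0..T} \<Longrightarrow>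
      (\<Sum>K\<in>D. Sup K - Inf K) < \<delta> \<Longrightarrow> (\<Sum>K\<in>D. snorm N n (x (Sup K) - x (Inf K))) < \<epsilon>"
    using ac unfolding abs_continuous_curve_def by meson
  have "(\<Sum>K\<in>D. \<bar>x (Sup K) i k - x (Inf K) i k\<bar>) < \<epsilon>"
    if D: "D division_of \<Union>D" "\<Union>D \<subseteq> {0..T}" "(\<Sum>K\<in>D. Sup K - Inf K) < \<delta>" for D
  proof -
    have "(\<Sum>K\<in>D. \<bar>x (Sup K) i k - x (Inf K) i k\<bar>) \<le> (\<Sum>K\<in>D. snorm N n (x (Sup K) - x (Inf K)))"
      using abs_coord_le_snorm[OF ik] by (intro sum_mono) (metis fun_diff_def)
    then show ?thesis using \<delta>(2)[OF D] by linarith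
  qed
  with \<delta>(1) show "\<exists>\<delta>>0. \<forall>D. D division_of \<Union>D \<longrightarrow> \<Union>D \<subseteq> {0..T} \<longrightarrow> (\<Sum>K\<in>D. Sup K - Inf K) < \<delta> \<longrightarrow>
        (\<Sum>K\<in>D. \<bar>x (Sup K) i k - x (Inf K) i k\<bar>) < \<epsilon>" by blast
qed

lemma krasovsky_on_velocity:
  assumes "krasovsky_on N n g T x"
  obtains Z where "negligible Z"
    "\<And>t. t \<in> {0..T} - Z \<Longrightarrow> \<exists>v\<in>krasovsky_set N n g (x t).
       \<forall>i k. ((\<lambda>s. x s i k) has_real_derivative v i k) (at t within {0..T})"
proof -
  have "AE t in lebesgue_on {0..T}. \<exists>v\<in>krasovsky_set N n g (x t). has_velocity T x v t"
    using assms unfolding krasovsky_on_def by blast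
  then obtain Z where Z: "negligible Z" 
    "\<And>t. t \<in> {0..T} - Z \<Longrightarrow> \<exists>v\<in>krasovsky_set N n g (x t). has_velocity T x v t"
    by (rule AE_lebesgue_on_negligible) (rule that)
  show thesis by (rule that[OF Z(1)]) (use Z(2) in \<open>auto simp: has_velocity_def\<close>)
qed

section \<open>Contractivity of the support\<close>

lemma pos_part_square_derivative:
  "((\<lambda>y. (max 0 (y - c))\<^sup>2) has_real_derivative 2 * max 0 (y - c)) (at y)" for c y :: real
proof -
  consider "y < c" | "y > c" | "y = c" by linarith
  then show ?thesis
  proof cases
    case 1
    have "((\<lambda>y. 0) has_real_derivative 0) (at y)" by simp
    then have "((\<lambda>y. (max 0 (y - c))\<^sup>2) has_real_derivative 0) (at y)"
      by (rule has_field_derivative_transform_within_open[of _ _ _ "{..<c}"]) (use 1 in auto)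
    then show ?thesis using 1 by simp
  next
    case 2
    have "((\<lambda>y. (y - c)\<^sup>2) has_real_derivative 2 * (y - c)) (at y)"
      by (auto intro!: derivative_eq_intros)
    then have "((\<lambda>y. (max 0 (y - c))\<^sup>2) has_real_derivative 2 * (y - c)) (at y)"
      by (rule has_field_derivative_transform_within_open[of _ _ _ "{c<..}"]) (use 2 in auto)
    then show ?thesis using 2 by simp
  next
    case 3
    have "((\<lambda>h. ((max 0 (c + h - c))\<^sup>2 - (max 0 (c - c))\<^sup>2) / h) \<longlongrightarrow> 0) (at 0)"
    proof (rule Lim_null_comparison)
      show "\<forall>\<^sub>F h in at 0. norm (((max 0 (c + h - c))\<^sup>2 - (max 0 (c - c))\<^sup>2) / h) \<le> \<bar>h\<bar>"
        by (rule always_eventually) (auto simp: max_def power2_eq_square)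
      show "((\<lambda>h::real. \<bar>h\<bar>) \<longlongrightarrow> 0) (at 0)" by (rule tendsto_eq_intros refl | simp)+
    qed
    then show ?thesis using 3 by (simp add: DERIV_def)
  qed
qed

text \<open>
  The nearest point \<open>z l\<close> to \<open>q\<close> in the hull exists because the simplex of weights is compact, and
  \<open>b = q - z l\<close> is a normal vector of a separating hyperplane through it: moving \<open>l\<close> slightly towards
  the vertex \<open>j\<close> cannot decrease the distance, which forces \<open>b \<bullet> (p j - z l) \<le> 0\<close>.
\<close>

lemma separation_from_finite_hull:
  fixes p :: "nat \<Rightarrow> point"
  assumes J: "finite J" "J \<noteq> {}" and p: "\<And>j. j \<in> J \<Longrightarrow> p j \<in> topspace (Euclidean_space n)"
    and q: "q \<in> topspace (Euclidean_space n)" "q \<notin> convex hull (p ` J)"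
  obtains b c where "\<And>j. j \<in> J \<Longrightarrow> (\<Sum>k<n. b k * p j k) \<le> c" "c < (\<Sum>k<n. b k * q k)"
proof -
  define \<Lambda> where "\<Lambda> = {l :: nat \<Rightarrow> real. (\<forall>j. l j \<in> (if j \<in> J then {0..1} else {0})) \<and> (\<Sum>j\<in>J. l j) = 1}"
  define z where "z l k = (\<Sum>j\<in>J. l j * p j k)" for l k
  define dst where "dst l = (\<Sum>k<n. (q k - z l k)\<^sup>2)" for l
  have "compact (PiE UNIV (\<lambda>j. if j \<in> J then {0..1::real} else {0}))"
    using compactin_PiE[of "\<lambda>_. euclidean" UNIV "\<lambda>j. if j \<in> J then {0..1::real} else {0}"]
    by (simp add: euclidean_product_topology)
  moreover have "closed {l :: nat \<Rightarrow> real. (\<Sum>j\<in>J. l j) = 1}"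
    by (intro closed_Collect_eq continuous_on_sum continuous_on_product_coordinates continuous_on_const)
  moreover have "\<Lambda> = PiE UNIV (\<lambda>j. if j \<in> J then {0..1} else {0}) \<inter> {l. (\<Sum>j\<in>J. l j) = 1}"
    by (auto simp: \<Lambda>_def PiE_def Pi_def)
  ultimately have "compact \<Lambda>" by (simp add: compact_Int_closed)
  obtain j0 where "j0 \<in> J" using J by auto
  then have "(\<lambda>j. if j = j0 then 1 else 0) \<in> \<Lambda>" using J by (auto simp: \<Lambda>_def)
  moreover have "continuous_on \<Lambda> dst"
    unfolding dst_def z_def
    by (intro continuous_on_sum continuous_on_power continuous_on_diff continuous_on_mult_right
        continuous_on_const continuous_on_subset[OF continuous_on_product_coordinates]) auto
  ultimately obtain l where l: "l \<in> \<Lambda>" "\<And>m. m \<in> \<Lambda> \<Longrightarrow> dst l \<le> dst m"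
    using continuous_attains_inf[OF \<open>compact \<Lambda>\<close>, of dst] by blast
  define b where "b k = q k - z l k" for k
  have l01: "0 \<le> l j" if "j \<in> J" for j using l(1) that by (auto simp: \<Lambda>_def split: if_splits dest!: spec[of _ j])
  have l1: "(\<Sum>j\<in>J. l j) = 1" using l(1) by (simp add: \<Lambda>_def)
  have "z l = (\<Sum>j\<in>J. l j *\<^sub>R p j)" by (rule ext) (simp add: z_def sum_apply)
  also have "\<dots> \<in> convex hull (p ` J)"
    using l01 l1 J by (intro convex_sum convex_convex_hull) (auto intro: hull_inc)
  finally have "q \<noteq> z l" using q by auto
  moreover have "z l \<in> topspace (Euclidean_space n)"
    using p by (auto simp: topspace_Euclidean_space z_def intro!: sum.neutral)
  ultimately obtain k0 where "k0 < n" "b k0 \<noteq> 0"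
    using point_eqI[OF q(1)] by (fastforce simp: b_def)
  then have bpos: "(\<Sum>k<n. b k * b k) > 0"
    by (intro sum_pos2[of _ k0]) (auto simp: zero_less_mult_iff)
  have var: "(\<Sum>k<n. b k * (p j k - z l k)) \<le> 0" if j: "j \<in> J" for j
  proof -
    define d where "d k = p j k - z l k" for k
    have step: "2 * (\<Sum>k<n. b k * d k) \<le> \<tau> * (\<Sum>k<n. d k * d k)" if "0 < \<tau>" "\<tau> \<le> 1" for \<tau> :: real
    proof -
      define m where "m i = (1 - \<tau>) * l i + (if i = j then \<tau> else 0)" for i
      have sm: "(\<Sum>i\<in>J. m i * h i) = (1 - \<tau>) * (\<Sum>i\<in>J. l i * h i) + \<tau> * h j" for h
        using J(1) j by (simp add: m_def distrib_right sum.distrib sum_distrib_left mult.assoc if_distrib[of "\<lambda>x. x * _"]  cong: if_cong)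
      have m1: "(\<Sum>i\<in>J. m i) = 1" using sm[of "\<lambda>_. 1"] l1 by simp
      have m0: "0 \<le> m i" if "i \<in> J" for i using l01[OF that] \<open>0 < \<tau>\<close> \<open>\<tau> \<le> 1\<close> by (simp add: m_def)
      have "m i \<le> 1" if "i \<in> J" for i
        using member_le_sum[of i J m] m0 m1 that J(1) by auto
      moreover have "m i = 0" if "i \<notin> J" for i
        using l(1) that j by (auto simp: m_def \<Lambda>_def split: if_splits dest!: spec[of _ i])
      ultimately have "m \<in> \<Lambda>" using m0 m1 by (auto simp: \<Lambda>_def)
      then have "dst l \<le> dst m" by (rule l(2))
      moreover have "q k - z m k = b k - \<tau> * d k" for k
        by (simp add: z_def sm b_def d_def algebra_simps)
      ultimately have "(\<Sum>k<n. b k * b k) \<le> (\<Sum>k<n. (b k - \<tau> * d k)\<^sup>2)"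
        by (simp add: dst_def b_def power2_eq_square)
      also have "\<dots> = (\<Sum>k<n. b k * b k) - \<tau> * (2 * (\<Sum>k<n. b k * d k)) + \<tau> * (\<tau> * (\<Sum>k<n. d k * d k))"
        by (simp add: power2_eq_square sum_distrib_left sum.distrib sum_subtractf algebra_simps)
      finally have "\<tau> * (2 * (\<Sum>k<n. b k * d k)) \<le> \<tau> * (\<tau> * (\<Sum>k<n. d k * d k))" by simp
      then show ?thesis using \<open>0 < \<tau>\<close> by simp
    qed
    define S where "S = (\<Sum>k<n. d k * d k)"
    have "S \<ge> 0" unfolding S_def by (intro sum_nonneg) auto
    have "2 * (\<Sum>k<n. b k * d k) \<le> 0"
    proof (rule field_le_epsilon)
      fix e :: real assume "e > 0"
      define \<tau> where "\<tau> = min 1 (e / (S + 1))"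
      have "0 < \<tau>" "\<tau> \<le> 1" using \<open>e > 0\<close> \<open>S \<ge> 0\<close> by (auto simp: \<tau>_def)
      then have "2 * (\<Sum>k<n. b k * d k) \<le> \<tau> * S" using step by (simp add: S_def)
      also have "\<dots> \<le> e / (S + 1) * S" using \<open>S \<ge> 0\<close> by (intro mult_right_mono) (auto simp: \<tau>_def)
      also have "\<dots> \<le> 0 + e" using \<open>e > 0\<close> \<open>S \<ge> 0\<close> by (simp add: field_simps)
      finally show "2 * (\<Sum>k<n. b k * d k) \<le> 0 + e" .
    qed
    then show ?thesis by (simp add: d_def)
  qed
  show thesis
  proof (rule that[of b "\<Sum>k<n. b k * z l k"])
    show "(\<Sum>k<n. b k * p j k) \<le> (\<Sum>k<n. b k * z l k)" if "j \<in> J" for j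
      using var[OF that] by (simp add: right_diff_distrib sum_subtractf)
    show "(\<Sum>k<n. b k * z l k) < (\<Sum>k<n. b k * q k)"
      using bpos by (simp add: b_def right_diff_distrib sum_subtractf)
  qed
qed

lemma snorm_curve_bounded:
  assumes "abs_continuous_curve N n T x"
  obtains R where "\<And>t. t \<in> {0..T} \<Longrightarrow> snorm N n (x t) \<le> R"
proof -
  have "continuous_on {0..T} (\<lambda>t. snorm N n (x t))"
    unfolding snorm_def enorm_def L2_set_def
    by (intro continuous_on_real_sqrt continuous_on_sum continuous_on_power
        abs_continuous_on_imp_continuous_on abs_continuous_curve_coord[OF assms]) auto
  then have "bounded ((\<lambda>t. snorm N n (x t)) ` {0..T})"
    by (intro compact_imp_bounded compact_continuous_image) auto
  then obtain R where "\<forall>y\<in>(\<lambda>t. snorm N n (x t)) ` {0..T}. norm y \<le> R"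
    unfolding bounded_iff by blast
  then show thesis by (intro that[of R]) (auto simp: abs_le_iff)
qed

lemma bc_field_apply:
  "i \<in> {1..N} \<Longrightarrow> bc_field N n a Nb y i k = (\<Sum>j\<in>Nb y i. a (enorm n (y j - y i)) * (y j k - y i k))"
  by (simp add: bc_field_def sum_apply)

lemma interaction_nonneg: "interaction a \<Longrightarrow> r \<ge> 0 \<Longrightarrow> a r \<ge> 0"
  and interaction_pos: "interaction a \<Longrightarrow> r > 0 \<Longrightarrow> a r > 0"
  and interaction_mono: "interaction a \<Longrightarrow> 0 \<le> r \<Longrightarrow> r \<le> s \<Longrightarrow> a r \<le> a s"
  by (auto simp: interaction_def mono_on_def)

lemma enorm_diff_le_snorm:
  assumes "i \<in> {1..N}" "j \<in> {1..N}"
  shows "enorm n (y j - y i) \<le> 2 * snorm N n y"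
  using enorm_diff_perturb[OF assms, of n y 0] by (simp add: enorm_def[of n 0] L2_set_def)

text \<open>
  Let \<open>p i\<close> be the excess of \<open>b \<bullet> x i\<close> over \<open>c\<close>. If \<open>p i > 0\<close>, an agent \<open>j\<close> can pull agent \<open>i\<close> further
  out only by being further out itself, so its contribution to the left-hand side is at most its
  weight times \<open>p i * p j\<close>. The weights near \<open>x\<close> are bounded by \<open>a (2 * R + 2)\<close>, and
  \<open>(\<Sum>i. p i)\<^sup>2 \<le> N * (\<Sum>i. (p i)\<^sup>2)\<close>.
\<close>

lemma excess_velocity_le:
  fixes b :: point and c :: real
  assumes a: "interaction a" and Nb: "\<And>y i. Nb y i \<subseteq> {1..N}" and R: "snorm N n x \<le> R"
    and v: "v \<in> krasovsky_set N n (bc_field N n a Nb) x"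
  defines "p i \<equiv> max 0 ((\<Sum>k<n. b k * x i k) - c)"
  shows "pairing N n (\<lambda>i k. p i * b k) v \<le> a (2 * R + 2) * real N * (\<Sum>i\<in>{1..N}. (p i)\<^sup>2)"
  using v
proof (rule krasovsky_set_halfspace)
  fix \<epsilon> :: real assume "\<epsilon> > 0"
  define B where "B = (\<Sum>k<n. \<bar>b k\<bar>)"
  define W where "W = a (2 * R + 2)"
  define P where "P = (\<Sum>i\<in>{1..N}. p i)"
  define l where "l z = (\<Sum>k<n. b k * z k)" for z :: point
  have R0: "R \<ge> 0" using R order_trans[OF L2_set_nonneg] unfolding snorm_def by blast
  then have W0: "W \<ge> 0" using interaction_nonneg[OF a] by (simp add: W_def)
  have p0: "p i \<ge> 0" for i by (simp add: p_def)
  have P0: "P \<ge> 0" unfolding P_def using p0 by (intro sum_nonneg) auto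
  have B0: "B \<ge> 0" unfolding B_def by (intro sum_nonneg) auto
  define M where "M = W * (real N * (2 * B) * P)"
  have M0: "M \<ge> 0" using W0 P0 B0 by (simp add: M_def)
  define \<delta> where "\<delta> = min 1 (\<epsilon> / (M + 1))"
  have \<delta>: "\<delta> > 0" "\<delta> \<le> 1" "M * \<delta> \<le> \<epsilon>"
  proof -
    show "\<delta> > 0" "\<delta> \<le> 1" using \<open>\<epsilon> > 0\<close> M0 by (auto simp: \<delta>_def)
    have "M * \<delta> \<le> M * (\<epsilon> / (M + 1))" using M0 by (intro mult_left_mono) (auto simp: \<delta>_def)
    also have "\<dots> \<le> \<epsilon>" using M0 \<open>\<epsilon> > 0\<close> by (simp add: field_simps)
    finally show "M * \<delta> \<le> \<epsilon>" .
  qed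
  have "pairing N n (\<lambda>i k. p i * b k) (bc_field N n a Nb y) \<le> W * real N * (\<Sum>i\<in>{1..N}. (p i)\<^sup>2) + \<epsilon>"
    if y: "y \<in> state_space N n" "snorm N n (y - x) < \<delta>" for y
  proof -
    define w where "w i j = a (enorm n (y j - y i))" for i j
    have w: "0 \<le> w i j" "w i j \<le> W" if "i \<in> {1..N}" "j \<in> {1..N}" for i j
    proof -
      show "0 \<le> w i j" using interaction_nonneg[OF a] by (simp add: w_def)
      have "enorm n (y j - y i) \<le> enorm n (x j - x i) + 2 * snorm N n (y - x)"
        using enorm_diff_perturb[OF that, of n y x] by linarith
      also have "\<dots> \<le> 2 * R + 2"
        using enorm_diff_le_snorm[OF that, of n x] R y(2) \<delta>(2) by linarith
      finally show "w i j \<le> W" unfolding w_def W_def by (intro interaction_mono[OF a]) auto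
    qed
    have near: "\<bar>l (y i) - l (x i)\<bar> \<le> B * \<delta>" if "i \<in> {1..N}" for i
    proof -
      have "l (y i) - l (x i) = (\<Sum>k<n. b k * (y - x) i k)"
        by (simp add: l_def right_diff_distrib sum_subtractf)
      then have "\<bar>l (y i) - l (x i)\<bar> \<le> (\<Sum>k<n. \<bar>b k * (y - x) i k\<bar>)" by (simp only: sum_abs)
      also have "\<dots> \<le> (\<Sum>k<n. \<bar>b k\<bar> * \<delta>)"
      proof (rule sum_mono)
        fix k assume "k \<in> {..<n}"
        then have "\<bar>(y - x) i k\<bar> \<le> \<delta>"
          using abs_coord_le_snorm[OF that, of k n "y - x"] y(2) by auto
        then show "\<bar>b k * (y - x) i k\<bar> \<le> \<bar>b k\<bar> * \<delta>" unfolding abs_mult by (intro mult_left_mono) auto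
      qed
      finally show ?thesis by (simp add: B_def sum_distrib_right)
    qed
    have pair: "p i * (w i j * (l (y j) - l (y i))) \<le> W * (p i * p j + 2 * B * \<delta> * p i)"
      if ij: "i \<in> {1..N}" "j \<in> {1..N}" for i j
    proof (cases "p i = 0")
      case False
      then have "p i > 0" using p0[of i] by simp
      then have "l (x i) = c + p i" by (auto simp: p_def l_def max_def split: if_splits)
      moreover have "l (x j) \<le> c + p j" by (simp add: p_def l_def)
      ultimately have "l (y j) - l (y i) \<le> p j + 2 * B * \<delta>"
        using near[OF ij(1)] near[OF ij(2)] \<open>p i > 0\<close> by linarith
      then have "w i j * (l (y j) - l (y i)) \<le> w i j * (p j + 2 * B * \<delta>)"
        using w[OF ij] by (intro mult_left_mono)
      also have "\<dots> \<le> W * (p j + 2 * B * \<delta>)"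
        using w[OF ij] p0 B0 \<delta>(1) by (intro mult_right_mono) auto
      finally have "p i * (w i j * (l (y j) - l (y i))) \<le> p i * (W * (p j + 2 * B * \<delta>))"
        using p0 by (intro mult_left_mono)
      then show ?thesis by (simp add: algebra_simps)
    qed auto
    have "pairing N n (\<lambda>i k. p i * b k) (bc_field N n a Nb y)
        = (\<Sum>i\<in>{1..N}. \<Sum>j\<in>Nb y i. p i * (w i j * (l (y j) - l (y i))))"
      unfolding pairing_def
    proof (rule sum.cong[OF refl])
      fix i assume i: "i \<in> {1..N}"
      have "(\<Sum>k<n. p i * b k * bc_field N n a Nb y i k)
          = (\<Sum>k<n. \<Sum>j\<in>Nb y i. p i * b k * (w i j * (y j k - y i k)))"
        by (simp add: bc_field_apply[OF i] sum_distrib_left w_def)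
      also have "\<dots> = (\<Sum>j\<in>Nb y i. \<Sum>k<n. p i * b k * (w i j * (y j k - y i k)))"
        by (rule sum.swap)
      also have "\<dots> = (\<Sum>j\<in>Nb y i. p i * (w i j * (l (y j) - l (y i))))"
      proof (rule sum.cong[OF refl])
        fix j
        have "l (y j) - l (y i) = (\<Sum>k<n. b k * (y j k - y i k))"
          by (simp add: l_def right_diff_distrib sum_subtractf)
        then show "(\<Sum>k<n. p i * b k * (w i j * (y j k - y i k))) = p i * (w i j * (l (y j) - l (y i)))"
          by (simp add: sum_distrib_left mult.assoc mult.left_commute)
      qed
      finally show "(\<Sum>k<n. p i * b k * bc_field N n a Nb y i k)
        = (\<Sum>j\<in>Nb y i. p i * (w i j * (l (y j) - l (y i))))" .
    qed
    also have "\<dots> \<le> (\<Sum>i\<in>{1..N}. \<Sum>j\<in>Nb y i. W * (p i * p j + 2 * B * \<delta> * p i))"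
      using pair Nb by (intro sum_mono) blast
    also have "\<dots> \<le> (\<Sum>i\<in>{1..N}. \<Sum>j\<in>{1..N}. W * (p i * p j + 2 * B * \<delta> * p i))"
      using Nb W0 p0 B0 \<delta>(1) by (intro sum_mono sum_mono2) auto
    also have "\<dots> = W * (P * P + (real N * (2 * B) * P) * \<delta>)"
      by (simp add: P_def sum_product sum.distrib sum_distrib_left sum_distrib_right algebra_simps)
    also have "\<dots> = W * P\<^sup>2 + M * \<delta>" by (simp add: M_def power2_eq_square algebra_simps)
    also have "\<dots> \<le> W * (real N * (\<Sum>i\<in>{1..N}. (p i)\<^sup>2)) + \<epsilon>"
      using \<delta>(3) W0 sum_squared_le_sum_of_squares[of p "{1..N}"]
      by (intro add_mono mult_left_mono) (auto simp: P_def mult.commute)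
    finally show ?thesis by simp
  qed
  then show "\<exists>\<delta>>0. \<forall>y\<in>state_space N n. snorm N n (y - x) < \<delta> \<longrightarrow>
      pairing N n (\<lambda>i k. p i * b k) (bc_field N n a Nb y) \<le> a (2 * R + 2) * real N * (\<Sum>i\<in>{1..N}. (p i)\<^sup>2) + \<epsilon>"
    using \<delta>(1) unfolding W_def by blast
qed

text \<open>
  Gronwall's argument: \<open>F\<close>, the sum of the squared excesses damped by \<open>exp (- C * t)\<close>, is
  nonincreasing by \<open>excess_velocity_le\<close>, is \<open>0\<close> at time \<open>s\<close>, and is never negative.
\<close>

lemma halfspace_invariant:
  fixes b :: point and c :: real
  assumes a: "interaction a" and Nb: "\<And>y i. Nb y i \<subseteq> {1..N}"
    and sol: "krasovsky_on N n (bc_field N n a Nb) T x"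
    and st: "0 \<le> s" "s \<le> t" "t \<le> T"
    and start: "\<And>i. i \<in> {1..N} \<Longrightarrow> (\<Sum>k<n. b k * x s i k) \<le> c"
    and i: "i \<in> {1..N}"
  shows "(\<Sum>k<n. b k * x t i k) \<le> c"
proof -
  have cur: "abs_continuous_curve N n T x"
    using sol by (auto simp: krasovsky_on_def)
  obtain R where R: "\<And>t. t \<in> {0..T} \<Longrightarrow> snorm N n (x t) \<le> R" using snorm_curve_bounded[OF cur] by blast
  define C where "C = 2 * (a (2 * R + 2) * real N)"
  define l where "l i t = (\<Sum>k<n. b k * x t i k)" for i t
  define p where "p i t = max 0 (l i t - c)" for i t
  define F where "F t = exp (- C * t) * (\<Sum>i\<in>{1..N}. (p i t)\<^sup>2)" for t
  have sub: "{s..t} \<subseteq> {0..T}" using st by auto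
  obtain Z where Z: "negligible Z" and vel: "\<And>t. t \<in> {0..T} - Z \<Longrightarrow>
      \<exists>v\<in>krasovsky_set N n (bc_field N n a Nb) (x t).
       \<forall>i k. ((\<lambda>s. x s i k) has_real_derivative v i k) (at t within {0..T})"
    using krasovsky_on_velocity[OF sol] by blast
  have acl: "abs_continuous_on s t (l i)" if "i \<in> {1..N}" for i
    unfolding l_def using abs_continuous_curve_coord[OF cur that]
    by (intro abs_continuous_on_sum abs_continuous_on_cmult abs_continuous_on_subinterval[OF _ sub]) auto
  have acp: "abs_continuous_on s t (p i)" if "i \<in> {1..N}" for i
    unfolding p_def by (rule abs_continuous_on_compose_lipschitz[OF acl[OF that], of "\<lambda>y. max 0 (y - c)" 1]) auto
  \<comment> \<open>The exponential is Lipschitz on a bounded interval.\<close>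
  have acexp: "abs_continuous_on s t (\<lambda>\<tau>. exp (- C * \<tau>))"
  proof -
    have "\<exists>B. \<forall>\<tau>\<in>{s..t}. norm (exp (- C * \<tau>) * (- C)) \<le> B"
    proof -
      have "compact ((\<lambda>\<tau>. exp (- C * \<tau>) * (- C)) ` {s..t})"
        by (intro compact_continuous_image continuous_intros) auto
      then show ?thesis using compact_imp_bounded by (fastforce simp: bounded_iff)
    qed
    then obtain B where B: "\<And>\<tau>. \<tau> \<in> {s..t} \<Longrightarrow> norm (exp (- C * \<tau>) * (- C)) \<le> B" by blast
    show ?thesis
    proof (rule abs_continuous_on_compose_lipschitz[OF abs_continuous_on_ident, of _ _ _ B])
      fix u w assume uw: "u \<in> {s..t}" "w \<in> {s..t}"
      have "norm (exp (- C * u) - exp (- C * w)) \<le> B * norm (u - w)"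
        by (rule field_differentiable_bound[of "{s..t}" _ "\<lambda>\<tau>. exp (- C * \<tau>) * (- C)"])
           (use uw B in \<open>auto intro!: derivative_eq_intros\<close>)
      then show "\<bar>exp (- C * u) - exp (- C * w)\<bar> \<le> B * \<bar>u - w\<bar>" by simp
    qed
  qed
  have acF: "abs_continuous_on s t F"
    unfolding F_def power2_eq_square
    by (intro abs_continuous_on_mult acexp abs_continuous_on_sum acp) auto
  have "F t \<le> F s"
  proof (rule abs_continuous_nonincreasing[OF st(2) acF Z])
    fix \<tau> assume \<tau>: "\<tau> \<in> {s..t} - Z"
    then have "\<tau> \<in> {0..T} - Z" using sub by auto
    with vel obtain v where v: "v \<in> krasovsky_set N n (bc_field N n a Nb) (x \<tau>)"
      "\<And>i k. ((\<lambda>s. x s i k) has_real_derivative v i k) (at \<tau> within {0..T})" by blast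
    have dl: "(l i has_real_derivative (\<Sum>k<n. b k * v i k)) (at \<tau> within {s..t})" for i
      unfolding l_def using DERIV_subset[OF v(2) sub]
      by (intro DERIV_sum DERIV_cmult) auto
    have dp: "((\<lambda>\<tau>. (p i \<tau>)\<^sup>2) has_real_derivative 2 * p i \<tau> * (\<Sum>k<n. b k * v i k)) (at \<tau> within {s..t})" for i
      using DERIV_chain2[OF pos_part_square_derivative[of c] dl[of i]] by (simp add: p_def)
    let ?d = "exp (- C * \<tau>) * (\<Sum>i\<in>{1..N}. 2 * p i \<tau> * (\<Sum>k<n. b k * v i k))
        + exp (- C * \<tau>) * (- C) * (\<Sum>i\<in>{1..N}. (p i \<tau>)\<^sup>2)"
    have "(F has_real_derivative ?d) (at \<tau> within {s..t})"
      unfolding F_def by (rule derivative_eq_intros dp refl | simp)+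
    moreover have "?d = 2 * exp (- C * \<tau>) *
        (pairing N n (\<lambda>i k. p i \<tau> * b k) v - C / 2 * (\<Sum>i\<in>{1..N}. (p i \<tau>)\<^sup>2))"
      by (simp add: pairing_def sum_distrib_left sum_distrib_right sum_negf algebra_simps)
    moreover have "\<dots> \<le> 0"
      using excess_velocity_le[OF a Nb R v(1), of b c] \<tau> sub
      by (intro mult_nonneg_nonpos) (auto simp: C_def p_def l_def)
    ultimately show "\<exists>d\<le>0. (F has_real_derivative d) (at \<tau> within {s..t})"
      by (intro exI[of _ ?d]) simp
  qed
  also have "F s = 0" using start by (auto simp: F_def p_def l_def intro!: sum.neutral)
  finally have "(\<Sum>i\<in>{1..N}. (p i t)\<^sup>2) \<le> 0" by (simp add: F_def mult_le_0_iff)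
  moreover have "(p i t)\<^sup>2 \<le> (\<Sum>i\<in>{1..N}. (p i t)\<^sup>2)"
    by (rule member_le_sum) (use i in auto)
  ultimately have "(p i t)\<^sup>2 \<le> 0" by linarith
  then show ?thesis by (simp add: p_def l_def)
qed

lemma krasovsky_support_contracting:
  assumes a: "interaction a" and Nb: "\<And>y i. Nb y i \<subseteq> {1..N}" and N: "N \<ge> 1"
    and sol: "krasovsky_solution N n (bc_field N n a Nb) x"
  shows "support_contracting N x"
  unfolding support_contracting_def
proof (intro allI impI)
  fix s t :: real assume st: "0 \<le> s \<and> s \<le> t"
  have on: "krasovsky_on N n (bc_field N n a Nb) (t + 1) x"
    using sol st by (auto simp: krasovsky_solution_def)
  then have xS: "\<And>\<tau>. \<tau> \<in> {0..t+1} \<Longrightarrow> x \<tau> \<in> state_space N n" by (auto simp: krasovsky_on_def)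
  have "x t i \<in> convex hull (x s ` {1..N})" if i: "i \<in> {1..N}" for i
  proof (rule ccontr)
    assume "x t i \<notin> convex hull (x s ` {1..N})"
    then obtain b c where bc: "\<And>j. j \<in> {1..N} \<Longrightarrow> (\<Sum>k<n. b k * x s j k) \<le> c" "c < (\<Sum>k<n. b k * x t i k)"
      using separation_from_finite_hull[of "{1..N}" "x s" n "x t i"] N i st xS state_spaceD[of _ N n]
      by auto
    then show False
      using halfspace_invariant[OF a Nb on _ _ _ bc(1) i, of t] st by auto
  qed
  then have "convex hull (x t ` {1..N}) \<subseteq> convex hull (x s ` {1..N})"
    by (intro hull_minimal) auto
  then show "closed_hull (x t ` {1..N}) \<subseteq> closed_hull (x s ` {1..N})"
    unfolding closed_hull_def by (rule closure_mono)
qed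

section \<open>Convex functionals in the metric model\<close>

lemma separable_functional_decreasing:
  fixes \<phi> \<phi>' :: "nat \<Rightarrow> real \<Rightarrow> real"
  assumes sol: "krasovsky_on N n g T x"
    and st: "0 \<le> s" "s \<le> t" "t \<le> T"
    and \<phi>: "\<And>k y. (\<phi> k has_real_derivative \<phi>' k y) (at y)" "\<And>k. continuous_on UNIV (\<phi>' k)"
    and dec: "\<And>\<tau> v. \<tau> \<in> {s..t} \<Longrightarrow> v \<in> krasovsky_set N n g (x \<tau>) \<Longrightarrow>
      pairing N n (\<lambda>i k. \<phi>' k (x \<tau> i k)) v \<le> - \<eta>"
  shows "(\<Sum>i\<in>{1..N}. \<Sum>k<n. \<phi> k (x t i k)) \<le> (\<Sum>i\<in>{1..N}. \<Sum>k<n. \<phi> k (x s i k)) - \<eta> * (t - s)"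
proof -
  have cur: "abs_continuous_curve N n T x" using sol by (auto simp: krasovsky_on_def)
  define F where "F t = (\<Sum>i\<in>{1..N}. \<Sum>k<n. \<phi> k (x t i k)) + \<eta> * t" for t
  have sub: "{s..t} \<subseteq> {0..T}" using st by auto
  obtain Z where Z: "negligible Z" and vel: "\<And>t. t \<in> {0..T} - Z \<Longrightarrow>
      \<exists>v\<in>krasovsky_set N n g (x t).
       \<forall>i k. ((\<lambda>s. x s i k) has_real_derivative v i k) (at t within {0..T})"
    using krasovsky_on_velocity[OF sol] by blast
  have ac1: "abs_continuous_on s t (\<lambda>\<tau>. \<phi> k (x \<tau> i k))" if ik: "i \<in> {1..N}" "k < n" for i k
  proof -
    have acx: "abs_continuous_on s t (\<lambda>\<tau>. x \<tau> i k)"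
      by (rule abs_continuous_on_subinterval[OF abs_continuous_curve_coord[OF cur ik] sub])
    obtain R where R: "\<And>t. t \<in> {0..T} \<Longrightarrow> snorm N n (x t) \<le> R" using snorm_curve_bounded[OF cur] by blast
    have xR: "x \<tau> i k \<in> {-R..R}" if "\<tau> \<in> {s..t}" for \<tau>
      using R[of \<tau>] abs_coord_le_snorm[OF ik, of "x \<tau>"] that sub by auto
    have "compact (\<phi>' k ` {-R..R})"
      using \<phi>(2) by (intro compact_continuous_image) (auto intro: continuous_on_subset)
    then have "bounded (\<phi>' k ` {-R..R})" by (rule compact_imp_bounded)
    then obtain B where B: "\<And>y. y \<in> {-R..R} \<Longrightarrow> norm (\<phi>' k y) \<le> B"
      unfolding bounded_iff by blast
    show ?thesis
    proof (rule abs_continuous_on_compose_lipschitz[OF acx, of _ B])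
      fix u w assume "u \<in> {s..t}" "w \<in> {s..t}"
      then have "norm (\<phi> k (x u i k) - \<phi> k (x w i k)) \<le> B * norm (x u i k - x w i k)"
        using xR B by (intro field_differentiable_bound[of "{-R..R}" "\<phi> k" "\<phi>' k" B])
           (auto intro: has_field_derivative_at_within \<phi>(1))
      then show "\<bar>\<phi> k (x u i k) - \<phi> k (x w i k)\<bar> \<le> B * \<bar>x u i k - x w i k\<bar>" by simp
    qed
  qed
  have acF: "abs_continuous_on s t F"
    unfolding F_def
    by (intro abs_continuous_on_add abs_continuous_on_sum abs_continuous_on_cmult
        abs_continuous_on_ident ac1) auto
  have "F t \<le> F s"
  proof (rule abs_continuous_nonincreasing[OF st(2) acF Z])
    fix \<tau> assume \<tau>: "\<tau> \<in> {s..t} - Z"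
    then have "\<tau> \<in> {0..T} - Z" using sub by auto
    with vel obtain v where v: "v \<in> krasovsky_set N n g (x \<tau>)"
      "\<And>i k. ((\<lambda>s. x s i k) has_real_derivative v i k) (at \<tau> within {0..T})" by blast
    have d1: "((\<lambda>\<tau>. \<phi> k (x \<tau> i k)) has_real_derivative \<phi>' k (x \<tau> i k) * v i k) (at \<tau> within {s..t})" for i k
      by (rule DERIV_chain2[OF \<phi>(1) DERIV_subset[OF v(2) sub]])
    have "(F has_real_derivative pairing N n (\<lambda>i k. \<phi>' k (x \<tau> i k)) v + \<eta> * 1) (at \<tau> within {s..t})"
      unfolding F_def pairing_def
      by (intro DERIV_add DERIV_sum DERIV_cmult DERIV_ident d1)
    moreover have "pairing N n (\<lambda>i k. \<phi>' k (x \<tau> i k)) v + \<eta> * 1 \<le> 0"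
      using dec[OF _ v(1)] \<tau> by simp
    ultimately show "\<exists>d\<le>0. (F has_real_derivative d) (at \<tau> within {s..t})" by blast
  qed
  then show ?thesis by (simp add: F_def algebra_simps)
qed

definition metric_weight :: "nat \<Rightarrow> (real \<Rightarrow> real) \<Rightarrow> state \<Rightarrow> nat \<Rightarrow> nat \<Rightarrow> real" where
  "metric_weight n a y i j = (if enorm n (y j - y i) < 1 then a (enorm n (y j - y i)) else 0)"

lemma metric_weight_commute: "metric_weight n a y i j = metric_weight n a y j i"
  by (simp add: metric_weight_def enorm_minus_commute[of n "y i"])

lemma metric_weight_bounds:
  assumes "interaction a"
  shows "0 \<le> metric_weight n a y i j" "metric_weight n a y i j \<le> a 1"
  using interaction_nonneg[OF assms] interaction_mono[OF assms, of "enorm n (y j - y i)" 1]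
  by (auto simp: metric_weight_def)

text \<open>
  Symmetry of the weights allows the double sum to be averaged with its transpose. A monotone choice
  of \<open>c\<close> as a function of \<open>y\<close> makes every term of the resulting sum nonnegative; this
  is the source of all Lyapunov functionals of the model.
\<close>

lemma pairing_metric_model:
  "pairing N n c (metric_model N n a y) =
     - (1/2) * (\<Sum>i\<in>{1..N}. \<Sum>j\<in>{1..N}. metric_weight n a y i j * (\<Sum>k<n. (c i k - c j k) * (y i k - y j k)))"
proof -
  define A where "A i j = metric_weight n a y i j * (\<Sum>k<n. c i k * (y j k - y i k))" for i j
  have "pairing N n c (metric_model N n a y) = (\<Sum>i\<in>{1..N}. \<Sum>j\<in>{1..N}. A i j)"
    unfolding pairing_def
  proof (rule sum.cong[OF refl])
    fix i assume i: "i \<in> {1..N}"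
    have w: "(\<Sum>j\<in>metric_nbrs N n y i. a (enorm n (y j - y i)) * (y j k - y i k))
        = (\<Sum>j\<in>{1..N}. metric_weight n a y i j * (y j k - y i k))" for k
      by (rule sum.mono_neutral_cong_left) (auto simp: metric_nbrs_def metric_weight_def)
    have "(\<Sum>k<n. c i k * metric_model N n a y i k)
        = (\<Sum>k<n. \<Sum>j\<in>{1..N}. c i k * (metric_weight n a y i j * (y j k - y i k)))"
      by (simp only: bc_field_apply[OF i] w sum_distrib_left)
    also have "\<dots> = (\<Sum>j\<in>{1..N}. \<Sum>k<n. c i k * (metric_weight n a y i j * (y j k - y i k)))"
      by (rule sum.swap)
    also have "\<dots> = (\<Sum>j\<in>{1..N}. A i j)"
      by (simp add: A_def sum_distrib_left mult.left_commute)
    finally show "(\<Sum>k<n. c i k * metric_model N n a y i k) = (\<Sum>j\<in>{1..N}. A i j)" .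
  qed
  also have "\<dots> = (1/2) * ((\<Sum>i\<in>{1..N}. \<Sum>j\<in>{1..N}. A i j) + (\<Sum>i\<in>{1..N}. \<Sum>j\<in>{1..N}. A j i))"
    using sum.swap[of "\<lambda>i j. A i j" "{1..N}" "{1..N}"] by simp
  also have "\<dots> = (1/2) * (\<Sum>i\<in>{1..N}. \<Sum>j\<in>{1..N}. A i j + A j i)"
    by (simp add: sum.distrib)
  also have "\<dots> = (1/2) * (\<Sum>i\<in>{1..N}. \<Sum>j\<in>{1..N}.
      - (metric_weight n a y i j * (\<Sum>k<n. (c i k - c j k) * (y i k - y j k))))"
  proof -
    have "A i j + A j i = - (metric_weight n a y i j * (\<Sum>k<n. (c i k - c j k) * (y i k - y j k)))" for i j
    proof -
      have "A i j + A j i = metric_weight n a y i j *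
          ((\<Sum>k<n. c i k * (y j k - y i k)) + (\<Sum>k<n. c j k * (y i k - y j k)))"
        by (simp add: A_def metric_weight_commute[of n a y j i] distrib_left)
      also have "(\<Sum>k<n. c i k * (y j k - y i k)) + (\<Sum>k<n. c j k * (y i k - y j k))
          = - (\<Sum>k<n. (c i k - c j k) * (y i k - y j k))"
        by (simp add: sum_negf[symmetric] sum.distrib[symmetric] algebra_simps)
      finally show ?thesis by simp
    qed
    then show ?thesis by simp
  qed
  finally show ?thesis by (simp add: sum_negf)
qed

text \<open>
  The factor \<open>c\<close> is fixed at \<open>x\<close> while the field is evaluated at nearby states \<open>y\<close>, so the
  monotonicity of \<open>c\<close> survives only up to an error of order \<open>norm (y - x)\<close>. The lower bounds
  \<open>\<omega>\<close> for the weights have to hold at all those \<open>y\<close>; they allow for pairs at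
  distance exactly \<open>1\<close>, whose weight jumps.
\<close>

lemma metric_velocity_le:
  assumes a: "interaction a"
    and v: "v \<in> krasovsky_set N n (metric_model N n a) x"
    and m: "\<And>i j. i \<in> {1..N} \<Longrightarrow> j \<in> {1..N} \<Longrightarrow> 0 \<le> (\<Sum>k<n. (c i k - c j k) * (x i k - x j k))"
    and \<omega>: "\<delta>\<^sub>0 > 0" "\<And>y i j. snorm N n (y - x) < \<delta>\<^sub>0 \<Longrightarrow> i \<in> {1..N} \<Longrightarrow> j \<in> {1..N} \<Longrightarrow> \<omega> i j \<le> metric_weight n a y i j"
  shows "pairing N n c v \<le> - (1/2) * (\<Sum>i\<in>{1..N}. \<Sum>j\<in>{1..N}. \<omega> i j * (\<Sum>k<n. (c i k - c j k) * (x i k - x j k)))"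
  using v
proof (rule krasovsky_set_halfspace)
  fix \<epsilon> :: real assume "\<epsilon> > 0"
  define V where "V = {1..N}"
  define D where "D i j = (\<Sum>k<n. \<bar>c i k - c j k\<bar>)" for i j
  define mx where "mx y i j = (\<Sum>k<n. (c i k - c j k) * (y i k - y j k))" for y :: state and i j
  define M where "M = a 1 * (\<Sum>i\<in>V. \<Sum>j\<in>V. D i j)"
  have D0: "D i j \<ge> 0" for i j unfolding D_def by (intro sum_nonneg) auto
  have M0: "M \<ge> 0" unfolding M_def using D0 interaction_nonneg[OF a, of 1]
    by (intro mult_nonneg_nonneg sum_nonneg) auto
  define \<delta> where "\<delta> = min \<delta>\<^sub>0 (\<epsilon> / (M + 1))"
  have \<delta>: "\<delta> > 0" "\<delta> \<le> \<delta>\<^sub>0" "M * \<delta> \<le> \<epsilon>"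
  proof -
    show "\<delta> > 0" "\<delta> \<le> \<delta>\<^sub>0" using \<open>\<epsilon> > 0\<close> M0 \<omega>(1) by (auto simp: \<delta>_def)
    have "M * \<delta> \<le> M * (\<epsilon> / (M + 1))" using M0 by (intro mult_left_mono) (auto simp: \<delta>_def)
    also have "\<dots> \<le> \<epsilon>" using M0 \<open>\<epsilon> > 0\<close> by (simp add: field_simps)
    finally show "M * \<delta> \<le> \<epsilon>" .
  qed
  have "pairing N n c (metric_model N n a y) \<le> - (1/2) * (\<Sum>i\<in>V. \<Sum>j\<in>V. \<omega> i j * mx x i j) + \<epsilon>"
    if y: "snorm N n (y - x) < \<delta>" for y
  proof -
    let ?w = "metric_weight n a y"
    have one: "\<omega> i j * mx x i j - a 1 * D i j * (2 * \<delta>) \<le> ?w i j * mx y i j"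
      if ij: "i \<in> V" "j \<in> V" for i j
    proof -
      have "mx x i j - mx y i j = (\<Sum>k<n. (c i k - c j k) * ((y - x) j k - (y - x) i k))"
        by (simp add: mx_def sum_subtractf[symmetric] algebra_simps)
      also have "\<dots> \<le> (\<Sum>k<n. \<bar>c i k - c j k\<bar> * (2 * \<delta>))"
      proof (rule sum_mono)
        fix k assume "k \<in> {..<n}"
        then have "\<bar>(y - x) i k\<bar> \<le> \<delta>" "\<bar>(y - x) j k\<bar> \<le> \<delta>"
          using ij y abs_coord_le_snorm[of i N k n "y - x"] abs_coord_le_snorm[of j N k n "y - x"]
          by (auto simp: V_def)
        then have "\<bar>(y - x) j k - (y - x) i k\<bar> \<le> 2 * \<delta>" by linarith
        then have "\<bar>(c i k - c j k) * ((y - x) j k - (y - x) i k)\<bar> \<le> \<bar>c i k - c j k\<bar> * (2 * \<delta>)"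
          unfolding abs_mult by (intro mult_left_mono) auto
        then show "(c i k - c j k) * ((y - x) j k - (y - x) i k) \<le> \<bar>c i k - c j k\<bar> * (2 * \<delta>)" by linarith
      qed
      also have "\<dots> = D i j * (2 * \<delta>)" by (simp add: D_def sum_distrib_right)
      finally have "?w i j * (mx x i j - mx y i j) \<le> ?w i j * (D i j * (2 * \<delta>))"
        using metric_weight_bounds[OF a] by (intro mult_left_mono) auto
      also have "\<dots> \<le> a 1 * (D i j * (2 * \<delta>))"
        using metric_weight_bounds[OF a] D0 \<delta>(1) by (intro mult_right_mono) auto
      finally have "?w i j * mx x i j - a 1 * D i j * (2 * \<delta>) \<le> ?w i j * mx y i j"
        by (simp add: algebra_simps)
      moreover have "\<omega> i j * mx x i j \<le> ?w i j * mx x i j"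
        using \<omega>(2)[of y i j] y \<delta>(2) ij m[of i j] by (intro mult_right_mono) (auto simp: V_def mx_def)
      ultimately show ?thesis by linarith
    qed
    have "(\<Sum>i\<in>V. \<Sum>j\<in>V. \<omega> i j * mx x i j) - 2 * (M * \<delta>)
        = (\<Sum>i\<in>V. \<Sum>j\<in>V. \<omega> i j * mx x i j - a 1 * D i j * (2 * \<delta>))"
      by (simp add: M_def sum_subtractf sum_distrib_left sum_distrib_right algebra_simps)
    also have "\<dots> \<le> (\<Sum>i\<in>V. \<Sum>j\<in>V. ?w i j * mx y i j)"
      by (intro sum_mono one)
    finally have "- (1/2) * (\<Sum>i\<in>V. \<Sum>j\<in>V. ?w i j * mx y i j)
        \<le> - (1/2) * (\<Sum>i\<in>V. \<Sum>j\<in>V. \<omega> i j * mx x i j) + M * \<delta>" by linarith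
    then show ?thesis
      using \<delta>(3) pairing_metric_model[of N n c a y] unfolding V_def mx_def by linarith
  qed
  then show "\<exists>\<delta>>0. \<forall>y\<in>state_space N n. snorm N n (y - x) < \<delta> \<longrightarrow>
      pairing N n c (metric_model N n a y) \<le> - (1/2) * (\<Sum>i\<in>{1..N}. \<Sum>j\<in>{1..N}. \<omega> i j * (\<Sum>k<n. (c i k - c j k) * (x i k - x j k))) + \<epsilon>"
    using \<delta>(1) unfolding V_def mx_def by blast
qed

lemma metric_velocity_nonpos:
  assumes a: "interaction a"
    and v: "v \<in> krasovsky_set N n (metric_model N n a) x"
    and m: "\<And>i j. i \<in> {1..N} \<Longrightarrow> j \<in> {1..N} \<Longrightarrow> 0 \<le> (\<Sum>k<n. (c i k - c j k) * (x i k - x j k))"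
  shows "pairing N n c v \<le> 0"
  using metric_velocity_le[OF a v m, of 1 "\<lambda>_ _. 0"] metric_weight_bounds[OF a] by simp

text \<open>
  A pair whose distance lies strictly between \<open>\<rho>\<close> and \<open>1\<close> keeps a weight of at least \<open>a \<rho>\<close> in all
  nearby states, so it dissipates energy at a definite rate.
\<close>

lemma metric_velocity_energy:
  assumes a: "interaction a"
    and v: "v \<in> krasovsky_set N n (metric_model N n a) x"
    and pq: "p \<in> {1..N}" "q \<in> {1..N}" "0 \<le> \<rho>" "\<rho> < enorm n (x p - x q)" "enorm n (x p - x q) < 1"
  shows "pairing N n (\<lambda>i k. 2 * x i k) v \<le> - (2 * (a \<rho> * \<rho>\<^sup>2))"
proof -
  define \<omega> where "\<omega> i j = (if (i = p \<and> j = q) \<or> (i = q \<and> j = p) then a \<rho> else 0)" for i j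
  define m where "m i j = (\<Sum>k<n. (2 * x i k - 2 * x j k) * (x i k - x j k))" for i j
  define e where "e = enorm n (x p - x q)"
  define \<delta> where "\<delta> = min (e - \<rho>) (1 - e) / 2"
  have "p \<noteq> q" using pq by (auto simp: enorm_def L2_set_def)
  have m_eq: "m i j = 2 * (enorm n (x i - x j))\<^sup>2" for i j
    unfolding m_def enorm_power2 sum_distrib_left
    by (rule sum.cong) (simp_all add: power2_eq_square algebra_simps)
  have "pairing N n (\<lambda>i k. 2 * x i k) v \<le> - (1/2) * (\<Sum>i\<in>{1..N}. \<Sum>j\<in>{1..N}. \<omega> i j * m i j)"
    unfolding m_def
  proof (rule metric_velocity_le[OF a v])
    show "0 \<le> (\<Sum>k<n. (2 * x i k - 2 * x j k) * (x i k - x j k))" for i j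
      using m_eq[of i j] by (simp add: m_def)
    show "\<delta> > 0" using pq by (simp add: \<delta>_def e_def)
    fix y i j assume y: "snorm N n (y - x) < \<delta>"
    have "\<bar>enorm n (y p - y q) - e\<bar> \<le> 2 * snorm N n (y - x)"
      unfolding e_def using enorm_diff_perturb[of q N p n y x] pq by auto
    then have "\<rho> < enorm n (y p - y q)" "enorm n (y p - y q) < 1"
      using y by (auto simp: \<delta>_def)
    then have "a \<rho> \<le> metric_weight n a y q p"
      using interaction_mono[OF a pq(3)] by (simp add: metric_weight_def)
    then show "\<omega> i j \<le> metric_weight n a y i j"
      using metric_weight_bounds[OF a, of n y i j] metric_weight_commute[of n a y p q] by (auto simp: \<omega>_def)
  qed
  also have "\<dots> \<le> - (1/2) * (a \<rho> * m p q + a \<rho> * m q p)"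
  proof -
    have nn: "0 \<le> \<omega> i j * m i j" for i j
      using interaction_nonneg[OF a pq(3)] by (auto simp: \<omega>_def m_eq)
    have "a \<rho> * m p q + a \<rho> * m q p = (\<Sum>i\<in>{p,q}. \<omega> i (if i = p then q else p) * m i (if i = p then q else p))"
      using \<open>p \<noteq> q\<close> by (simp add: \<omega>_def)
    also have "\<dots> \<le> (\<Sum>i\<in>{p,q}. \<Sum>j\<in>{1..N}. \<omega> i j * m i j)"
    proof (rule sum_mono)
      fix i assume "i \<in> {p,q}"
      show "\<omega> i (if i = p then q else p) * m i (if i = p then q else p) \<le> (\<Sum>j\<in>{1..N}. \<omega> i j * m i j)"
        by (rule member_le_sum[of "if i = p then q else p" "{1..N}" "\<lambda>j. \<omega> i j * m i j"]) (use pq nn in auto)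
    qed
    also have "\<dots> \<le> (\<Sum>i\<in>{1..N}. \<Sum>j\<in>{1..N}. \<omega> i j * m i j)"
      using pq nn by (intro sum_mono2 sum_nonneg) auto
    finally show ?thesis by simp
  qed
  also have "\<dots> = - (2 * (a \<rho> * e\<^sup>2))"
    by (simp add: m_eq e_def enorm_minus_commute[of n "x q"])
  also have "\<dots> \<le> - (2 * (a \<rho> * \<rho>\<^sup>2))"
    using pq interaction_nonneg[OF a pq(3)] by (simp add: e_def mult_left_mono power_mono)
  finally show ?thesis .
qed

text \<open>
  Both \<open>\<phi> y = y\<close> and \<open>\<phi> y = - y\<close> are convex.
\<close>

lemma metric_average_preserving:
  assumes a: "interaction a" and sol: "krasovsky_solution N n (metric_model N n a) x"
  shows "average_preserving N x"
proof -
  have eq: "(\<Sum>i\<in>{1..N}. x t i k) = (\<Sum>i\<in>{1..N}. x 0 i k)" if t: "t \<ge> 0" for t k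
  proof (cases "k < n")
    case False
    have on: "krasovsky_on N n (metric_model N n a) (t + 1) x"
      using sol t by (auto simp: krasovsky_solution_def)
    then have "x \<tau> i k = 0" if "\<tau> \<in> {0..t+1}" "i \<in> {1..N}" for \<tau> i
      using that False state_spaceD[of "x \<tau>" N n i] by (auto simp: krasovsky_on_def topspace_Euclidean_space)
    then show ?thesis using t by (auto intro!: sum.cong)
  next
    case True
    have on: "krasovsky_on N n (metric_model N n a) (t + 1) x"
      using sol t by (auto simp: krasovsky_solution_def)
    have main: "\<sigma> * (\<Sum>i\<in>{1..N}. x t i k) \<le> \<sigma> * (\<Sum>i\<in>{1..N}. x 0 i k)" for \<sigma>
    proof -
      have "(\<Sum>i\<in>{1..N}. \<Sum>l<n. (if l = k then \<sigma> else 0) * x t i l)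
         \<le> (\<Sum>i\<in>{1..N}. \<Sum>l<n. (if l = k then \<sigma> else 0) * x 0 i l) - 0 * (t - 0)"
      proof (rule separable_functional_decreasing[OF on, of 0 t "\<lambda>l y. (if l = k then \<sigma> else 0) * y" "\<lambda>l y. (if l = k then \<sigma> else 0)"])
        fix \<tau> v assume "v \<in> krasovsky_set N n (metric_model N n a) (x \<tau>)"
        from metric_velocity_nonpos[OF a this, of "\<lambda>i l. if l = k then \<sigma> else 0"]
        show "pairing N n (\<lambda>i l. if l = k then \<sigma> else 0) v \<le> - 0" by simp
      next
        show "((\<lambda>y. (if l = k then \<sigma> else 0) * y) has_real_derivative (if l = k then \<sigma> else 0)) (at y)" for l and y :: real
          by (auto intro!: derivative_eq_intros)
      qed (use t in \<open>auto intro!: continuous_intros\<close>)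
      moreover have "(\<Sum>l<n. (if l = k then \<sigma> else 0) * z l) = \<sigma> * z k" for z :: point
        using True by (simp add: if_distrib[of "\<lambda>y. y * _"] cong: if_cong)
      ultimately show ?thesis by (simp add: sum_distrib_left)
    qed
    show ?thesis using main[of 1] main[of "-1"] by simp
  qed
  have avg: "average N (x t) = average N (x 0)" if "t \<ge> 0" for t
    by (rule ext) (simp only: average_def sum_apply scaleR_fun_apply eq[OF that])
  show ?thesis
    unfolding average_preserving_def constant_on_def
    by (intro exI[of _ "average N (x 0)"] ballI avg) simp
qed

section \<open>Convergence from truncated squares\<close>

lemma tendsto_fun_iff:
  fixes f :: "'a \<Rightarrow> 'b \<Rightarrow> 'c::topological_space"
  shows "(f \<longlongrightarrow> l) F \<longleftrightarrow> (\<forall>i. ((\<lambda>x. f x i) \<longlongrightarrow> l i) F)"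
  using limitin_componentwise[of "\<lambda>_. euclidean :: 'c topology" UNIV f l F]
  by (simp add: euclidean_product_topology extensional_UNIV)

lemma nonincreasing_bounded_below_converges:
  fixes f :: "real \<Rightarrow> real"
  assumes dec: "\<And>s t. 0 \<le> s \<Longrightarrow> s \<le> t \<Longrightarrow> f t \<le> f s" and bd: "\<And>t. 0 \<le> t \<Longrightarrow> b \<le> f t"
  shows "(f \<longlongrightarrow> Inf (f ` {0..})) at_top"
proof (rule order_tendstoI)
  have bdd: "bdd_below (f ` {0..})" using bd by (auto intro!: bdd_belowI2)
  fix y assume "y < Inf (f ` {0..})"
  then show "eventually (\<lambda>t. y < f t) at_top"
    using cInf_lower[OF _ bdd] by (intro eventually_at_top_linorderI[of 0]) (auto intro: less_le_trans)
next
  fix y assume "Inf (f ` {0..}) < y"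
  then obtain s where s: "s \<ge> 0" "f s < y"
    using cInf_lessD[of "f ` {0..}" y] by auto
  then show "eventually (\<lambda>t. f t < y) at_top"
    using dec by (intro eventually_at_top_linorderI[of s]) (auto intro: le_less_trans)
qed

lemma converges_if_no_oscillation:
  fixes y :: "real \<Rightarrow> real"
  assumes bd: "\<And>t. t \<ge> 0 \<Longrightarrow> \<bar>y t\<bar> \<le> B"
    and osc: "\<And>\<alpha> \<beta>. \<alpha> < \<beta> \<Longrightarrow> eventually (\<lambda>t. \<alpha> \<le> y t) at_top \<or> eventually (\<lambda>t. y t \<le> \<beta>) at_top"
  shows "\<exists>l. (y \<longlongrightarrow> l) at_top"
proof -
  define A where "A = {\<alpha>. eventually (\<lambda>t. \<alpha> \<le> y t) at_top}"
  have bd': "eventually (\<lambda>t. \<bar>y t\<bar> \<le> B) at_top"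
    using bd by (intro eventually_at_top_linorderI[of 0])
  have "-B \<in> A" unfolding A_def using bd' by (auto elim: eventually_mono)
  have upper: "\<alpha> \<le> B" if "\<alpha> \<in> A" for \<alpha>
  proof -
    have "eventually (\<lambda>t::real. \<alpha> \<le> B) at_top"
      by (rule eventually_mono[OF eventually_conj[OF that[unfolded A_def mem_Collect_eq] bd']]) linarith
    then show ?thesis by (simp add: eventually_const_iff trivial_limit_at_top_linorder)
  qed
  have bdd: "bdd_above A" using upper by (rule bdd_aboveI)
  have "(y \<longlongrightarrow> Sup A) at_top"
  proof (rule order_tendstoI)
    fix z assume "z < Sup A"
    then obtain \<alpha> where "\<alpha> \<in> A" "z < \<alpha>"
      using less_cSup_iff[OF _ bdd] \<open>-B \<in> A\<close> by auto
    then show "eventually (\<lambda>t. z < y t) at_top"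
      by (auto simp: A_def elim!: eventually_mono)
  next
    fix z assume z: "Sup A < z"
    \<comment> \<open>Two levels strictly between \<open>Sup A\<close> and \<open>z\<close>, at one and two thirds.\<close>
    define \<alpha> \<beta> where "\<alpha> = (2 * Sup A + z) / 3" and "\<beta> = (Sup A + 2 * z) / 3"
    have ord: "Sup A < \<alpha>" "\<alpha> < \<beta>" "\<beta> < z" using z by (auto simp: \<alpha>_def \<beta>_def field_simps)
    have "\<alpha> \<notin> A" using ord(1) cSup_upper[OF _ bdd] by force
    then have "eventually (\<lambda>t. y t \<le> \<beta>) at_top" using osc[OF ord(2)] by (auto simp: A_def)
    then show "eventually (\<lambda>t. y t < z) at_top"
      using ord(3) by (auto elim: eventually_mono)
  qed
  then show ?thesis by blast
qed

text \<open>
  The quadratic B-spline with knots \<open>0\<close>, \<open>h\<close>, \<open>2 * h\<close> and \<open>3 * h\<close>: a third difference of truncated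
  squares, positive exactly between the outer knots.
\<close>

definition bump :: "real \<Rightarrow> real \<Rightarrow> real" where
  "bump h z = (max 0 z)\<^sup>2 - 3 * (max 0 (z - h))\<^sup>2 + 3 * (max 0 (z - 2 * h))\<^sup>2 - (max 0 (z - 3 * h))\<^sup>2"

lemma bump_zero: "h > 0 \<Longrightarrow> z \<le> 0 \<or> 3 * h \<le> z \<Longrightarrow> bump h z = 0"
  by (auto simp: bump_def max_def power2_eq_square algebra_simps)

lemma bump_center: "h > 0 \<Longrightarrow> bump h (3 / 2 * h) = 3 / 2 * h\<^sup>2"
  by (simp add: bump_def max_def power2_eq_square field_simps)

lemma bump_bounds:
  assumes h: "h > 0"
  shows "0 \<le> bump h z" "bump h z \<le> 3 / 2 * h\<^sup>2"
proof -
  have h2: "0 \<le> h\<^sup>2" by simp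
  consider "z \<le> 0 \<or> 3 * h \<le> z" | "0 < z" "z \<le> h" | "h < z" "z \<le> 2 * h" | "2 * h < z" "z < 3 * h" by linarith
  then have "0 \<le> bump h z \<and> bump h z \<le> 3 / 2 * h\<^sup>2"
  proof cases
    case 1
    then show ?thesis using bump_zero[OF h 1] by simp
  next
    case 2
    then have b: "bump h z = z\<^sup>2" using h by (simp add: bump_def)
    have "z\<^sup>2 \<le> h\<^sup>2" using 2 by (intro power_mono) auto
    then show ?thesis unfolding b using h2 zero_le_power2[of z] zero_le_power2[of "3 * h - z"] by (intro conjI; linarith)
  next
    case 3
    then have b: "bump h z = z\<^sup>2 - 3 * (z - h)\<^sup>2" using h by (simp add: bump_def)
    have l: "z\<^sup>2 - 3 * (z - h)\<^sup>2 = 2 * ((z - h) * (2 * h - z)) + h\<^sup>2"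
      by (simp add: power2_eq_square algebra_simps)
    have u: "z\<^sup>2 - 3 * (z - h)\<^sup>2 = 3 / 2 * h\<^sup>2 - (3 * h - 2 * z)\<^sup>2 / 2"
      by (simp add: power2_eq_square field_simps)
    have "0 \<le> (z - h) * (2 * h - z)" using 3 by (intro mult_nonneg_nonneg) auto
    then show ?thesis unfolding b using l u h2 by (smt (verit) zero_le_power2 divide_nonneg_pos)
  next
    case 4
    then have b: "bump h z = (3 * h - z)\<^sup>2" using h
      by (simp add: bump_def max_def power2_eq_square algebra_simps)
    have "(3 * h - z)\<^sup>2 \<le> h\<^sup>2" using 4 by (intro power_mono) auto
    then show ?thesis unfolding b using h2 zero_le_power2[of z] zero_le_power2[of "3 * h - z"] by (intro conjI; linarith)
  qed
  then show "0 \<le> bump h z" "bump h z \<le> 3 / 2 * h\<^sup>2" by auto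
qed

lemma sum_bumps_le:
  assumes h: "h > 0"
  shows "(\<Sum>m<M. bump h (z - 3 * h * real m)) \<le> 3 / 2 * h\<^sup>2"
proof (cases "\<exists>m<M. bump h (z - 3 * h * real m) \<noteq> 0")
  case False
  then have "(\<Sum>m<M. bump h (z - 3 * h * real m)) = 0" by (intro sum.neutral) auto
  then show ?thesis by simp
next
  case True
  then obtain m where m: "m < M" "bump h (z - 3 * h * real m) \<noteq> 0" by blast
  have inside: "3 * h * real k < z \<and> z < 3 * h * (real k + 1)" if "bump h (z - 3 * h * real k) \<noteq> 0" for k
  proof -
    have "\<not> (z - 3 * h * real k \<le> 0 \<or> 3 * h \<le> z - 3 * h * real k)"
      using bump_zero[OF h] that by blast
    then show ?thesis by (auto simp: algebra_simps)
  qed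
  have "bump h (z - 3 * h * real k) = 0" if "k \<noteq> m" for k
  proof (rule ccontr)
    assume "bump h (z - 3 * h * real k) \<noteq> 0"
    from inside[OF this] inside[OF m(2)] have "3 * h * real k < 3 * h * (real m + 1)" "3 * h * real m < 3 * h * (real k + 1)"
      by linarith+
    then have "real k < real m + 1" "real m < real k + 1" using h by auto
    then show False using that by linarith
  qed
  then have "(\<Sum>m<M. bump h (z - 3 * h * real m)) = (\<Sum>k\<in>{m}. bump h (z - 3 * h * real k))"
    using m(1) by (intro sum.mono_neutral_right) auto
  then show ?thesis using bump_bounds(2)[OF h] by simp
qed

text \<open>
  Suppose that \<open>y i\<close> crosses the interval from \<open>\<alpha>\<close> to \<open>\<beta>\<close> again and again. Place \<open>card J + 1\<close> bumps
  with disjoint supports side by side in this interval. The sum of one bump over all agents is a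
  combination of convergent sums, so it converges, and its limit is at least the
  height of the bump since \<open>y i\<close> passes the centre of the bump at arbitrarily late times. But every
  agent is in the support of at most one bump, so all these sums together never exceed \<open>card J\<close>
  times the height.
\<close>

lemma converges_of_truncated_square_sums:
  fixes y :: "'a \<Rightarrow> real \<Rightarrow> real"
  assumes J: "finite J" "i \<in> J" and cont: "\<And>T. continuous_on {0..T} (y i)"
    and bd: "\<And>t. t \<ge> 0 \<Longrightarrow> \<bar>y i t\<bar> \<le> B"
    and lim: "\<And>c. \<exists>l. ((\<lambda>t. \<Sum>j\<in>J. (max 0 (y j t - c))\<^sup>2) \<longlongrightarrow> l) at_top"
  shows "\<exists>l. (y i \<longlongrightarrow> l) at_top"
proof (rule converges_if_no_oscillation[OF bd])
  fix \<alpha> \<beta> :: real assume \<alpha>\<beta>: "\<alpha> < \<beta>"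
  show "eventually (\<lambda>t. \<alpha> \<le> y i t) at_top \<or> eventually (\<lambda>t. y i t \<le> \<beta>) at_top"
  proof (rule ccontr)
    assume *: "\<not> ?thesis"
    have low: "\<exists>t\<ge>T. y i t < \<alpha>" and high: "\<exists>t\<ge>T. \<beta> < y i t" for T
      using * by (auto simp: eventually_at_top_linorder not_le)
    define M where "M = card J + 1"
    \<comment> \<open>Each bump has width \<open>3 * h\<close>, so \<open>M\<close> of them fill the interval exactly.\<close>
    define h where "h = (\<beta> - \<alpha>) / (3 * real M)"
    have h: "h > 0" using \<alpha>\<beta> by (simp add: h_def M_def)
    have visit: "\<exists>t\<ge>T. y i t = c" if c: "\<alpha> \<le> c" "c \<le> \<beta>" for c T
    proof -
      obtain s where s: "s \<ge> max 0 T" "y i s < \<alpha>" using low by blast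
      obtain r where r: "r \<ge> s" "\<beta> < y i r" using high by blast
      have "continuous_on {s..r} (y i)" using s by (intro continuous_on_subset[OF cont[of r]]) auto
      then obtain t where "s \<le> t" "t \<le> r" "y i t = c"
        using IVT'[of "y i" s c r] s r c by auto
      then show ?thesis using s by (intro exI[of _ t]) auto
    qed
    define S where "S m t = (\<Sum>j\<in>J. bump h (y j t - \<alpha> - 3 * h * real m))" for m t
    have "\<exists>l. (S m \<longlongrightarrow> l) at_top" for m
    proof -
      define q where "q c t = (\<Sum>j\<in>J. (max 0 (y j t - c))\<^sup>2)" for c t
      define c0 where "c0 = \<alpha> + 3 * h * real m"
      have S_eq: "S m = (\<lambda>t. q c0 t - 3 * q (c0 + h) t + 3 * q (c0 + 2 * h) t - q (c0 + 3 * h) t)"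
        by (rule ext)
           (simp add: S_def q_def c0_def bump_def sum.distrib sum_subtractf sum_distrib_left diff_diff_eq)
      obtain l where l: "\<And>c. (q c \<longlongrightarrow> l c) at_top" using lim unfolding q_def by metis
      have "(S m \<longlongrightarrow> l c0 - 3 * l (c0 + h) + 3 * l (c0 + 2 * h) - l (c0 + 3 * h)) at_top"
        unfolding S_eq by (intro tendsto_diff tendsto_add tendsto_mult_left l)
      then show ?thesis by blast
    qed
    then obtain L where L: "\<And>m. (S m \<longlongrightarrow> L m) at_top" by metis
    have L_ge: "3 / 2 * h\<^sup>2 \<le> L m" if m: "m < M" for m
    proof (rule ccontr)
      assume "\<not> 3 / 2 * h\<^sup>2 \<le> L m"
      then have "eventually (\<lambda>t. S m t < 3 / 2 * h\<^sup>2) at_top"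
        using L by (intro order_tendstoD(2)) auto
      then obtain T where T: "\<And>t. t \<ge> T \<Longrightarrow> S m t < 3 / 2 * h\<^sup>2" by (auto simp: eventually_at_top_linorder)
      define c where "c = \<alpha> + 3 * h * real m + 3 / 2 * h"
      have "3 * h * (real m + 1) \<le> 3 * h * real M" using h m by (intro mult_left_mono) auto
      also have "\<dots> = \<beta> - \<alpha>"
      proof -
        have "real M \<noteq> 0" by (simp add: M_def)
        then show ?thesis by (simp add: h_def)
      qed
      finally have "c \<le> \<beta>" using h by (simp add: c_def algebra_simps)
      moreover have "\<alpha> \<le> c" using h by (simp add: c_def)
      ultimately obtain t where t: "t \<ge> T" "y i t = c" using visit by blast
      have "3 / 2 * h\<^sup>2 = bump h (y i t - \<alpha> - 3 * h * real m)"
        using bump_center[OF h] t(2) by (simp add: c_def)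
      also have "\<dots> \<le> S m t"
        unfolding S_def by (rule member_le_sum[OF J(2)]) (use J bump_bounds[OF h] in auto)
      finally show False using T[OF t(1)] by linarith
    qed
    have "((\<lambda>t. \<Sum>m<M. S m t) \<longlongrightarrow> (\<Sum>m<M. L m)) at_top" by (intro tendsto_sum L)
    moreover have "(\<Sum>m<M. S m t) \<le> real (card J) * (3 / 2 * h\<^sup>2)" for t
    proof -
      have "(\<Sum>m<M. S m t) = (\<Sum>j\<in>J. \<Sum>m<M. bump h (y j t - \<alpha> - 3 * h * real m))"
        unfolding S_def by (rule sum.swap)
      also have "\<dots> \<le> (\<Sum>j\<in>J. 3 / 2 * h\<^sup>2)" by (intro sum_mono sum_bumps_le h)
      finally show ?thesis by simp
    qed
    ultimately have "(\<Sum>m<M. L m) \<le> real (card J) * (3 / 2 * h\<^sup>2)"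
      by (intro tendsto_upperbound) (auto simp: trivial_limit_at_top_linorder)
    moreover have "real M * (3 / 2 * h\<^sup>2) \<le> (\<Sum>m<M. L m)"
      using sum_mono[of "{..<M}" "\<lambda>_. 3 / 2 * h\<^sup>2" L] L_ge by simp
    moreover have "real M * (3 / 2 * h\<^sup>2) = real (card J) * (3 / 2 * h\<^sup>2) + 3 / 2 * h\<^sup>2"
      by (simp add: M_def distrib_right)
    moreover have "0 < 3 / 2 * h\<^sup>2" using h by simp
    ultimately show False by linarith
  qed
qed

section \<open>Clustering in the metric model\<close>

lemma state_converges:
  fixes x :: "real \<Rightarrow> state"
  assumes st: "\<And>t. t \<ge> 0 \<Longrightarrow> x t \<in> state_space N n"
    and coord: "\<And>i k. i \<in> {1..N} \<Longrightarrow> k < n \<Longrightarrow> \<exists>l. ((\<lambda>t. x t i k) \<longlongrightarrow> l) at_top"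
  obtains z where "z \<in> state_space N n" "(x \<longlongrightarrow> z) at_top"
proof -
  have "\<exists>l. ((\<lambda>t. x t i k) \<longlongrightarrow> l) at_top \<and> (i \<notin> {1..N} \<or> k \<ge> n \<longrightarrow> l = 0)" for i k
  proof (cases "i \<in> {1..N} \<and> k < n")
    case True then show ?thesis using coord by auto
  next
    case False
    have "x t i k = 0" if "t \<ge> 0" for t
      using st[OF that] False by (cases "i \<in> {1..N}") (auto simp: state_space_def topspace_Euclidean_space)
    then have "((\<lambda>t. x t i k) \<longlongrightarrow> 0) at_top"
      by (intro tendsto_eventually eventually_at_top_linorderI[of 0]) auto
    then show ?thesis by blast
  qed
  then obtain z where z: "\<And>i k. ((\<lambda>t. x t i k) \<longlongrightarrow> z i k) at_top" "\<And>i k. i \<notin> {1..N} \<or> k \<ge> n \<Longrightarrow> z i k = 0"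
    by metis
  have "z \<in> state_space N n"
    using z(2) by (auto simp: state_space_def topspace_Euclidean_space fun_eq_iff)
  moreover have "(x \<longlongrightarrow> z) at_top" using z(1) by (simp add: tendsto_fun_iff)
  ultimately show thesis by (rule that)
qed

lemma tendsto_enorm_diff:
  fixes x :: "real \<Rightarrow> state"
  assumes "(x \<longlongrightarrow> z) F"
  shows "((\<lambda>t. enorm n (x t i - x t j)) \<longlongrightarrow> enorm n (z i - z j)) F"
  using assms unfolding enorm_def L2_set_def tendsto_fun_iff
  by (auto intro!: tendsto_intros)

text \<open>
  The sums of truncated squares of each coordinate are nonincreasing and nonnegative, hence
  convergent, so the solution has a limit \<open>z\<close>. If two distinct limit positions had distance \<open>e < 1\<close>, the
  two agents would finally stay at a distance between \<open>e / 2\<close> and \<open>1\<close> and the energy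
  would decrease at a positive constant rate for ever.
\<close>

lemma metric_converges_to_cluster:
  assumes a: "interaction a" and sol: "krasovsky_solution N n (metric_model N n a) x"
  shows "converges_to_cluster N n (metric_nbrs N n) x"
proof -
  have on: "krasovsky_on N n (metric_model N n a) (t + 1) x" if "t \<ge> 0" for t
    using sol that by (auto simp: krasovsky_solution_def)
  have st: "x t \<in> state_space N n" if "t \<ge> 0" for t
    using on[OF that] that by (auto simp: krasovsky_on_def)
  have cur: "abs_continuous_curve N n T x" if "T \<ge> 1" for T
    using on[of "T - 1"] that by (auto simp: krasovsky_on_def)
  define En where "En t = (\<Sum>i\<in>{1..N}. \<Sum>k<n. (x t i k)\<^sup>2)" for t
  have En0: "En t \<ge> 0" for t unfolding En_def by (intro sum_nonneg) auto
  have sq_deriv: "((\<lambda>y. y\<^sup>2) has_real_derivative 2 * y) (at y)" for y :: real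
    by (auto intro!: derivative_eq_intros)
  have energy: "En t \<le> En s - \<eta> * (t - s)"
    if "0 \<le> s" "s \<le> t" "\<And>\<tau> v. \<tau> \<in> {s..t} \<Longrightarrow> v \<in> krasovsky_set N n (metric_model N n a) (x \<tau>) \<Longrightarrow>
      pairing N n (\<lambda>i k. 2 * x \<tau> i k) v \<le> - \<eta>" for s t \<eta>
    unfolding En_def
    by (rule separable_functional_decreasing[OF on, of t s t "\<lambda>_ y. y\<^sup>2" "\<lambda>_ y. 2 * y"])
       (use that in \<open>auto intro!: sq_deriv continuous_intros\<close>)
  have conv: "\<exists>l. ((\<lambda>t. x t i k) \<longlongrightarrow> l) at_top" if ik: "i \<in> {1..N}" "k < n" for i k
  proof (rule converges_of_truncated_square_sums[of "{1..N}" i "\<lambda>i t. x t i k" "sqrt (En 0)"])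
    show "continuous_on {0..T} (\<lambda>t. x t i k)" for T
      by (rule continuous_on_subset[OF abs_continuous_on_imp_continuous_on[OF abs_continuous_curve_coord[OF cur ik, of "max 1 T"]]]) auto
    show "\<bar>x t i k\<bar> \<le> sqrt (En 0)" if t: "t \<ge> 0" for t
    proof -
      have "(x t i k)\<^sup>2 \<le> (\<Sum>k<n. (x t i k)\<^sup>2)" by (rule member_le_sum) (use ik in auto)
      also have "\<dots> \<le> En t" unfolding En_def
        by (rule member_le_sum[of i "{1..N}" "\<lambda>i. \<Sum>k<n. (x t i k)\<^sup>2"]) (use ik in \<open>auto intro: sum_nonneg\<close>)
      also have "En t \<le> En 0 - 0 * (t - 0)"
      proof (rule energy)
        fix \<tau> v assume "v \<in> krasovsky_set N n (metric_model N n a) (x \<tau>)"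
        moreover have "0 \<le> (2 * u - 2 * w) * (u - w)" for u w :: real
        proof -
          have "(2 * u - 2 * w) * (u - w) = 2 * (u - w)\<^sup>2" by (simp add: power2_eq_square algebra_simps)
          then show ?thesis by simp
        qed
        ultimately show "pairing N n (\<lambda>i k. 2 * x \<tau> i k) v \<le> - 0"
          using metric_velocity_nonpos[OF a, of v N n "x \<tau>" "\<lambda>i k. 2 * x \<tau> i k"] by (simp add: sum_nonneg)
      qed (use t in auto)
      finally show ?thesis by (simp add: real_le_rsqrt abs_le_square_iff real_sqrt_ge_abs1)
    qed
    show "\<exists>l. ((\<lambda>t. \<Sum>j\<in>{1..N}. (max 0 (x t j k - c))\<^sup>2) \<longlongrightarrow> l) at_top" for c
    proof (intro exI, rule nonincreasing_bounded_below_converges[of _ 0])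
      fix s t :: real assume s: "0 \<le> s" "s \<le> t"
      define \<phi> where "\<phi> l y = (if l = k then 1 else 0) * (max 0 (y - c))\<^sup>2" for l :: nat and y :: real
      define \<phi>' where "\<phi>' l y = (if l = k then 1 else 0) * (2 * max 0 (y - c))" for l :: nat and y :: real
      have "(\<Sum>j\<in>{1..N}. \<Sum>l<n. \<phi> l (x t j l)) \<le> (\<Sum>j\<in>{1..N}. \<Sum>l<n. \<phi> l (x s j l)) - 0 * (t - s)"
      proof (rule separable_functional_decreasing[OF on, of t s t \<phi> \<phi>'])
        show "(\<phi> l has_real_derivative \<phi>' l y) (at y)" for l y
          unfolding \<phi>_def \<phi>'_def by (intro DERIV_cmult pos_part_square_derivative)
        show "continuous_on UNIV (\<phi>' l)" for l
          unfolding \<phi>'_def by (intro continuous_intros)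
        fix \<tau> v assume v: "v \<in> krasovsky_set N n (metric_model N n a) (x \<tau>)"
        have "0 \<le> (\<phi>' l y - \<phi>' l z) * (y - z)" for l y z
        proof (cases "y \<le> z")
          case True
          then show ?thesis by (intro mult_nonpos_nonpos) (auto simp: \<phi>'_def max_def)
        next
          case False
          then show ?thesis by (intro mult_nonneg_nonneg) (auto simp: \<phi>'_def max_def)
        qed
        then show "pairing N n (\<lambda>i k. \<phi>' k (x \<tau> i k)) v \<le> - 0"
          using metric_velocity_nonpos[OF a v, of "\<lambda>i k. \<phi>' k (x \<tau> i k)"] by (auto intro: sum_nonneg)
      qed (use s in auto)
      moreover have "(\<Sum>l<n. \<phi> l (w l)) = (max 0 (w k - c))\<^sup>2" for w :: point
        using ik by (simp add: \<phi>_def if_distrib[of "\<lambda>y. y * _"] cong: if_cong)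
      ultimately show "(\<Sum>j\<in>{1..N}. (max 0 (x t j k - c))\<^sup>2) \<le> (\<Sum>j\<in>{1..N}. (max 0 (x s j k - c))\<^sup>2)" by simp
    qed (auto intro: sum_nonneg)
  qed (use ik in auto)
  obtain z where z: "z \<in> state_space N n" "(x \<longlongrightarrow> z) at_top"
    using state_converges[of x N n, OF st conv] by blast
  have "z i = z j" if i: "i \<in> {1..N}" and j: "j \<in> metric_nbrs N n z i" for i j
  proof (rule ccontr)
    assume ne: "z i \<noteq> z j"
    have j': "j \<in> {1..N}" "enorm n (z i - z j) < 1"
      using j by (auto simp: metric_nbrs_def enorm_minus_commute)
    define e where "e = enorm n (z i - z j)"
    have "e \<noteq> 0" using ne enorm_eq_0_iff[of "z i" n "z j"] state_spaceD[OF z(1)] i j'(1) by (auto simp: e_def)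
    then have e: "e > 0" by (simp add: e_def order_less_le)
    have conv: "((\<lambda>t. enorm n (x t i - x t j)) \<longlongrightarrow> e) at_top"
      unfolding e_def by (rule tendsto_enorm_diff[OF z(2)])
    have "eventually (\<lambda>t. e / 2 < enorm n (x t i - x t j) \<and> enorm n (x t i - x t j) < 1) at_top"
      using order_tendstoD(1)[OF conv, of "e/2"] order_tendstoD(2)[OF conv, of 1] e j'(2)
      by (intro eventually_conj) (auto simp: e_def)
    then obtain T where T: "\<And>t. t \<ge> T \<Longrightarrow> e / 2 < enorm n (x t i - x t j) \<and> enorm n (x t i - x t j) < 1"
      by (auto simp: eventually_at_top_linorder)
    define s where "s = max 0 T"
    define \<eta> where "\<eta> = 2 * (a (e / 2) * (e / 2)\<^sup>2)"
    have \<eta>: "\<eta> > 0" using e interaction_pos[OF a, of "e/2"] by (simp add: \<eta>_def)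
    \<comment> \<open>By this time the energy would be negative.\<close>
    define t where "t = s + (En s + 1) / \<eta>"
    have st': "0 \<le> s" "s \<le> t" using \<eta> En0[of s] by (auto simp: s_def t_def)
    have "En t \<le> En s - \<eta> * (t - s)"
    proof (rule energy[OF st'])
      fix \<tau> v assume "\<tau> \<in> {s..t}" "v \<in> krasovsky_set N n (metric_model N n a) (x \<tau>)"
      then show "pairing N n (\<lambda>i k. 2 * x \<tau> i k) v \<le> - \<eta>"
        unfolding \<eta>_def using T[of \<tau>] e i j'(1)
        by (intro metric_velocity_energy[OF a, of v N n "x \<tau>" i j]) (auto simp: s_def)
    qed
    also have "\<dots> = -1" using \<eta> by (simp add: t_def)
    finally show False using En0[of t] by simp
  qed
  then have "cluster_point N n (metric_nbrs N n) z" using z(1) by (auto simp: cluster_point_def)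
  then show ?thesis unfolding converges_to_cluster_def using z(2) by blast
qed

section \<open>Counterexamples for the topological model\<close>

lemma topological_nbrs_subset: "topological_nbrs N n \<kappa> x i \<subseteq> {1..N} - {i}"
proof -
  have "set (take \<kappa> (sort_key (\<lambda>j. enorm n (x j - x i)) [j \<leftarrow> [1..<Suc N]. j \<noteq> i]))
      \<subseteq> set [j \<leftarrow> [1..<Suc N]. j \<noteq> i]"
    using set_take_subset by (metis set_sort)
  also have "\<dots> \<subseteq> {1..N} - {i}" by auto
  finally show ?thesis by (simp only: topological_nbrs_def)
qed

lemma interaction_one: "interaction (\<lambda>_. 1)"
  unfolding interaction_def by (auto intro!: exI[of _ 0] lipschitz_intros mono_onI)

lemma enorm_1: "enorm (Suc 0) v = \<bar>v 0\<bar>"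
  by (simp add: enorm_def L2_set_def)

definition line_state :: "nat \<Rightarrow> (nat \<Rightarrow> real) \<Rightarrow> state" where
  "line_state N y = (\<lambda>i k. if i \<in> {1..N} \<and> k = 0 then y i else 0)"

lemma line_state_in_state_space: "line_state N y \<in> state_space N (Suc 0)"
  by (auto simp: line_state_def state_space_def topspace_Euclidean_space)

lemma abs_continuous_curveI_lipschitz:
  assumes lip: "\<And>s t. s \<in> {0..T} \<Longrightarrow> t \<in> {0..T} \<Longrightarrow> snorm N n (x s - x t) \<le> L * \<bar>s - t\<bar>"
  shows "abs_continuous_curve N n T x"
  unfolding abs_continuous_curve_def
proof (intro allI impI)
  fix \<epsilon> :: real assume "\<epsilon> > 0"
  define C where "C = \<bar>L\<bar> + 1"
  have "C > 0" by (simp add: C_def)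
  have "(\<Sum>K\<in>D. snorm N n (x (Sup K) - x (Inf K))) < \<epsilon>"
    if D: "D division_of \<Union>D" "\<Union>D \<subseteq> {0..T}" "(\<Sum>K\<in>D. Sup K - Inf K) < \<epsilon> / C" for D
  proof -
    have "(\<Sum>K\<in>D. snorm N n (x (Sup K) - x (Inf K))) \<le> (\<Sum>K\<in>D. C * (Sup K - Inf K))"
    proof (rule sum_mono)
      fix K assume "K \<in> D"
      then obtain u v where uv: "u \<le> v" "u \<in> {0..T}" "v \<in> {0..T}" "Inf K = u" "Sup K = v"
        using division_memE[OF D(1) _ D(2)] by metis
      then have "snorm N n (x v - x u) \<le> L * \<bar>v - u\<bar>" by (intro lip)
      also have "\<dots> \<le> C * (v - u)" using uv(1) by (auto simp: C_def intro: mult_right_mono)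
      finally show "snorm N n (x (Sup K) - x (Inf K)) \<le> C * (Sup K - Inf K)" using uv by simp
    qed
    also have "\<dots> = C * (\<Sum>K\<in>D. Sup K - Inf K)" by (simp only: sum_distrib_left)
    also have "\<dots> < \<epsilon>" using D(3) \<open>C > 0\<close> by (simp add: pos_less_divide_eq mult.commute)
    finally show ?thesis .
  qed
  then show "\<exists>\<delta>>0. \<forall>D. D division_of \<Union>D \<longrightarrow> \<Union>D \<subseteq> {0..T} \<longrightarrow> (\<Sum>K\<in>D. Sup K - Inf K) < \<delta> \<longrightarrow>
        (\<Sum>K\<in>D. snorm N n (x (Sup K) - x (Inf K))) < \<epsilon>"
    using \<open>\<epsilon> > 0\<close> \<open>C > 0\<close> by (intro exI[of _ "\<epsilon> / C"]) auto
qed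

text \<open>
  Agents \<open>1\<close> and \<open>2\<close> rest at the origin, each being the nearest neighbour of the other, while agent \<open>3\<close>
  approaches agent \<open>1\<close> without any reaction.
\<close>

definition follower :: "real \<Rightarrow> state" where
  "follower t = line_state 3 (\<lambda>i. if i = 3 then exp (- t) else 0)"

lemma follower_apply: "follower t i k = (if i = 3 \<and> k = 0 then exp (- t) else 0)"
  by (auto simp: follower_def line_state_def)

lemma follower_field:
  "topological_model 3 1 1 (\<lambda>_. 1) (follower t) = line_state 3 (\<lambda>i. if i = 3 then - exp (- t) else 0)"
proof -
  have nb: "topological_nbrs 3 1 1 (follower t) 1 = {2}" "topological_nbrs 3 1 1 (follower t) 2 = {1}"
    "topological_nbrs 3 1 1 (follower t) 3 = {1}"
    by (simp_all add: topological_nbrs_def follower_def line_state_def enorm_1 upt_rec numeral_eq_Suc)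
  show ?thesis
  proof (rule ext)+
    fix i k :: nat
    have "i = 1 \<or> i = 2 \<or> i = 3 \<or> i \<notin> {1..3}" by auto
    then show "topological_model 3 1 1 (\<lambda>_. 1) (follower t) i k = line_state 3 (\<lambda>i. if i = 3 then - exp (- t) else 0) i k"
      using nb by (auto simp: bc_field_def follower_apply line_state_def)
  qed
qed

lemma follower_solution: "caratheodory_solution 3 1 (topological_model 3 1 1 (\<lambda>_. 1)) follower"
  unfolding caratheodory_solution_def caratheodory_on_def
proof (intro allI impI conjI ballI)
  fix T :: real assume "T > 0"
  show "follower t \<in> state_space 3 1" for t
    by (simp add: follower_def line_state_in_state_space)
  show "abs_continuous_curve 3 1 T follower"
  proof (rule abs_continuous_curveI_lipschitz)
    fix s t assume st: "s \<in> {0..T}" "t \<in> {0..T}"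
    have "norm (exp (- s) - exp (- t)) \<le> 1 * norm (s - t)"
      by (rule field_differentiable_bound[of "{0..T}" _ "\<lambda>t. - exp (- t)"])
         (use st in \<open>auto intro!: derivative_eq_intros\<close>)
    moreover have "snorm 3 1 (follower s - follower t) = \<bar>exp (- s) - exp (- t)\<bar>"
      by (simp add: snorm_def enorm_1 L2_set_def follower_def line_state_def numeral_3_eq_3 atLeastAtMostSuc_conv)
    ultimately show "snorm 3 1 (follower s - follower t) \<le> 1 * \<bar>s - t\<bar>" by simp
  qed
  have "has_velocity T follower (topological_model 3 1 1 (\<lambda>_. 1) (follower t)) t" for t
    unfolding follower_field has_velocity_def
  proof (intro allI)
    fix i k
    have "((\<lambda>s. exp (- s)) has_real_derivative - exp (- t)) (at t within {0..T})"
      by (rule derivative_eq_intros refl | simp)+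
    then show "((\<lambda>s. follower s i k) has_real_derivative line_state 3 (\<lambda>i. if i = 3 then - exp (- t) else 0) i k)
        (at t within {0..T})"
      by (cases "i = 3 \<and> k = 0") (auto simp: follower_apply line_state_def)
  qed
  then show "AE t in lebesgue_on {0..T}. has_velocity T follower (topological_model 3 1 1 (\<lambda>_. 1) (follower t)) t"
    by simp
qed

lemma follower_not_average_preserving: "\<not> average_preserving 3 follower"
proof
  assume "average_preserving 3 follower"
  then obtain c where c: "\<forall>t\<in>{0..}. average 3 (follower t) = c"
    unfolding average_preserving_def constant_on_def by blast
  have "average 3 (follower t) 0 = exp (- t) / 3" for t
    by (simp add: average_def sum_apply follower_def line_state_def numeral_3_eq_3 atLeastAtMostSuc_conv)
  moreover have "average 3 (follower 0) = average 3 (follower 1)"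
    using bspec[OF c, of 0] bspec[OF c, of 1] by simp
  ultimately have "exp (- 0) / 3 = exp (- (1::real)) / 3" by metis
  then show False by simp
qed

text \<open>
  Agent \<open>7\<close> is at distance \<open>1\<close> from all others. The tie is broken in favour of agents \<open>1\<close> and \<open>2\<close>,
  which pull in opposite directions. Each group needs three members so that both neighbours of any of
  them belong to the same group.
\<close>

definition torn :: state where
  "torn = line_state 7 (\<lambda>i. if i = 7 then 0 else if odd i then -1 else 1)"

lemma torn_nbrs:
  "topological_nbrs 7 1 2 torn 1 = {3,5}" "topological_nbrs 7 1 2 torn 2 = {4,6}"
  "topological_nbrs 7 1 2 torn 3 = {1,5}" "topological_nbrs 7 1 2 torn 4 = {2,6}"
  "topological_nbrs 7 1 2 torn 5 = {1,3}" "topological_nbrs 7 1 2 torn 6 = {2,4}"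
  "topological_nbrs 7 1 2 torn 7 = {1,2}"
proof -
  have list: "[1..<Suc 7] = [1,2,3,4,5,6,7]" by (simp add: upt_rec)
  have coord: "torn 1 0 = -1" "torn 2 0 = 1" "torn 3 0 = -1" "torn 4 0 = 1" "torn 5 0 = -1"
    "torn 6 0 = 1" "torn 7 0 = 0"
    by (simp_all add: torn_def line_state_def)
  show "topological_nbrs 7 1 2 torn 1 = {3,5}" "topological_nbrs 7 1 2 torn 2 = {4,6}"
    "topological_nbrs 7 1 2 torn 3 = {1,5}" "topological_nbrs 7 1 2 torn 4 = {2,6}"
    "topological_nbrs 7 1 2 torn 5 = {1,3}" "topological_nbrs 7 1 2 torn 6 = {2,4}"
    "topological_nbrs 7 1 2 torn 7 = {1,2}"
    unfolding topological_nbrs_def list by (simp_all add: enorm_1 coord[simplified])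
qed

lemma torn_equilibrium: "topological_model 7 1 2 (\<lambda>_. 1) torn = 0"
proof (rule ext)+
  fix i k :: nat
  have "i = 1 \<or> i = 2 \<or> i = 3 \<or> i = 4 \<or> i = 5 \<or> i = 6 \<or> i = 7 \<or> i \<notin> {1..7}" by auto
  then show "topological_model 7 1 2 (\<lambda>_. 1) torn i k = (0 :: state) i k"
    using torn_nbrs by (auto simp: bc_field_def torn_def line_state_def)
qed

lemma torn_solution: "caratheodory_solution 7 1 (topological_model 7 1 2 (\<lambda>_. 1)) (\<lambda>_. torn)"
  unfolding caratheodory_solution_def caratheodory_on_def torn_equilibrium has_velocity_def
  by (auto simp: torn_def line_state_in_state_space snorm_def enorm_def L2_set_def
      intro!: abs_continuous_curveI_lipschitz[where L = 0])

lemma torn_not_converging_to_cluster: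
  "\<not> converges_to_cluster 7 1 (topological_nbrs 7 1 2) (\<lambda>_. torn)"
proof
  assume "converges_to_cluster 7 1 (topological_nbrs 7 1 2) (\<lambda>_. torn)"
  then obtain z where z: "cluster_point 7 1 (topological_nbrs 7 1 2) z" "((\<lambda>_::real. torn) \<longlongrightarrow> z) at_top"
    by (auto simp: converges_to_cluster_def)
  then have "z = torn"
    using tendsto_unique[OF trivial_limit_at_top_linorder z(2) tendsto_const] by simp
  then have "torn 7 = torn 1" using z(1) torn_nbrs(7) by (auto simp: cluster_point_def)
  then have "torn 7 0 = torn 1 0" by simp
  then show False by (simp add: torn_def line_state_def)
qed

section \<open>Nearest neighbours and their chains\<close>

definition nearest :: "nat \<Rightarrow> nat \<Rightarrow> state \<Rightarrow> nat \<Rightarrow> nat" where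
  "nearest N n x i = hd (sort_key (\<lambda>j. enorm n (x j - x i)) [j \<leftarrow> [1..<Suc N]. j \<noteq> i])"

text \<open>
  The head of a stably sorted list minimises the pair of key and value lexicographically.
\<close>

lemma hd_sort_key_minimal:
  fixes f :: "nat \<Rightarrow> 'b::linorder"
  assumes xs: "xs \<noteq> []" "sorted xs" and j: "j \<in> set xs"
  defines "m \<equiv> hd (sort_key f xs)"
  shows "f m < f j \<or> f m = f j \<and> m \<le> j"
proof -
  let ?s = "sort_key f xs"
  have "?s \<noteq> []" using xs(1) by (metis set_empty set_sort)
  then have s: "?s = m # tl ?s" by (simp add: m_def)
  have "f m \<le> f j"
  proof (cases "j = m")
    case False
    then have "j \<in> set (tl ?s)" using j s by (metis set_ConsD set_sort)
    moreover have "sorted (map f (m # tl ?s))" using s sorted_sort_key[of f xs] by simp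
    ultimately show ?thesis by auto
  qed simp
  moreover have "m \<le> j" if eq: "f m = f j"
  proof -
    have "[y \<leftarrow> xs. f y = f m] = [y \<leftarrow> ?s. f y = f m]" by (simp add: sort_key_stable)
    also have "\<dots> = m # [y \<leftarrow> tl ?s. f y = f m]" by (subst s) simp
    finally have "[y \<leftarrow> xs. f y = f m] = m # [y \<leftarrow> tl ?s. f y = f m]" .
    moreover have "sorted [y \<leftarrow> xs. f y = f m]" using xs(2) by (rule sorted_wrt_filter)
    moreover have "j \<in> set [y \<leftarrow> xs. f y = f m]" using j eq by simp
    ultimately show ?thesis by (metis order_refl set_ConsD sorted_simps(2))
  qed
  ultimately show ?thesis by (auto simp: order_le_less)
qed

lemma nearest_props:
  assumes N: "N \<ge> 2" and i: "i \<in> {1..N}"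
  shows "topological_nbrs N n 1 x i = {nearest N n x i}"
    and "nearest N n x i \<in> {1..N} - {i}"
    and "\<And>j. j \<in> {1..N} - {i} \<Longrightarrow> enorm n (x (nearest N n x i) - x i) < enorm n (x j - x i) \<or>
           enorm n (x (nearest N n x i) - x i) = enorm n (x j - x i) \<and> nearest N n x i \<le> j"
proof -
  let ?xs = "[j \<leftarrow> [1..<Suc N]. j \<noteq> i]"
  let ?s = "sort_key (\<lambda>j. enorm n (x j - x i)) ?xs"
  have "(if i = 1 then 2 else 1) \<in> set ?xs" using N i by auto
  then have ne: "?xs \<noteq> []" by (metis empty_iff empty_set)
  then have sne: "?s \<noteq> []" by (metis set_empty set_sort)
  then have "take 1 ?s = [hd ?s]" by (cases ?s) auto
  then show eq: "topological_nbrs N n 1 x i = {nearest N n x i}"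
    unfolding topological_nbrs_def nearest_def by simp
  show "nearest N n x i \<in> {1..N} - {i}"
    using topological_nbrs_subset[of N n 1 x i] eq by simp
  fix j assume "j \<in> {1..N} - {i}"
  then have "j \<in> set ?xs" by auto
  then show "enorm n (x (nearest N n x i) - x i) < enorm n (x j - x i) \<or>
           enorm n (x (nearest N n x i) - x i) = enorm n (x j - x i) \<and> nearest N n x i \<le> j"
    unfolding nearest_def by (intro hd_sort_key_minimal[OF ne] sorted_wrt_filter sorted_upt)
qed

text \<open>
  Along the orbit of \<open>u\<close> under \<open>f\<close> the bounds \<open>\<delta> u \<le> - \<sigma> u + \<sigma> (f u)\<close> telescope until a pair with
  \<open>f (f u) = u\<close> is reached, where \<open>\<delta> u \<le> - \<sigma> u\<close> ends the sum. The orbit does end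
  in such a pair: \<open>lex\<close> makes the pair \<open>(r u, u)\<close> decrease lexicographically under two steps of \<open>f\<close>, strictly
  unless \<open>f (f u) = u\<close>, so an orbit can return to its start only if \<open>f (f u) = u\<close>.
\<close>

lemma sum_along_chain:
  fixes f :: "nat \<Rightarrow> nat" and r \<sigma> \<delta> :: "nat \<Rightarrow> real"
  assumes V: "finite V" "\<And>i. i \<in> V \<Longrightarrow> f i \<in> V"
    and lex: "\<And>i. i \<in> V \<Longrightarrow> r (f i) < r i \<or> r (f i) = r i \<and> f (f i) \<le> i"
    and nonpos: "\<And>i. i \<in> V \<Longrightarrow> \<delta> i \<le> 0"
    and step: "\<And>i. i \<in> V \<Longrightarrow> \<delta> i \<le> - \<sigma> i + \<sigma> (f i)"
    and pair: "\<And>i. i \<in> V \<Longrightarrow> f (f i) = i \<Longrightarrow> \<delta> i \<le> - \<sigma> i"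
    and i: "i \<in> V"
  shows "(\<Sum>j\<in>V. \<delta> j) \<le> - \<sigma> i"
proof -
  define lx where "lx u w \<longleftrightarrow> r u < r w \<or> r u = r w \<and> u \<le> w" for u w :: nat
  define Orb where "Orb u = (\<lambda>m. (f ^^ m) u) ` UNIV" for u
  have iterV: "(f ^^ m) u \<in> V" if "u \<in> V" for m u using that V(2) by (induction m) auto
  then have OrbV: "Orb u \<subseteq> V" if "u \<in> V" for u using that by (auto simp: Orb_def)
  have two: "lx (f (f u)) u" if "u \<in> V" for u
    using lex[OF that] lex[OF V(2)[OF that]] by (auto simp: lx_def)
  \<comment> \<open>Only even iterates decrease: \<open>lex\<close> compares the index of \<open>f (f u)\<close> with that of \<open>u\<close>.\<close>
  have even: "lx ((f ^^ (2 * m)) u) u" if "u \<in> V" for m u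
  proof (induction m)
    case 0 show ?case by (simp add: lx_def)
  next
    case (Suc m)
    have "lx (f (f ((f ^^ (2 * m)) u))) ((f ^^ (2 * m)) u)" using two iterV that by blast
    then show ?case using Suc by (auto simp: lx_def)
  qed
  have return: "f (f u) = u" if u: "u \<in> V" and ret: "u \<in> Orb (f u)" for u
  proof -
    obtain k where "u = (f ^^ k) (f u)" using ret by (auto simp: Orb_def)
    then have per: "(f ^^ Suc k) u = u" by (simp add: funpow_swap1)
    then have "(f ^^ (Suc k + Suc k)) u = u" by (simp only: funpow_add comp_apply per)
    moreover have "Suc k + Suc k = 2 * k + 2" by simp
    ultimately have "u = (f ^^ (2 * k)) (f (f u))"
      by (metis (no_types, lifting) funpow_add comp_apply funpow_0 funpow.simps(2) numeral_2_eq_2 One_nat_def)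
    then have "lx u (f (f u))" using even[of "f (f u)" k] V(2) u by simp
    then show ?thesis using two[OF u] by (auto simp: lx_def)
  qed
  have OrbS: "Orb u = insert u (Orb (f u))" for u
  proof
    show "Orb u \<subseteq> insert u (Orb (f u))"
    proof
      fix w assume "w \<in> Orb u"
      then obtain m where "w = (f ^^ m) u" by (auto simp: Orb_def)
      then show "w \<in> insert u (Orb (f u))"
        by (cases m) (auto simp: Orb_def funpow_swap1)
    qed
    show "insert u (Orb (f u)) \<subseteq> Orb u"
    proof
      fix w assume "w \<in> insert u (Orb (f u))"
      then consider "w = u" | m where "w = (f ^^ m) (f u)" by (auto simp: Orb_def)
      then show "w \<in> Orb u"
      proof cases
        case 1 then show ?thesis unfolding Orb_def by (auto intro: image_eqI[of _ _ 0])
      next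
        case 2 then show ?thesis unfolding Orb_def by (auto simp: funpow_swap1 intro: image_eqI[of _ _ "Suc m"])
      qed
    qed
  qed
  have "(\<Sum>j\<in>Orb u. \<delta> j) \<le> - \<sigma> u" if "u \<in> V" for u
    using that
  proof (induction "card (Orb u)" arbitrary: u rule: less_induct)
    case less
    have fin: "finite (Orb u)" using OrbV[OF less.prems] V(1) by (rule finite_subset)
    have fu: "f u \<in> V" using V(2) less.prems .
    have finf: "finite (Orb (f u))" using OrbV[OF fu] V(1) by (rule finite_subset)
    show ?case
    proof (cases "f (f u) = u")
      case True
      have "(\<Sum>j\<in>Orb u. \<delta> j) = \<delta> u + (\<Sum>j\<in>Orb u - {u}. \<delta> j)"
        using fin OrbS[of u] by (intro sum.remove) auto
      moreover have "(\<Sum>j\<in>Orb u - {u}. \<delta> j) \<le> 0"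
        using OrbV[OF less.prems] nonpos by (intro sum_nonpos) auto
      ultimately show ?thesis using pair[OF less.prems True] by linarith
    next
      case False
      then have notin: "u \<notin> Orb (f u)" using return[OF less.prems] by blast
      then have sum: "(\<Sum>j\<in>Orb u. \<delta> j) = \<delta> u + (\<Sum>j\<in>Orb (f u). \<delta> j)"
        unfolding OrbS[of u] using finf by simp
      have "card (Orb (f u)) < card (Orb u)"
        unfolding OrbS[of u] using finf notin by simp
      then have "(\<Sum>j\<in>Orb (f u). \<delta> j) \<le> - \<sigma> (f u)" using less.hyps fu by blast
      then show ?thesis using sum step[OF less.prems] by linarith
    qed
  qed
  moreover have "(\<Sum>j\<in>V. \<delta> j) \<le> (\<Sum>j\<in>Orb i. \<delta> j)"
  proof -
    have "(\<Sum>j\<in>V. \<delta> j) = (\<Sum>j\<in>V - Orb i. \<delta> j) + (\<Sum>j\<in>Orb i. \<delta> j)"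
      using OrbV[OF i] V(1) by (rule sum.subset_diff)
    moreover have "(\<Sum>j\<in>V - Orb i. \<delta> j) \<le> 0" using nonpos by (intro sum_nonpos) auto
    ultimately show ?thesis by linarith
  qed
  ultimately show ?thesis using i by fastforce
qed

section \<open>Distances to nearest neighbours\<close>

definition nn_dist :: "nat \<Rightarrow> nat \<Rightarrow> state \<Rightarrow> nat \<Rightarrow> real" where
  "nn_dist N n x i = Min ((\<lambda>j. enorm n (x j - x i)) ` ({1..N} - {i}))"

lemma nn_dist_nearest:
  assumes "N \<ge> 2" "i \<in> {1..N}"
  shows "nn_dist N n x i = enorm n (x (nearest N n x i) - x i)"
  unfolding nn_dist_def
proof (rule Min_eqI)
  fix d assume "d \<in> (\<lambda>j. enorm n (x j - x i)) ` ({1..N} - {i})"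
  then obtain j where "j \<in> {1..N} - {i}" "d = enorm n (x j - x i)" by blast
  then show "enorm n (x (nearest N n x i) - x i) \<le> d"
    using nearest_props(3)[OF assms, of j n x] by auto
qed (use nearest_props(2)[OF assms, of n x] in auto)

lemma nn_dist_le:
  assumes "j \<in> {1..N} - {i}" shows "nn_dist N n x i \<le> enorm n (x j - x i)"
  unfolding nn_dist_def using assms by (intro Min_le) auto

lemma nn_dist_nonneg:
  assumes "N \<ge> 2" "i \<in> {1..N}" shows "nn_dist N n x i \<ge> 0"
  by (simp add: nn_dist_nearest[OF assms])

lemma has_real_derivative_iff_eventually:
  fixes f :: "real \<Rightarrow> real"
  shows "(f has_real_derivative d) (at t within S) \<longleftrightarrow>
    (\<forall>\<epsilon>>0. eventually (\<lambda>s. \<bar>f s - f t - d * (s - t)\<bar> \<le> \<epsilon> * \<bar>s - t\<bar>) (at t within S))"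
proof -
  have "(\<exists>r>0. \<forall>y\<in>S. norm (y - t) < r \<longrightarrow> norm (f y - f t - d * (y - t)) \<le> \<epsilon> * norm (y - t)) \<longleftrightarrow>
      eventually (\<lambda>s. \<bar>f s - f t - d * (s - t)\<bar> \<le> \<epsilon> * \<bar>s - t\<bar>) (at t within S)" for \<epsilon>
  proof -
    define Q where "Q y \<longleftrightarrow> \<bar>f y - f t - d * (y - t)\<bar> \<le> \<epsilon> * \<bar>y - t\<bar>" for y
    have "Q t" by (simp add: Q_def)
    then have "(\<exists>r>0. \<forall>y\<in>S. \<bar>y - t\<bar> < r \<longrightarrow> Q y) \<longleftrightarrow> eventually Q (at t within S)"
      unfolding eventually_at dist_real_def by metis
    then show ?thesis by (simp add: Q_def[abs_def])
  qed
  then show ?thesis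
    unfolding has_field_derivative_def has_derivative_within_alt by (simp add: bounded_linear_mult_right)
qed

text \<open>
  Near \<open>t\<close> the minimum is attained only by functions that attain it at \<open>t\<close>, and all of these have the same
  first-order expansion.
\<close>

lemma has_real_derivative_Min:
  fixes D :: "'a \<Rightarrow> real \<Rightarrow> real"
  assumes S: "finite S" "S \<noteq> {}"
    and d: "\<And>j. j \<in> S \<Longrightarrow> (D j has_real_derivative d j) (at t within A)"
    and active: "\<And>j. j \<in> S \<Longrightarrow> D j t = Min ((\<lambda>j. D j t) ` S) \<Longrightarrow> d j = e"
  shows "((\<lambda>s. Min ((\<lambda>j. D j s) ` S)) has_real_derivative e) (at t within A)"
  unfolding has_real_derivative_iff_eventually
proof (intro allI impI)
  fix \<epsilon> :: real assume \<epsilon>: "\<epsilon> > 0"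
  define m where "m s = Min ((\<lambda>j. D j s) ` S)" for s
  have m_attained: "\<exists>j\<in>S. D j s = m s" for s
    using Min_in[of "(\<lambda>j. D j s) ` S"] S unfolding m_def by fastforce
  have m_le: "m s \<le> D j s" if "j \<in> S" for j s
    unfolding m_def using S that by (intro Min_le) auto
  obtain j0 where j0: "j0 \<in> S" "D j0 t = m t" using m_attained by blast
  have "eventually (\<lambda>s. \<forall>j\<in>S. \<bar>D j s - D j t - d j * (s - t)\<bar> \<le> \<epsilon> * \<bar>s - t\<bar>) (at t within A)"
    using d \<epsilon> by (intro eventually_ball_finite[OF S(1)]) (auto simp: has_real_derivative_iff_eventually)
  moreover have "eventually (\<lambda>s. \<forall>j\<in>S. D j t = m t \<or> D j0 s < D j s) (at t within A)"
  proof (intro eventually_ball_finite[OF S(1)] ballI)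
    fix j assume j: "j \<in> S"
    have lim: "((\<lambda>s. D j s - D j0 s) \<longlongrightarrow> D j t - D j0 t) (at t within A)"
      using DERIV_continuous[OF d[OF j]] DERIV_continuous[OF d[OF j0(1)]]
      by (intro tendsto_diff) (auto simp: continuous_within)
    show "eventually (\<lambda>s. D j t = m t \<or> D j0 s < D j s) (at t within A)"
    proof (cases "D j t = m t")
      case False
      then have "0 < D j t - D j0 t" using m_le[OF j, of t] j0 by simp
      from order_tendstoD(1)[OF lim this] show ?thesis by (rule eventually_mono) auto
    qed simp
  qed
  ultimately show "eventually (\<lambda>s. \<bar>m s - m t - e * (s - t)\<bar> \<le> \<epsilon> * \<bar>s - t\<bar>) (at t within A)"
  proof eventually_elim
    case (elim s)
    obtain j where j: "j \<in> S" "D j s = m s" using m_attained by blast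
    then have "D j s \<le> D j0 s" using m_le[OF j0(1)] by simp
    then have jt: "D j t = m t" using elim(2) j(1) by auto
    then have "d j = e" using active[OF j(1)] by (simp add: m_def)
    then show ?case using elim(1) j jt by auto
  qed
qed

text \<open>
  Where two functions meet with different derivatives, they do not meet again nearby. A set of
  isolated points of the real line is countable, hence negligible. Away from these points all
  candidates for the nearest neighbour of an agent recede from it at the same rate, so that the
  distance to the nearest neighbour is differentiable.
\<close>

lemma countable_transversal_coincidences:
  fixes g h :: "real \<Rightarrow> real"
  shows "countable {t \<in> A. g t = h t \<and> (\<exists>d e. d \<noteq> e \<and>
    (g has_real_derivative d) (at t within A) \<and> (h has_real_derivative e) (at t within A))}"
    (is "countable ?E")
proof -
  define E where "E = ?E"
  have E: "t \<in> E \<longleftrightarrow> t \<in> A \<and> g t = h t \<and> (\<exists>d e. d \<noteq> e \<and>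
    (g has_real_derivative d) (at t within A) \<and> (h has_real_derivative e) (at t within A))" for t
    by (simp add: E_def)
  have iso: "\<exists>U. open U \<and> U \<inter> E = {t}" if t: "t \<in> E" for t
  proof -
    obtain d e where de: "d \<noteq> e" "(g has_real_derivative d) (at t within A)"
      "(h has_real_derivative e) (at t within A)" using t unfolding E by blast
    have gh: "g t = h t" using t unfolding E by blast
    have "((\<lambda>s. g s - h s) has_real_derivative (d - e)) (at t within A)"
      using DERIV_diff[OF de(2,3)] .
    moreover have "\<bar>d - e\<bar> / 2 > 0" using de(1) by simp
    ultimately have "eventually (\<lambda>s. \<bar>g s - h s - (g t - h t) - (d - e) * (s - t)\<bar> \<le> \<bar>d - e\<bar> / 2 * \<bar>s - t\<bar>) (at t within A)"
      unfolding has_real_derivative_iff_eventually by blast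
    then obtain r where r: "r > 0" "\<And>s. s \<in> A \<Longrightarrow> s \<noteq> t \<Longrightarrow> dist s t < r \<Longrightarrow>
        \<bar>g s - h s - (g t - h t) - (d - e) * (s - t)\<bar> \<le> \<bar>d - e\<bar> / 2 * \<bar>s - t\<bar>"
      unfolding eventually_at by blast
    have only: "s = t" if "s \<in> ball t r" "s \<in> E" for s
    proof (rule ccontr)
      assume "s \<noteq> t"
      moreover have "s \<in> A" "g s = h s" "dist s t < r" using that unfolding E by (auto simp: dist_commute)
      ultimately have "\<bar>(d - e) * (s - t)\<bar> \<le> \<bar>d - e\<bar> / 2 * \<bar>s - t\<bar>" using r(2)[of s] gh by simp
      moreover have "\<bar>d - e\<bar> * \<bar>s - t\<bar> > 0" using \<open>s \<noteq> t\<close> de(1) by simp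
      ultimately show False by (simp add: abs_mult)
    qed
    have "ball t r \<inter> E = {t}"
    proof
      show "ball t r \<inter> E \<subseteq> {t}" using only by blast
      show "{t} \<subseteq> ball t r \<inter> E" using t r(1) by simp
    qed
    then show ?thesis using open_ball by blast
  qed
  define F where "F = {U. open U \<and> (\<exists>t. U \<inter> E = {t})}"
  obtain F' where F': "F' \<subseteq> F" "countable F'" "\<Union>F' = \<Union>F"
    using Lindelof[of F] by (auto simp: F_def)
  have "E \<subseteq> \<Union>F"
  proof
    fix t assume "t \<in> E"
    then obtain U where "open U" "U \<inter> E = {t}" using iso by blast
    then have "U \<in> F" "t \<in> U" unfolding F_def by blast+
    then show "t \<in> \<Union>F" by blast
  qed
  then have "E \<subseteq> (\<Union>U\<in>F'. U \<inter> E)" using F'(3) by blast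
  moreover have "countable (\<Union>U\<in>F'. U \<inter> E)"
  proof (rule countable_UN[OF F'(2)])
    fix U assume "U \<in> F'"
    then obtain t where "U \<inter> E = {t}" using F'(1) unfolding F_def by blast
    then show "countable (U \<inter> E)" by simp
  qed
  ultimately have "countable E" by (rule countable_subset)
  then show ?thesis by (simp only: E_def)
qed

lemma has_zero_derivative_dominated:
  fixes f :: "real \<Rightarrow> real"
  assumes K: "finite K" and g: "\<And>k. k \<in> K \<Longrightarrow> (g k has_real_derivative 0) (at t within A)"
    and dom: "\<And>s. \<bar>f s - f t\<bar> \<le> (\<Sum>k\<in>K. \<bar>g k s - g k t\<bar>)"
  shows "(f has_real_derivative 0) (at t within A)"
  unfolding has_real_derivative_iff_eventually
proof (intro allI impI)
  fix \<epsilon> :: real assume \<epsilon>: "\<epsilon> > 0"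
  define \<eta> where "\<eta> = \<epsilon> / (real (card K) + 1)"
  have \<eta>: "\<eta> > 0" "real (card K) * \<eta> \<le> \<epsilon>" using \<epsilon> by (auto simp: \<eta>_def field_simps)
  have "eventually (\<lambda>s. \<forall>k\<in>K. \<bar>g k s - g k t - 0 * (s - t)\<bar> \<le> \<eta> * \<bar>s - t\<bar>) (at t within A)"
    using g \<eta>(1) unfolding has_real_derivative_iff_eventually by (intro eventually_ball_finite[OF K]) blast
  then show "eventually (\<lambda>s. \<bar>f s - f t - 0 * (s - t)\<bar> \<le> \<epsilon> * \<bar>s - t\<bar>) (at t within A)"
  proof eventually_elim
    case (elim s)
    have "\<bar>f s - f t\<bar> \<le> (\<Sum>k\<in>K. \<bar>g k s - g k t\<bar>)" by (rule dom)
    also have "\<dots> \<le> (\<Sum>k\<in>K. \<eta> * \<bar>s - t\<bar>)" using elim by (intro sum_mono) auto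
    also have "\<dots> = (real (card K) * \<eta>) * \<bar>s - t\<bar>" by simp
    also have "\<dots> \<le> \<epsilon> * \<bar>s - t\<bar>" using \<eta>(2) by (intro mult_right_mono) auto
    finally show ?case by simp
  qed
qed

lemma abs_enorm_diff_le: "\<bar>enorm n u - enorm n w\<bar> \<le> (\<Sum>k<n. \<bar>u k - w k\<bar>)"
proof -
  have 1: "enorm n u \<le> enorm n w + enorm n (u - w)" using enorm_triangle[of n w "u - w"] by simp
  have 2: "enorm n w \<le> enorm n u + enorm n (u - w)"
    using enorm_triangle[of n u "w - u"] by (simp add: enorm_minus_commute)
  have "enorm n (u - w) \<le> (\<Sum>k<n. \<bar>(u - w) k\<bar>)" unfolding enorm_def by (rule L2_set_le_sum_abs)
  then show ?thesis using 1 2 by simp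
qed

lemma abs_Min_diff_le:
  fixes f g :: "'a \<Rightarrow> real"
  assumes "finite S" "S \<noteq> {}"
  shows "\<bar>Min (f ` S) - Min (g ` S)\<bar> \<le> (\<Sum>j\<in>S. \<bar>f j - g j\<bar>)"
proof -
  have *: "Min (f ` S) \<le> Min (g ` S) + (\<Sum>j\<in>S. \<bar>f j - g j\<bar>)" for f g :: "'a \<Rightarrow> real"
  proof -
    obtain j where j: "j \<in> S" "g j = Min (g ` S)" using Min_in[of "g ` S"] assms by fastforce
    have "Min (f ` S) \<le> f j" using assms j(1) by (intro Min_le) auto
    moreover have "\<bar>f j - g j\<bar> \<le> (\<Sum>j\<in>S. \<bar>f j - g j\<bar>)" using assms j(1) by (intro member_le_sum) auto
    ultimately show ?thesis using j(2) by linarith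
  qed
  show ?thesis using *[of f g] *[of g f] by (simp add: abs_minus_commute[of "g _"])
qed

lemma distance_derivative:
  assumes X: "\<And>i k. ((\<lambda>s. x s i k) has_real_derivative v i k) (at t within A)"
    and pos: "enorm n (x t j - x t i) > 0"
  shows "((\<lambda>s. enorm n (x s j - x s i)) has_real_derivative
    (\<Sum>k<n. (x t j k - x t i k) * (v j k - v i k)) / enorm n (x t j - x t i)) (at t within A)"
proof -
  define S where "S s = (\<Sum>k<n. (x s j k - x s i k)\<^sup>2)" for s
  have e: "enorm n (x s j - x s i) = sqrt (S s)" for s by (simp add: enorm_def L2_set_def S_def)
  have dS: "(S has_real_derivative (\<Sum>k<n. 2 * (x t j k - x t i k) * (v j k - v i k))) (at t within A)"
    unfolding S_def
  proof (rule DERIV_sum)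
    fix k
    show "((\<lambda>s. (x s j k - x s i k)\<^sup>2) has_real_derivative 2 * (x t j k - x t i k) * (v j k - v i k)) (at t within A)"
      using DERIV_power[OF DERIV_diff[OF X[of j k] X[of i k]], of 2] by (simp add: algebra_simps)
  qed
  have "S t > 0" using pos by (simp add: e)
  from DERIV_chain2[OF DERIV_real_sqrt[OF this] dS]
  have "((\<lambda>s. sqrt (S s)) has_real_derivative
      inverse (sqrt (S t)) / 2 * (\<Sum>k<n. 2 * (x t j k - x t i k) * (v j k - v i k))) (at t within A)" .
  moreover have "inverse (sqrt (S t)) / 2 * (\<Sum>k<n. 2 * (x t j k - x t i k) * (v j k - v i k))
      = (\<Sum>k<n. (x t j k - x t i k) * (v j k - v i k)) / sqrt (S t)"
  proof -
    have "(\<Sum>k<n. 2 * (x t j k - x t i k) * (v j k - v i k)) = 2 * (\<Sum>k<n. (x t j k - x t i k) * (v j k - v i k))"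
      by (simp only: sum_distrib_left mult.assoc)
    then show ?thesis by (simp add: inverse_eq_divide)
  qed
  ultimately show ?thesis by (simp add: e)
qed

text \<open>
  The norm is not differentiable at the origin, but coinciding agents of equal velocity separate only
  to higher order.
\<close>

lemma distance_derivative_zero:
  assumes X: "\<And>i k. ((\<lambda>s. x s i k) has_real_derivative v i k) (at t within A)"
    and v: "\<And>k. k < n \<Longrightarrow> v i k = v j k"
  shows "((\<lambda>s. enorm n (x s j - x s i)) has_real_derivative 0) (at t within A)"
proof (rule has_zero_derivative_dominated[of "{..<n}" "\<lambda>k s. x s j k - x s i k"])
  show "((\<lambda>s. x s j k - x s i k) has_real_derivative 0) (at t within A)" if "k \<in> {..<n}" for k
    using that DERIV_diff[OF X[of j k] X[of i k]] v by simp
  show "\<bar>enorm n (x s j - x s i) - enorm n (x t j - x t i)\<bar>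
      \<le> (\<Sum>k<n. \<bar>x s j k - x s i k - (x t j k - x t i k)\<bar>)" for s
    using abs_enorm_diff_le[of n "x s j - x s i" "x t j - x t i"] by simp
qed simp

text \<open>
  The derivative of the distance from \<open>i\<close> to \<open>j = f i\<close> is \<open>- \<sigma> i\<close>, from the motion of \<open>i\<close> straight towards \<open>j\<close>,
  plus the component of the velocity of \<open>j\<close> along the same direction, which is at most the
  speed \<open>\<sigma> j\<close>. If \<open>f j = i\<close>, agent \<open>j\<close> moves towards \<open>i\<close> and this component is not positive. Agents with
  \<open>r i = 0\<close> do not move. The \<open>coherent\<close> hypothesis excludes the exceptional times of
  \<open>countable_transversal_coincidences\<close>.
\<close>

lemma nearest_distances_velocity:
  fixes x :: "real \<Rightarrow> state"
  assumes N: "N \<ge> 2" and a: "interaction a"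
    and X: "\<And>i k. ((\<lambda>s. x s i k) has_real_derivative topological_model N n 1 a (x t) i k) (at t within A)"
    and coherent: "\<And>i j l d e. i \<in> {1..N} \<Longrightarrow> j \<in> {1..N} \<Longrightarrow> l \<in> {1..N} \<Longrightarrow>
      enorm n (x t j - x t i) = enorm n (x t l - x t i) \<Longrightarrow>
      ((\<lambda>s. enorm n (x s j - x s i)) has_real_derivative d) (at t within A) \<Longrightarrow>
      ((\<lambda>s. enorm n (x s l - x s i)) has_real_derivative e) (at t within A) \<Longrightarrow> d = e"
  defines "\<sigma> \<equiv> \<lambda>i. a (nn_dist N n (x t) i) * nn_dist N n (x t) i"
  obtains \<delta> where
    "\<And>i. i \<in> {1..N} \<Longrightarrow> ((\<lambda>s. nn_dist N n (x s) i) has_real_derivative \<delta> i) (at t within A)"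
    "\<And>i. i \<in> {1..N} \<Longrightarrow> \<delta> i \<le> 0"
    "\<And>i. i \<in> {1..N} \<Longrightarrow> (\<Sum>j\<in>{1..N}. \<delta> j) \<le> - \<sigma> i"
    "\<And>i k. i \<in> {1..N} \<Longrightarrow> k < n \<Longrightarrow> \<bar>topological_model N n 1 a (x t) i k\<bar> \<le> \<sigma> i"
proof -
  define v where "v = topological_model N n 1 a (x t)"
  define f where "f = nearest N n (x t)"
  define r where "r = nn_dist N n (x t)"
  define D where "D i j = enorm n (x t j - x t i)" for i j
  define \<delta> where "\<delta> i = (if r i = 0 then 0
      else (\<Sum>k<n. (x t (f i) k - x t i k) * (v (f i) k - v i k)) / r i)" for i
  note Xv = X[folded v_def]
  have f: "f i \<in> {1..N}" "f i \<noteq> i" if "i \<in> {1..N}" for i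
    using nearest_props(2)[OF N that, of n "x t"] by (auto simp: f_def)
  have r: "r i = D i (f i)" if "i \<in> {1..N}" for i
    using nn_dist_nearest[OF N that] by (simp add: r_def D_def f_def)
  have r0: "r i \<ge> 0" if "i \<in> {1..N}" for i using r[OF that] by (simp add: D_def)
  have r_le: "r i \<le> D i j" if "j \<in> {1..N}" "j \<noteq> i" for i j
    using nn_dist_le[of j N i n "x t"] that by (simp add: r_def D_def)
  have D_sym: "D i j = D j i" for i j by (simp add: D_def enorm_minus_commute)
  have \<sigma>: "\<sigma> i = a (r i) * r i" for i by (simp add: \<sigma>_def r_def)
  have \<sigma>0: "\<sigma> i \<ge> 0" if "i \<in> {1..N}" for i
    using r0[OF that] interaction_nonneg[OF a] by (simp add: \<sigma>)
  have v_eq: "v i = a (r i) *\<^sub>R (x t (f i) - x t i)" if "i \<in> {1..N}" for i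
    using that nearest_props(1)[OF N that, of n "x t"] nn_dist_nearest[OF N that, of n "x t"]
    by (simp add: v_def bc_field_def f_def r_def)
  have v_norm: "enorm n (v i) = \<sigma> i" if "i \<in> {1..N}" for i
    using interaction_nonneg[OF a r0[OF that]] r[OF that]
    by (simp add: v_eq[OF that] enorm_scaleR \<sigma> D_def)
  have v0: "v i k = 0" if "i \<in> {1..N}" "r i = 0" "k < n" for i k
    using abs_coord_le_enorm[OF that(3), of "v i"] v_norm[OF that(1)] that(2) by (simp add: \<sigma>)
  have dist_deriv: "((\<lambda>s. enorm n (x s j - x s i)) has_real_derivative
      (if D i j = 0 then 0 else (\<Sum>k<n. (x t j k - x t i k) * (v j k - v i k)) / D i j)) (at t within A)"
    if ij: "i \<in> {1..N}" "j \<in> {1..N}" "i \<noteq> j" for i j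
  proof (cases "D i j = 0")
    case True
    then have "r i = 0" "r j = 0"
      using r_le[of j i] r_le[of i j] r0 ij D_sym[of i j] by (auto intro: antisym)
    then have "v i k = v j k" if "k < n" for k using v0 ij that by simp
    from distance_derivative_zero[where v = v, OF Xv this] show ?thesis using True by simp
  next
    case False
    then have "enorm n (x t j - x t i) > 0" by (simp add: D_def order_less_le)
    from distance_derivative[where v = v, OF Xv this] show ?thesis using False by (simp add: D_def)
  qed
  show thesis
  proof (rule that)
    fix i assume i: "i \<in> {1..N}"
    show "((\<lambda>s. nn_dist N n (x s) i) has_real_derivative \<delta> i) (at t within A)"
      unfolding nn_dist_def
    proof (rule has_real_derivative_Min)
      show "finite ({1..N} - {i})" "{1..N} - {i} \<noteq> {}" using f[OF i] by auto
      show "((\<lambda>s. enorm n (x s j - x s i)) has_real_derivative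
        (if D i j = 0 then 0 else (\<Sum>k<n. (x t j k - x t i k) * (v j k - v i k)) / D i j)) (at t within A)"
        if "j \<in> {1..N} - {i}" for j using dist_deriv[OF i, of j] that by blast
      fix j assume j: "j \<in> {1..N} - {i}" "enorm n (x t j - x t i) = Min ((\<lambda>j. enorm n (x t j - x t i)) ` ({1..N} - {i}))"
      then have "D i j = D i (f i)" using r[OF i] by (simp add: D_def r_def nn_dist_def)
      then have "(if D i j = 0 then 0 else (\<Sum>k<n. (x t j k - x t i k) * (v j k - v i k)) / D i j)
          = (if D i (f i) = 0 then 0 else (\<Sum>k<n. (x t (f i) k - x t i k) * (v (f i) k - v i k)) / D i (f i))"
        using j(1) f[OF i] i by (intro coherent[OF i _ _ _ dist_deriv dist_deriv]) (auto simp: D_def)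
      then show "(if D i j = 0 then 0 else (\<Sum>k<n. (x t j k - x t i k) * (v j k - v i k)) / D i j) = \<delta> i"
        by (simp add: \<delta>_def r[OF i])
    qed
  next
    have inner_self: "(\<Sum>k<n. (x t (f i) k - x t i k) * v i k) = r i * \<sigma> i" if i: "i \<in> {1..N}" for i
    proof -
      have "(\<Sum>k<n. (x t (f i) k - x t i k) * v i k) = a (r i) * (\<Sum>k<n. (x t (f i) k - x t i k)\<^sup>2)"
        by (simp add: v_eq[OF i] sum_distrib_left power2_eq_square mult.left_commute)
      also have "\<dots> = a (r i) * (r i)\<^sup>2"
        using enorm_power2[of n "x t (f i) - x t i"] r[OF i] by (simp add: D_def)
      finally show ?thesis by (simp add: \<sigma> power2_eq_square)
    qed
    have \<delta>_eq: "\<delta> i = - \<sigma> i + (\<Sum>k<n. (x t (f i) k - x t i k) * v (f i) k) / r i"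
      if i: "i \<in> {1..N}" "r i \<noteq> 0" for i
      using i(2) inner_self[OF i(1)]
      by (simp add: \<delta>_def right_diff_distrib sum_subtractf diff_divide_distrib)
    have step: "\<delta> i \<le> - \<sigma> i + \<sigma> (f i)" if i: "i \<in> {1..N}" for i
    proof (cases "r i = 0")
      case True
      then show ?thesis using \<sigma>0[OF f(1)[OF i]] by (simp add: \<delta>_def \<sigma>)
    next
      case False
      then have ri: "r i > 0" using r0[OF i] by simp
      have "(\<Sum>k<n. (x t (f i) - x t i) k * v (f i) k) \<le> r i * \<sigma> (f i)"
        using inner_le_enorm[of "x t (f i) - x t i" "v (f i)" n] v_norm[OF f(1)[OF i]] r[OF i]
        by (simp add: D_def)
      then have "(\<Sum>k<n. (x t (f i) k - x t i k) * v (f i) k) / r i \<le> \<sigma> (f i)"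
        using ri by (simp add: divide_le_eq mult.commute)
      then show ?thesis using \<delta>_eq[OF i False] by simp
    qed
    have r_f: "r (f i) \<le> r i" if i: "i \<in> {1..N}" for i
      using r_le[of i "f i"] f[OF i] r[OF i] D_sym[of i "f i"] i by auto
    have nonpos: "\<delta> i \<le> 0" if i: "i \<in> {1..N}" for i
    proof -
      have "\<sigma> (f i) \<le> \<sigma> i" unfolding \<sigma>
        using r_f[OF i] r0[OF i] r0[OF f(1)[OF i]] interaction_nonneg[OF a] interaction_mono[OF a]
        by (intro mult_mono) auto
      then show ?thesis using step[OF i] by linarith
    qed
    then show "\<delta> i \<le> 0" if "i \<in> {1..N}" for i using that by blast
    show "(\<Sum>j\<in>{1..N}. \<delta> j) \<le> - \<sigma> i" if "i \<in> {1..N}" for i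
    proof (rule sum_along_chain[of "{1..N}" f r \<delta> \<sigma> i])
      fix i assume i: "i \<in> {1..N}"
      show "r (f i) < r i \<or> r (f i) = r i \<and> f (f i) \<le> i"
        using nearest_props(3)[OF N f(1)[OF i], of i n "x t"] i f[OF i] r[OF f(1)[OF i]] r[OF i] D_sym[of i "f i"]
        by (auto simp: f_def D_def)
      show "\<delta> i \<le> - \<sigma> i" if ff: "f (f i) = i"
      proof (cases "r i = 0")
        case True then show ?thesis by (simp add: \<delta>_def \<sigma>)
      next
        case False
        have "(\<Sum>k<n. (x t (f i) k - x t i k) * v (f i) k) = - (\<Sum>k<n. (x t i k - x t (f i) k) * v (f i) k)"
          by (simp add: sum_negf[symmetric] algebra_simps)
        also have "\<dots> = - (r (f i) * \<sigma> (f i))" using inner_self[OF f(1)[OF i]] ff by simp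
        also have "\<dots> \<le> 0" using r0[OF f(1)[OF i]] \<sigma>0[OF f(1)[OF i]] by simp
        finally show ?thesis using \<delta>_eq[OF i False] r0[OF i] by (simp add: divide_le_0_iff)
      qed
    qed (use f nonpos step that in auto)
    show "\<bar>topological_model N n 1 a (x t) i k\<bar> \<le> \<sigma> i" if "i \<in> {1..N}" "k < n" for i k
      using abs_coord_le_enorm[OF that(2), of "v i"] v_norm[OF that(1)] by (simp add: v_def)
  qed
qed

section \<open>Clustering for one topological neighbour\<close>

lemma abs_continuous_on_nn_dist:
  assumes cur: "abs_continuous_curve N n T x" and N: "N \<ge> 2" and i: "i \<in> {1..N}"
  shows "abs_continuous_on 0 T (\<lambda>t. nn_dist N n (x t) i)"
proof (rule abs_continuous_on_dominated[of "{1..N} - {i}" _ _ "\<lambda>j t. enorm n (x t j - x t i)" _ 1])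
  have ne: "{1..N} - {i} \<noteq> {}" using nearest_props(2)[OF N i, of n "x 0"] by auto
  show "\<bar>nn_dist N n (x s) i - nn_dist N n (x t) i\<bar>
      \<le> 1 * (\<Sum>j\<in>{1..N} - {i}. \<bar>enorm n (x s j - x s i) - enorm n (x t j - x t i)\<bar>)" for s t
    unfolding nn_dist_def mult_1 by (rule abs_Min_diff_le) (use ne in auto)
  fix j assume j: "j \<in> {1..N} - {i}"
  show "abs_continuous_on 0 T (\<lambda>t. enorm n (x t j - x t i))"
  proof (rule abs_continuous_on_dominated[of "{..<n}" _ _ "\<lambda>k t. x t j k + - x t i k" _ 1])
    show "abs_continuous_on 0 T (\<lambda>t. x t j k + - x t i k)" if "k \<in> {..<n}" for k
      using that i j by (intro abs_continuous_on_add abs_continuous_on_minus abs_continuous_curve_coord[OF cur]) auto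
    show "\<bar>enorm n (x s j - x s i) - enorm n (x t j - x t i)\<bar>
        \<le> 1 * (\<Sum>k<n. \<bar>x s j k + - x s i k - (x t j k + - x t i k)\<bar>)" for s t
      using abs_enorm_diff_le[of n "x s j - x s i" "x t j - x t i"] by simp
  qed simp
qed simp

lemma nearest_distances_decay:
  assumes N: "N \<ge> 2" and a: "interaction a"
    and sol: "caratheodory_on N n (topological_model N n 1 a) T x"
  obtains Z where "negligible Z"
    "\<And>t. t \<in> {0..T} - Z \<Longrightarrow> \<exists>\<delta> v. \<forall>i\<in>{1..N}.
       ((\<lambda>s. nn_dist N n (x s) i) has_real_derivative \<delta> i) (at t within {0..T}) \<and>
       (\<forall>k. ((\<lambda>s. x s i k) has_real_derivative v i k) (at t within {0..T})) \<and>
       \<delta> i \<le> 0 \<and> (\<Sum>j\<in>{1..N}. \<delta> j) \<le> - (a (nn_dist N n (x t) i) * nn_dist N n (x t) i) \<and>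
       (\<forall>k<n. \<bar>v i k\<bar> \<le> a (nn_dist N n (x t) i) * nn_dist N n (x t) i)"
proof -
  have "AE t in lebesgue_on {0..T}. has_velocity T x (topological_model N n 1 a (x t)) t"
    using sol by (simp add: caratheodory_on_def)
  then obtain Z0 where Z0: "negligible Z0"
    "\<And>t. t \<in> {0..T} - Z0 \<Longrightarrow> has_velocity T x (topological_model N n 1 a (x t)) t"
    by (rule AE_lebesgue_on_negligible) (rule that)
  define D where "D i j s = enorm n (x s j - x s i)" for i j s
  \<comment> \<open>The times at which \<open>j\<close> and \<open>l\<close> exchange their order of distance from \<open>i\<close>.\<close>
  define E where "E i j l = {t \<in> {0..T}. D i j t = D i l t \<and> (\<exists>d e. d \<noteq> e \<and>
    (D i j has_real_derivative d) (at t within {0..T}) \<and> (D i l has_real_derivative e) (at t within {0..T}))}" for i j l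
  define Z where "Z = Z0 \<union> (\<Union>i\<in>{1..N}. \<Union>j\<in>{1..N}. \<Union>l\<in>{1..N}. E i j l)"
  have "countable (\<Union>i\<in>{1..N}. \<Union>j\<in>{1..N}. \<Union>l\<in>{1..N}. E i j l)"
    unfolding E_def by (intro countable_UN countable_transversal_coincidences) auto
  then have "negligible (\<Union>i\<in>{1..N}. \<Union>j\<in>{1..N}. \<Union>l\<in>{1..N}. E i j l)"
    unfolding negligible_iff_null_sets by (intro null_sets_completionI countable_imp_null_set_lborel)
  then have "negligible Z" unfolding Z_def using Z0(1) by (intro negligible_Un)
  then show thesis
  proof (rule that)
    fix t assume t: "t \<in> {0..T} - Z"
    then have "t \<in> {0..T} - Z0" by (simp add: Z_def)
    then have X: "((\<lambda>s. x s i k) has_real_derivative topological_model N n 1 a (x t) i k) (at t within {0..T})" for i k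
      using Z0(2) by (simp add: has_velocity_def)
    have coherent: "d = e" if "i \<in> {1..N}" "j \<in> {1..N}" "l \<in> {1..N}"
      "enorm n (x t j - x t i) = enorm n (x t l - x t i)"
      "((\<lambda>s. enorm n (x s j - x s i)) has_real_derivative d) (at t within {0..T})"
      "((\<lambda>s. enorm n (x s l - x s i)) has_real_derivative e) (at t within {0..T})" for i j l d e
    proof (rule ccontr)
      assume "d \<noteq> e"
      then have "t \<in> E i j l" using that t unfolding E_def D_def by blast
      then show False using that(1-3) t unfolding Z_def by blast
    qed
    obtain \<delta> where
      "\<And>i. i \<in> {1..N} \<Longrightarrow> ((\<lambda>s. nn_dist N n (x s) i) has_real_derivative \<delta> i) (at t within {0..T})"
      "\<And>i. i \<in> {1..N} \<Longrightarrow> \<delta> i \<le> 0"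
      "\<And>i. i \<in> {1..N} \<Longrightarrow> (\<Sum>j\<in>{1..N}. \<delta> j) \<le> - (a (nn_dist N n (x t) i) * nn_dist N n (x t) i)"
      "\<And>i k. i \<in> {1..N} \<Longrightarrow> k < n \<Longrightarrow>
         \<bar>topological_model N n 1 a (x t) i k\<bar> \<le> a (nn_dist N n (x t) i) * nn_dist N n (x t) i"
    proof (rule nearest_distances_velocity[OF N a X])
      show "d = e" if "i \<in> {1..N}" "j \<in> {1..N}" "l \<in> {1..N}"
        "enorm n (x t j - x t i) = enorm n (x t l - x t i)"
        "((\<lambda>s. enorm n (x s j - x s i)) has_real_derivative d) (at t within {0..T})"
        "((\<lambda>s. enorm n (x s l - x s i)) has_real_derivative e) (at t within {0..T})" for i j l d e
        using that by (rule coherent)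
    qed (rule that)
    with X show "\<exists>\<delta> v. \<forall>i\<in>{1..N}.
       ((\<lambda>s. nn_dist N n (x s) i) has_real_derivative \<delta> i) (at t within {0..T}) \<and>
       (\<forall>k. ((\<lambda>s. x s i k) has_real_derivative v i k) (at t within {0..T})) \<and>
       \<delta> i \<le> 0 \<and> (\<Sum>j\<in>{1..N}. \<delta> j) \<le> - (a (nn_dist N n (x t) i) * nn_dist N n (x t) i) \<and>
       (\<forall>k<n. \<bar>v i k\<bar> \<le> a (nn_dist N n (x t) i) * nn_dist N n (x t) i)"
      by (intro exI[of _ \<delta>] exI[of _ "topological_model N n 1 a (x t)"]) blast
  qed
qed

text \<open>
  The sum \<open>W\<close> of all distances to nearest neighbours decreases at least as fast as any agent moves, so
  \<open>W + x i k\<close> and \<open>W - x i k\<close> are both nonincreasing; as \<open>W\<close> converges, so does every coordinate. The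
  distance \<open>r i\<close> cannot stay above some \<open>\<rho> > 0\<close>, or \<open>W\<close> would decrease at the rate \<open>a \<rho> * \<rho>\<close> for ever. If
  \<open>z i\<close> were at a positive distance from all other limit positions, \<open>r i\<close> would finally be bounded away
  from \<open>0\<close>.
\<close>

lemma nearest_neighbour_converges_to_cluster:
  assumes N: "N \<ge> 2" and a: "interaction a"
    and sol: "caratheodory_solution N n (topological_model N n 1 a) x"
  shows "converges_to_cluster N n (topological_nbrs N n 1) x"
proof -
  define r where "r i t = nn_dist N n (x t) i" for i t
  define \<sigma> where "\<sigma> i t = a (r i t) * r i t" for i t
  define W where "W t = (\<Sum>i\<in>{1..N}. r i t)" for t
  have on: "caratheodory_on N n (topological_model N n 1 a) (t + 1) x" if "t \<ge> 0" for t
    using sol that by (auto simp: caratheodory_solution_def)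
  have st: "x t \<in> state_space N n" if "t \<ge> 0" for t
    using on[OF that] that by (auto simp: caratheodory_on_def)
  have cur: "abs_continuous_curve N n (t + 1) x" if "t \<ge> 0" for t
    using on[OF that] by (auto simp: caratheodory_on_def)
  have r0: "r i t \<ge> 0" if "i \<in> {1..N}" for i t using nn_dist_nonneg[OF N that] by (simp add: r_def)
  have W0: "W t \<ge> 0" for t unfolding W_def using r0 by (intro sum_nonneg) auto
  \<comment> \<open>The monotonicity principle with the derivative data of \<open>nearest_distances_decay\<close> at hand.\<close>
  have decay: "F t \<le> F s" if s: "0 \<le> s" "s \<le> t" and ac: "abs_continuous_on s t F"
    and dF: "\<And>\<tau> \<delta> v. \<tau> \<in> {s..t} \<Longrightarrow> (\<And>i. i \<in> {1..N} \<Longrightarrow> (r i has_real_derivative \<delta> i) (at \<tau> within {s..t})) \<Longrightarrow>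
      (\<And>i k. i \<in> {1..N} \<Longrightarrow> ((\<lambda>s. x s i k) has_real_derivative v i k) (at \<tau> within {s..t})) \<Longrightarrow>
      (\<And>i. i \<in> {1..N} \<Longrightarrow> \<delta> i \<le> 0) \<Longrightarrow> (\<And>i. i \<in> {1..N} \<Longrightarrow> (\<Sum>j\<in>{1..N}. \<delta> j) \<le> - \<sigma> i \<tau>) \<Longrightarrow>
      (\<And>i k. i \<in> {1..N} \<Longrightarrow> k < n \<Longrightarrow> \<bar>v i k\<bar> \<le> \<sigma> i \<tau>) \<Longrightarrow>
      \<exists>d\<le>0. (F has_real_derivative d) (at \<tau> within {s..t})"
    for F :: "real \<Rightarrow> real" and s t
  proof -
    have sub: "{s..t} \<subseteq> {0..t + 1}" using s by auto
    obtain Z where Z: "negligible Z" "\<And>\<tau>. \<tau> \<in> {0..t + 1} - Z \<Longrightarrow> \<exists>\<delta> v. \<forall>i\<in>{1..N}.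
       (r i has_real_derivative \<delta> i) (at \<tau> within {0..t + 1}) \<and>
       (\<forall>k. ((\<lambda>s. x s i k) has_real_derivative v i k) (at \<tau> within {0..t + 1})) \<and>
       \<delta> i \<le> 0 \<and> (\<Sum>j\<in>{1..N}. \<delta> j) \<le> - \<sigma> i \<tau> \<and> (\<forall>k<n. \<bar>v i k\<bar> \<le> \<sigma> i \<tau>)"
      by (rule nearest_distances_decay[OF N a on[OF order_trans[OF s]], folded r_def, folded \<sigma>_def]) (rule that)
    show ?thesis
    proof (rule abs_continuous_nonincreasing[OF s(2) ac Z(1)])
      fix \<tau> assume \<tau>: "\<tau> \<in> {s..t} - Z"
      then have "\<tau> \<in> {0..t + 1} - Z" using sub by blast
      from Z(2)[OF this] obtain \<delta> v where \<delta>v: "\<forall>i\<in>{1..N}.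
       (r i has_real_derivative \<delta> i) (at \<tau> within {0..t + 1}) \<and>
       (\<forall>k. ((\<lambda>s. x s i k) has_real_derivative v i k) (at \<tau> within {0..t + 1})) \<and>
       \<delta> i \<le> 0 \<and> (\<Sum>j\<in>{1..N}. \<delta> j) \<le> - \<sigma> i \<tau> \<and> (\<forall>k<n. \<bar>v i k\<bar> \<le> \<sigma> i \<tau>)" by blast
      show "\<exists>d\<le>0. (F has_real_derivative d) (at \<tau> within {s..t})"
      proof (rule dF[of \<tau> \<delta> v])
        show "\<tau> \<in> {s..t}" using \<tau> by blast
        show "(r i has_real_derivative \<delta> i) (at \<tau> within {s..t})" if "i \<in> {1..N}" for i
          using \<delta>v that DERIV_subset[OF _ sub] by blast
        show "((\<lambda>s. x s i k) has_real_derivative v i k) (at \<tau> within {s..t})" if "i \<in> {1..N}" for i k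
          using \<delta>v that DERIV_subset[OF _ sub] by blast
      qed (use \<delta>v in blast)+
    qed
  qed
  have ac_r: "abs_continuous_on s t (r i)" if "0 \<le> s" "s \<le> t" "i \<in> {1..N}" for s t i
    unfolding r_def using that
    by (intro abs_continuous_on_subinterval[OF abs_continuous_on_nn_dist[OF cur[of t] N]]) auto
  have ac_x: "abs_continuous_on s t (\<lambda>t. x t i k)" if "0 \<le> s" "s \<le> t" "i \<in> {1..N}" "k < n" for s t i k
    using that by (intro abs_continuous_on_subinterval[OF abs_continuous_curve_coord[OF cur[of t]]]) auto
  have ac_W: "abs_continuous_on s t W" if "0 \<le> s" "s \<le> t" for s t
    unfolding W_def using that by (intro abs_continuous_on_sum ac_r) auto
  have W_deriv: "(W has_real_derivative (\<Sum>i\<in>{1..N}. \<delta> i)) (at \<tau> within A)"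
    if "\<And>i. i \<in> {1..N} \<Longrightarrow> (r i has_real_derivative \<delta> i) (at \<tau> within A)" for \<delta> \<tau> A
    unfolding W_def using that by (intro DERIV_sum) auto
  have r_dec: "r i t \<le> r i s" if "0 \<le> s" "s \<le> t" "i \<in> {1..N}" for s t i
    by (rule decay[OF that(1,2) ac_r[OF that]]) (use that(3) in blast)
  have Wx_dec: "W t + c * x t i k \<le> W s + c * x s i k"
    if "0 \<le> s" "s \<le> t" "i \<in> {1..N}" "k < n" "\<bar>c\<bar> \<le> 1" for s t i k c
  proof (rule decay[OF that(1,2)])
    show "abs_continuous_on s t (\<lambda>t. W t + c * x t i k)"
      using that by (intro abs_continuous_on_add abs_continuous_on_cmult ac_W ac_x) auto
    fix \<tau> \<delta> v
    assume d: "\<And>i. i \<in> {1..N} \<Longrightarrow> (r i has_real_derivative \<delta> i) (at \<tau> within {s..t})"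
      "\<And>i k. i \<in> {1..N} \<Longrightarrow> ((\<lambda>s. x s i k) has_real_derivative v i k) (at \<tau> within {s..t})"
      and b: "\<And>i. i \<in> {1..N} \<Longrightarrow> (\<Sum>j\<in>{1..N}. \<delta> j) \<le> - \<sigma> i \<tau>"
      "\<And>i k. i \<in> {1..N} \<Longrightarrow> k < n \<Longrightarrow> \<bar>v i k\<bar> \<le> \<sigma> i \<tau>"
    have "((\<lambda>t. W t + c * x t i k) has_real_derivative (\<Sum>i\<in>{1..N}. \<delta> i) + c * v i k) (at \<tau> within {s..t})"
      using W_deriv d that(3) by (intro DERIV_add DERIV_cmult) auto
    moreover have "\<bar>c * v i k\<bar> \<le> 1 * \<sigma> i \<tau>"
      unfolding abs_mult using that(5) b(2)[OF that(3,4)] by (intro mult_mono) auto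
    then have "(\<Sum>i\<in>{1..N}. \<delta> i) + c * v i k \<le> 0" using b(1)[OF that(3)] by linarith
    ultimately show "\<exists>d\<le>0. ((\<lambda>t. W t + c * x t i k) has_real_derivative d) (at \<tau> within {s..t})" by blast
  qed
  have conv: "\<exists>l. ((\<lambda>t. x t i k) \<longlongrightarrow> l) at_top" if ik: "i \<in> {1..N}" "k < n" for i k
  proof -
    obtain l1 where l1: "(W \<longlongrightarrow> l1) at_top"
    proof -
      have "W t \<le> W s" if "0 \<le> s" "s \<le> t" for s t
        using Wx_dec[OF that ik, of 0] by simp
      from nonincreasing_bounded_below_converges[of W, OF this W0] show thesis by (rule that)
    qed
    obtain l2 where l2: "((\<lambda>t. W t + 1 * x t i k) \<longlongrightarrow> l2) at_top"
    proof -
      have "x 0 i k - W 0 \<le> W t + 1 * x t i k" if "0 \<le> t" for t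
        using Wx_dec[OF order_refl that ik, of "-1"] W0[of t] by simp
      then have "((\<lambda>t. W t + 1 * x t i k) \<longlongrightarrow> Inf ((\<lambda>t. W t + 1 * x t i k) ` {0..})) at_top"
        by (intro nonincreasing_bounded_below_converges[where b = "x 0 i k - W 0"] Wx_dec ik) auto
      then show thesis by (rule that)
    qed
    show ?thesis using tendsto_diff[OF l2 l1] by auto
  qed
  obtain z where z: "z \<in> state_space N n" "(x \<longlongrightarrow> z) at_top"
    using state_converges[of x N n, OF st conv] by blast
  have r_small: "\<exists>t\<ge>T. r i t < \<rho>" if i: "i \<in> {1..N}" and \<rho>: "\<rho> > 0" for i \<rho> T
  proof (rule ccontr)
    assume "\<not> (\<exists>t\<ge>T. r i t < \<rho>)"
    then have r_ge: "\<rho> \<le> r i t" if "t \<ge> T" for t using that by force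
    define s where "s = max 0 T"
    define \<eta> where "\<eta> = a \<rho> * \<rho>"
    have \<eta>: "\<eta> > 0" using \<rho> interaction_pos[OF a] by (simp add: \<eta>_def)
    \<comment> \<open>By this time \<open>W\<close> would be negative.\<close>
    define t where "t = s + (W s + 1) / \<eta>"
    have st': "0 \<le> s" "s \<le> t" using \<eta> W0[of s] by (auto simp: s_def t_def)
    have "W t + \<eta> * t \<le> W s + \<eta> * s"
    proof (rule decay[OF st'])
      show "abs_continuous_on s t (\<lambda>t. W t + \<eta> * t)"
        using st' by (intro abs_continuous_on_add abs_continuous_on_cmult abs_continuous_on_ident ac_W)
      fix \<tau> \<delta> v
      assume \<tau>: "\<tau> \<in> {s..t}"
        and d: "\<And>i. i \<in> {1..N} \<Longrightarrow> (r i has_real_derivative \<delta> i) (at \<tau> within {s..t})"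
        and b: "\<And>i. i \<in> {1..N} \<Longrightarrow> (\<Sum>j\<in>{1..N}. \<delta> j) \<le> - \<sigma> i \<tau>"
      have "((\<lambda>t. W t + \<eta> * t) has_real_derivative (\<Sum>i\<in>{1..N}. \<delta> i) + \<eta> * 1) (at \<tau> within {s..t})"
        by (intro DERIV_add DERIV_cmult DERIV_ident W_deriv d)
      moreover have "\<eta> \<le> \<sigma> i \<tau>"
        unfolding \<eta>_def \<sigma>_def using r_ge[of \<tau>] \<tau> \<rho> interaction_mono[OF a, of \<rho>] interaction_nonneg[OF a]
        by (intro mult_mono) (auto simp: s_def)
      then have "(\<Sum>i\<in>{1..N}. \<delta> i) + \<eta> * 1 \<le> 0" using b[OF i] by linarith
      ultimately show "\<exists>d\<le>0. ((\<lambda>t. W t + \<eta> * t) has_real_derivative d) (at \<tau> within {s..t})" by blast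
    qed
    moreover have "\<eta> * t = \<eta> * s + \<eta> * ((W s + 1) / \<eta>)" by (simp only: t_def distrib_left)
    moreover have "\<eta> * ((W s + 1) / \<eta>) = W s + 1" using \<eta> by simp
    ultimately show False using W0[of t] by linarith
  qed
  have "z i = z j" if i: "i \<in> {1..N}" and j: "j \<in> topological_nbrs N n 1 z i" for i j
  proof (rule ccontr)
    assume ne: "z i \<noteq> z j"
    have j_near: "j = nearest N n z i" using j nearest_props(1)[OF N i] by simp
    then have jV: "j \<in> {1..N} - {i}" using nearest_props(2)[OF N i] by simp
    define e where "e = enorm n (z j - z i)"
    have "e \<noteq> 0" using ne enorm_eq_0_iff[of "z j" n "z i"] state_spaceD[OF z(1)] i jV by (auto simp: e_def)
    then have e: "e > 0" by (simp add: e_def order_less_le)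
    have "eventually (\<lambda>t. \<forall>l\<in>{1..N} - {i}. e / 2 < enorm n (x t l - x t i)) at_top"
    proof (intro eventually_ball_finite ballI)
      fix l assume "l \<in> {1..N} - {i}"
      then have "e \<le> enorm n (z l - z i)"
        using nearest_props(3)[OF N i, of l n z] j_near by (auto simp: e_def)
      then have "e / 2 < enorm n (z l - z i)" using e by linarith
      then show "eventually (\<lambda>t. e / 2 < enorm n (x t l - x t i)) at_top"
        by (rule order_tendstoD(1)[OF tendsto_enorm_diff[OF z(2)]])
    qed simp
    then obtain T where T: "\<And>t l. t \<ge> T \<Longrightarrow> l \<in> {1..N} - {i} \<Longrightarrow> e / 2 < enorm n (x t l - x t i)"
      unfolding eventually_at_top_linorder by blast
    obtain t where t: "t \<ge> T" "r i t < e / 2" using r_small[OF i, of "e/2" T] e by auto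
    then show False
      using T[OF t(1) nearest_props(2)[OF N i, of n "x t"]] nn_dist_nearest[OF N i, of n "x t"] by (simp add: r_def)
  qed
  then have "cluster_point N n (topological_nbrs N n 1) z" using z(1) by (auto simp: cluster_point_def)
  then show ?thesis unfolding converges_to_cluster_def using z(2) by blast
qed

theorem theorem2:
  shows
    "(\<comment> \<open>(i)\<close>
      \<forall>N n a x. N \<ge> 2 \<and> n \<ge> 1 \<and> interaction a \<and>
        (caratheodory_solution N n (metric_model N n a) x \<or>
         krasovsky_solution N n (metric_model N n a) x) \<longrightarrow>
        average_preserving N x \<and> support_contracting N x \<and>
        converges_to_cluster N n (metric_nbrs N n) x) \<and>
     (\<comment> \<open>(ii)\<close>
      \<forall>N n \<kappa> a x. N \<ge> 2 \<and> n \<ge> 1 \<and> 1 \<le> \<kappa> \<and> \<kappa> \<le> N - 1 \<and> interaction a \<and>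
        (caratheodory_solution N n (topological_model N n \<kappa> a) x \<or>
         krasovsky_solution N n (topological_model N n \<kappa> a) x) \<longrightarrow>
        support_contracting N x) \<and>
     (\<exists>N n \<kappa> a x. N \<ge> 2 \<and> n \<ge> 1 \<and> 1 \<le> \<kappa> \<and> \<kappa> \<le> N - 1 \<and> interaction a \<and>
        caratheodory_solution N n (topological_model N n \<kappa> a) x \<and>
        \<not> average_preserving N x) \<and>
     (\<exists>N n \<kappa> a x. N \<ge> 2 \<and> n \<ge> 1 \<and> 1 \<le> \<kappa> \<and> \<kappa> \<le> N - 1 \<and> interaction a \<and>
        krasovsky_solution N n (topological_model N n \<kappa> a) x \<and>
        \<not> average_preserving N x) \<and>
     (\<exists>N n \<kappa> a x. N \<ge> 2 \<and> n \<ge> 1 \<and> 1 \<le> \<kappa> \<and> \<kappa> \<le> N - 1 \<and> interaction a \<and>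
        caratheodory_solution N n (topological_model N n \<kappa> a) x \<and>
        \<not> converges_to_cluster N n (topological_nbrs N n \<kappa>) x) \<and>
     (\<exists>N n \<kappa> a x. N \<ge> 2 \<and> n \<ge> 1 \<and> 1 \<le> \<kappa> \<and> \<kappa> \<le> N - 1 \<and> interaction a \<and>
        krasovsky_solution N n (topological_model N n \<kappa> a) x \<and>
        \<not> converges_to_cluster N n (topological_nbrs N n \<kappa>) x) \<and>
     (\<comment> \<open>(iii)\<close>
      \<forall>N n \<kappa> a x. N \<ge> 2 \<and> n \<ge> 1 \<and> \<kappa> = 1 \<and> interaction a \<and>
        caratheodory_solution N n (topological_model N n \<kappa> a) x \<longrightarrow>
        converges_to_cluster N n (topological_nbrs N n \<kappa>) x)"
proof (intro conjI allI impI; (elim conjE)?)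
  fix N n :: nat and a x
  assume "N \<ge> 2" and a: "interaction a"
    and sol: "caratheodory_solution N n (metric_model N n a) x \<or>
      krasovsky_solution N n (metric_model N n a) x"
  then have kras: "krasovsky_solution N n (metric_model N n a) x"
    using caratheodory_imp_krasovsky by blast
  show "average_preserving N x" using a kras by (rule metric_average_preserving)
  show "support_contracting N x"
    using \<open>N \<ge> 2\<close> by (intro krasovsky_support_contracting[OF a _ _ kras]) (auto simp: metric_nbrs_def)
  show "converges_to_cluster N n (metric_nbrs N n) x" using a kras by (rule metric_converges_to_cluster)
next
  fix N n \<kappa> :: nat and a x
  assume "N \<ge> 2" and a: "interaction a"
    and sol: "caratheodory_solution N n (topological_model N n \<kappa> a) x \<or>
      krasovsky_solution N n (topological_model N n \<kappa> a) x"
  then have kras: "krasovsky_solution N n (topological_model N n \<kappa> a) x"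
    using caratheodory_imp_krasovsky by blast
  show "support_contracting N x"
  proof (rule krasovsky_support_contracting[OF a _ _ kras])
    show "topological_nbrs N n \<kappa> y i \<subseteq> {1..N}" for y i
      using topological_nbrs_subset by blast
  qed (use \<open>N \<ge> 2\<close> in simp)
next
  show "\<exists>N n \<kappa> a x. N \<ge> 2 \<and> n \<ge> 1 \<and> 1 \<le> \<kappa> \<and> \<kappa> \<le> N - 1 \<and> interaction a \<and>
        caratheodory_solution N n (topological_model N n \<kappa> a) x \<and> \<not> average_preserving N x"
    by (intro exI[of _ 3] exI[of _ 1] exI[of _ "\<lambda>_. 1"] exI[of _ follower] conjI interaction_one
        follower_solution follower_not_average_preserving) auto
  show "\<exists>N n \<kappa> a x. N \<ge> 2 \<and> n \<ge> 1 \<and> 1 \<le> \<kappa> \<and> \<kappa> \<le> N - 1 \<and> interaction a \<and>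
        krasovsky_solution N n (topological_model N n \<kappa> a) x \<and> \<not> average_preserving N x"
    by (intro exI[of _ 3] exI[of _ 1] exI[of _ "\<lambda>_. 1"] exI[of _ follower] conjI interaction_one
        caratheodory_imp_krasovsky[OF follower_solution] follower_not_average_preserving) auto
  show "\<exists>N n \<kappa> a x. N \<ge> 2 \<and> n \<ge> 1 \<and> 1 \<le> \<kappa> \<and> \<kappa> \<le> N - 1 \<and> interaction a \<and>
        caratheodory_solution N n (topological_model N n \<kappa> a) x \<and>
        \<not> converges_to_cluster N n (topological_nbrs N n \<kappa>) x"
    by (intro exI[of _ 7] exI[of _ 1] exI[of _ 2] exI[of _ "\<lambda>_. 1"] exI[of _ "\<lambda>_. torn"] conjI interaction_one
        torn_solution torn_not_converging_to_cluster) auto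
  show "\<exists>N n \<kappa> a x. N \<ge> 2 \<and> n \<ge> 1 \<and> 1 \<le> \<kappa> \<and> \<kappa> \<le> N - 1 \<and> interaction a \<and>
        krasovsky_solution N n (topological_model N n \<kappa> a) x \<and>
        \<not> converges_to_cluster N n (topological_nbrs N n \<kappa>) x"
    by (intro exI[of _ 7] exI[of _ 1] exI[of _ 2] exI[of _ "\<lambda>_. 1"] exI[of _ "\<lambda>_. torn"] conjI interaction_one
        caratheodory_imp_krasovsky[OF torn_solution] torn_not_converging_to_cluster) auto
next
  fix N n \<kappa> :: nat and a x
  assume "N \<ge> 2" "\<kappa> = 1" "interaction a" "caratheodory_solution N n (topological_model N n \<kappa> a) x"
  then show "converges_to_cluster N n (topological_nbrs N n \<kappa>) x"
    using nearest_neighbour_converges_to_cluster by blast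
qed

end
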